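(* Given an instance $(V,T)$ of the Generalized Euclidean Traveling Salesman Problem with $n=|V|$ inner points and $m=|T|$ terminal pairs, where $m\ge n^{2}$, one can find a set $T_0\subseteq T$ with $|T_0|=m-n^{2}$ such that there exists an optimal solution in which every path built on a pair from $T_0$ is redundant. This can be done in $\mathcal{O}(mn^{2}+n^{6})$ time and $\mathcal{O}(m)$ space.
   Context: Generalized Euclidean Traveling Salesman Problem: the input is a finite set $V=\{v_1,\dots,v_n\}$ of points in the plane (inner points) and a set $T=\{(t_1,t'_1),\dots,(t_m,t'_m)\}$ of terminal pairs of points in the plane. A solution is a collection of $m$ polygonal paths such that the $i$-th path starts at $t_i$, ends at $t'_i$ (it is "built on" $(t_i,t'_i)$), and its intermediate vertices are points of $V$, with every point of $V$ appearing in exactly one of the paths. The cost of a solution is the total Euclidean length of all its segments; an optimal solution minimizes this cost. It is assumed (as a promise on the input) that in any optimal solution the paths have no self-intersections and no two paths intersect except possibly at their endpoints. A path of a solution is redundant if it contains no point of $V$ (i.e., it is the single segment $t_it'_i$), and important otherwise. The computational model is the Real RAM, in which Euclidean distances are computed exactly in constant time. *)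

theory Defs
  imports "HOL-Analysis.Analysis"
begin

section \<open>The Generalized Euclidean Traveling Salesman Problem\<close>

type_synonym point = "real ^ 2"
type_synonym terminal_pair = "point \<times> point"

text \<open>A solution maps every terminal pair to the list of intermediate vertices, in order, of the
  path built on it; its values outside the given set of pairs are irrelevant.\<close>

type_synonym path_system = "terminal_pair \<Rightarrow> point list"

definition path_vertices :: "path_system \<Rightarrow> terminal_pair \<Rightarrow> point list" where
  "path_vertices s p = fst p # s p @ [snd p]"

definition gtsp_solution :: "point set \<Rightarrow> terminal_pair set \<Rightarrow> path_system \<Rightarrow> bool" where
  "gtsp_solution V T s \<longleftrightarrow>
     (\<forall>p\<in>T. distinct (s p) \<and> set (s p) \<subseteq> V) \<and>
     (\<forall>v\<in>V. \<exists>!p. p \<in> T \<and> v \<in> set (s p))"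

definition polyline_length :: "point list \<Rightarrow> real" where
  "polyline_length ps = (\<Sum>i<length ps - 1. dist (ps ! i) (ps ! Suc i))"

definition gtsp_cost :: "terminal_pair set \<Rightarrow> path_system \<Rightarrow> real" where
  "gtsp_cost T s = (\<Sum>p\<in>T. polyline_length (path_vertices s p))"

definition gtsp_optimal :: "point set \<Rightarrow> terminal_pair set \<Rightarrow> path_system \<Rightarrow> bool" where
  "gtsp_optimal V T s \<longleftrightarrow>
     gtsp_solution V T s \<and> (\<forall>s'. gtsp_solution V T s' \<longrightarrow> gtsp_cost T s \<le> gtsp_cost T s')"

definition redundant_path :: "path_system \<Rightarrow> terminal_pair \<Rightarrow> bool" where
  "redundant_path s p \<longleftrightarrow> s p = []"

definition polyline_segment :: "point list \<Rightarrow> nat \<Rightarrow> point set" where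
  "polyline_segment ps i = closed_segment (ps ! i) (ps ! Suc i)"

definition polyline_image :: "point list \<Rightarrow> point set" where
  "polyline_image ps = (\<Union>i<length ps - 1. polyline_segment ps i)"

text \<open>Consecutive segments may meet only in their common vertex and all others are disjoint, except
  that the first and the last segment of a closed polyline (\<open>t = t'\<close>) also meet in its base point.\<close>

definition no_self_intersection :: "point list \<Rightarrow> bool" where
  "no_self_intersection ps \<longleftrightarrow>
     (\<forall>i j. i < j \<and> Suc j < length ps \<longrightarrow>
        polyline_segment ps i \<inter> polyline_segment ps j \<subseteq>
          (if j = Suc i then {ps ! j} else {}) \<union>
          (if i = 0 \<and> Suc (Suc j) = length ps then {hd ps} \<inter> {last ps} else {}))"

definition noncrossing :: "terminal_pair set \<Rightarrow> path_system \<Rightarrow> bool" where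
  "noncrossing T s \<longleftrightarrow>
     (\<forall>p\<in>T. no_self_intersection (path_vertices s p)) \<and>
     (\<forall>p\<in>T. \<forall>q\<in>T. p \<noteq> q \<longrightarrow>
        polyline_image (path_vertices s p) \<inter> polyline_image (path_vertices s q)
          \<subseteq> {fst p, snd p} \<inter> {fst q, snd q})"

definition gtsp_promise :: "point set \<Rightarrow> terminal_pair set \<Rightarrow> bool" where
  "gtsp_promise V T \<longleftrightarrow> (\<forall>s. gtsp_optimal V T s \<longrightarrow> noncrossing T s)"


section \<open>The Real RAM\<close>

text \<open>
  The machine has integer words and exact reals. Each sort has registers, whose names are part of
  the program text (so a program uses only finitely many of them), and a random-access memory that
  is addressed by computed words. Every operation takes unit time, including exact square roots,
  so that a Euclidean distance takes constant time. The only real constants are casts of words, and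
  there is no conversion from reals to words (no rounding).

  The semantics has two parameters: a word bound \<open>w\<close> (words range over \<open>{0..<w}\<close>) and a memory
  size \<open>S\<close> (each of the two memories has the addresses \<open>{0..<S}\<close>). Overflow, access to an address
  outside the memory, division by zero and the square root of a negative number are errors: the
  value is \<open>None\<close> and a program that evaluates it has no terminating run. Boolean connectives
  evaluate both arguments; subtraction of words is truncated at zero.
\<close>

record rr_state =
  ireg :: "nat \<Rightarrow> nat"
  rreg :: "nat \<Rightarrow> real"
  imem :: "nat \<Rightarrow> nat"
  rmem :: "nat \<Rightarrow> real"

datatype iop = IAdd | ISub | IMul | IDiv | IMod

datatype iexp = INum nat | IReg nat | IMem iexp | IBin iop iexp iexp

datatype rop = RAdd | RSub | RMul | RDiv

datatype rexp = RCast iexp | RReg nat | RMem iexp | RBin rop rexp rexp | RSqrt rexp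

datatype bexp = ILess iexp iexp | RLess rexp rexp | BNot bexp | BAnd bexp bexp

datatype com =
    Skip
  | ISet nat iexp
  | RSet nat rexp
  | IStore iexp iexp
  | RStore iexp rexp
  | Seq com com
  | Cond bexp com com
  | While bexp com

definition word :: "nat \<Rightarrow> nat \<Rightarrow> nat option" where
  "word w x = (if x < w then Some x else None)"

fun iop_apply :: "nat \<Rightarrow> iop \<Rightarrow> nat \<Rightarrow> nat \<Rightarrow> nat option" where
  "iop_apply w IAdd x y = word w (x + y)"
| "iop_apply w ISub x y = word w (x - y)"
| "iop_apply w IMul x y = word w (x * y)"
| "iop_apply w IDiv x y = (if y = 0 then None else word w (x div y))"
| "iop_apply w IMod x y = (if y = 0 then None else word w (x mod y))"

fun rop_apply :: "rop \<Rightarrow> real \<Rightarrow> real \<Rightarrow> real option" where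
  "rop_apply RAdd x y = Some (x + y)"
| "rop_apply RSub x y = Some (x - y)"
| "rop_apply RMul x y = Some (x * y)"
| "rop_apply RDiv x y = (if y = 0 then None else Some (x / y))"

fun ieval :: "nat \<Rightarrow> nat \<Rightarrow> rr_state \<Rightarrow> iexp \<Rightarrow> nat option" where
  "ieval w S s (INum k) = word w k"
| "ieval w S s (IReg r) = Some (ireg s r)"
| "ieval w S s (IMem e) =
     Option.bind (ieval w S s e) (\<lambda>a. if a < S then Some (imem s a) else None)"
| "ieval w S s (IBin f d e) =
     Option.bind (ieval w S s d) (\<lambda>x. Option.bind (ieval w S s e) (\<lambda>y. iop_apply w f x y))"

fun reval :: "nat \<Rightarrow> nat \<Rightarrow> rr_state \<Rightarrow> rexp \<Rightarrow> real option" where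
  "reval w S s (RCast e) = map_option real (ieval w S s e)"
| "reval w S s (RReg r) = Some (rreg s r)"
| "reval w S s (RMem e) =
     Option.bind (ieval w S s e) (\<lambda>a. if a < S then Some (rmem s a) else None)"
| "reval w S s (RBin f d e) =
     Option.bind (reval w S s d) (\<lambda>x. Option.bind (reval w S s e) (\<lambda>y. rop_apply f x y))"
| "reval w S s (RSqrt e) =
     Option.bind (reval w S s e) (\<lambda>x. if x < 0 then None else Some (sqrt x))"

fun beval :: "nat \<Rightarrow> nat \<Rightarrow> rr_state \<Rightarrow> bexp \<Rightarrow> bool option" where
  "beval w S s (ILess d e) =
     Option.bind (ieval w S s d) (\<lambda>x. Option.bind (ieval w S s e) (\<lambda>y. Some (x < y)))"
| "beval w S s (RLess d e) =
     Option.bind (reval w S s d) (\<lambda>x. Option.bind (reval w S s e) (\<lambda>y. Some (x < y)))"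
| "beval w S s (BNot b) = map_option Not (beval w S s b)"
| "beval w S s (BAnd b c) =
     Option.bind (beval w S s b) (\<lambda>x. Option.bind (beval w S s c) (\<lambda>y. Some (x \<and> y)))"

fun icost :: "iexp \<Rightarrow> nat" where
  "icost (INum k) = 1"
| "icost (IReg r) = 1"
| "icost (IMem e) = 1 + icost e"
| "icost (IBin f d e) = 1 + icost d + icost e"

fun rcost :: "rexp \<Rightarrow> nat" where
  "rcost (RCast e) = 1 + icost e"
| "rcost (RReg r) = 1"
| "rcost (RMem e) = 1 + icost e"
| "rcost (RBin f d e) = 1 + rcost d + rcost e"
| "rcost (RSqrt e) = 1 + rcost e"

fun bcost :: "bexp \<Rightarrow> nat" where
  "bcost (ILess d e) = 1 + icost d + icost e"
| "bcost (RLess d e) = 1 + rcost d + rcost e"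
| "bcost (BNot b) = 1 + bcost b"
| "bcost (BAnd b c) = 1 + bcost b + bcost c"

text \<open>\<open>rr_exec w S c s k s'\<close>: on the machine with word bound \<open>w\<close> and memory size \<open>S\<close>, the program \<open>c\<close>
  started in state \<open>s\<close> halts without error after \<open>k\<close> time units in state \<open>s'\<close>.\<close>

inductive rr_exec :: "nat \<Rightarrow> nat \<Rightarrow> com \<Rightarrow> rr_state \<Rightarrow> nat \<Rightarrow> rr_state \<Rightarrow> bool"
  for w :: nat and S :: nat where
  Skip: "rr_exec w S Skip s 1 s"
| ISet: "ieval w S s e = Some x \<Longrightarrow>
    rr_exec w S (ISet r e) s (1 + icost e) (s\<lparr>ireg := (ireg s)(r := x)\<rparr>)"
| RSet: "reval w S s e = Some x \<Longrightarrow>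
    rr_exec w S (RSet r e) s (1 + rcost e) (s\<lparr>rreg := (rreg s)(r := x)\<rparr>)"
| IStore: "ieval w S s d = Some a \<Longrightarrow> a < S \<Longrightarrow> ieval w S s e = Some x \<Longrightarrow>
    rr_exec w S (IStore d e) s (1 + icost d + icost e) (s\<lparr>imem := (imem s)(a := x)\<rparr>)"
| RStore: "ieval w S s d = Some a \<Longrightarrow> a < S \<Longrightarrow> reval w S s e = Some x \<Longrightarrow>
    rr_exec w S (RStore d e) s (1 + icost d + rcost e) (s\<lparr>rmem := (rmem s)(a := x)\<rparr>)"
| Seq: "rr_exec w S c s k s' \<Longrightarrow> rr_exec w S d s' l s'' \<Longrightarrow>
    rr_exec w S (Seq c d) s (k + l) s''"
| CondTrue: "beval w S s b = Some True \<Longrightarrow> rr_exec w S c s k s' \<Longrightarrow>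
    rr_exec w S (Cond b c d) s (1 + bcost b + k) s'"
| CondFalse: "beval w S s b = Some False \<Longrightarrow> rr_exec w S d s k s' \<Longrightarrow>
    rr_exec w S (Cond b c d) s (1 + bcost b + k) s'"
| WhileFalse: "beval w S s b = Some False \<Longrightarrow>
    rr_exec w S (While b c) s (1 + bcost b) s"
| WhileTrue: "beval w S s b = Some True \<Longrightarrow> rr_exec w S c s k s' \<Longrightarrow>
    rr_exec w S (While b c) s' l s'' \<Longrightarrow>
    rr_exec w S (While b c) s (1 + bcost b + k + l) s''"

inductive_cases SkipE: "rr_exec w S Skip s k s'"
inductive_cases ISetE: "rr_exec w S (ISet r e) s k s'"
inductive_cases RSetE: "rr_exec w S (RSet r e) s k s'"
inductive_cases IStoreE: "rr_exec w S (IStore d e) s k s'"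
inductive_cases RStoreE: "rr_exec w S (RStore d e) s k s'"
inductive_cases SeqE: "rr_exec w S (Seq c d) s k s'"
inductive_cases CondE: "rr_exec w S (Cond b c d) s k s'"
inductive_cases WhileE: "rr_exec w S (While b c) s k s'"

lemma rr_exec_deterministic:
  "rr_exec w S c s k s' \<Longrightarrow> rr_exec w S c s l t' \<Longrightarrow> k = l \<and> s' = t'"
proof (induction arbitrary: l t' rule: rr_exec.induct)
  case Skip
  from Skip.prems show ?case by (rule SkipE) simp
next
  case ISet
  from ISet.prems show ?case by (rule ISetE) (use ISet.hyps in simp)
next
  case RSet
  from RSet.prems show ?case by (rule RSetE) (use RSet.hyps in simp)
next
  case IStore
  from IStore.prems show ?case by (rule IStoreE) (use IStore.hyps in simp)
next
  case RStore
  from RStore.prems show ?case by (rule RStoreE) (use RStore.hyps in simp)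
next
  case (Seq c s k s' d k' s'')
  from Seq.prems obtain i u j where l: "l = i + j"
    and c: "rr_exec w S c s i u" and d: "rr_exec w S d u j t'"
    by (rule SeqE)
  from Seq.IH(1)[OF c] have "k = i" "s' = u" by simp_all
  with Seq.IH(2)[of j t'] d l show ?case by simp
next
  case (CondTrue s b c k s' d)
  from CondTrue.prems CondTrue.hyps obtain i where l: "l = 1 + bcost b + i"
    and e: "rr_exec w S c s i t'"
    by (elim CondE) simp_all
  from CondTrue.IH[OF e] l show ?case by simp
next
  case (CondFalse s b d k s' c)
  from CondFalse.prems CondFalse.hyps obtain i where l: "l = 1 + bcost b + i"
    and e: "rr_exec w S d s i t'"
    by (elim CondE) simp_all
  from CondFalse.IH[OF e] l show ?case by simp
next
  case (WhileFalse s b c)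
  from WhileFalse.prems show ?case
    by (rule WhileE) (use WhileFalse.hyps in simp_all)
next
  case (WhileTrue s b c k s' k' s'')
  from WhileTrue.prems obtain i u j where l: "l = 1 + bcost b + i + j"
    and c: "rr_exec w S c s i u" and d: "rr_exec w S (While b c) u j t'"
    by (rule WhileE) (use WhileTrue.hyps in simp_all)
  from WhileTrue.IH(1)[OF c] have "k = i" "s' = u" by simp_all
  with WhileTrue.IH(2)[of j t'] d l show ?case by simp
qed


section \<open>Instances as machine inputs, and machine outputs as sets of terminal pairs\<close>

definition coords :: "point \<Rightarrow> real list" where
  "coords x = [x $ 1, x $ 2]"

definition input_reals :: "point list \<Rightarrow> terminal_pair list \<Rightarrow> real list" where
  "input_reals vs ts =
     concat (map coords vs) @ concat (map (\<lambda>p. coords (fst p) @ coords (snd p)) ts)"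

text \<open>The word registers 0 and 1 hold \<open>n\<close> and \<open>m\<close>, the real memory starts with the coordinates of
  the inner points followed by those of the terminal pairs, and everything else is zero.\<close>

definition rr_input :: "point list \<Rightarrow> terminal_pair list \<Rightarrow> rr_state" where
  "rr_input vs ts =
     \<lparr> ireg = (\<lambda>_. 0)(0 := length vs, 1 := length ts),
       rreg = (\<lambda>_. 0),
       imem = (\<lambda>_. 0),
       rmem = (\<lambda>a. if a < length (input_reals vs ts) then input_reals vs ts ! a else 0) \<rparr>"

text \<open>The first \<open>k\<close> cells of the word memory of the final state list, without repetition,
  the positions in the input of the elements of the output set.\<close>

definition rr_outputs :: "rr_state \<Rightarrow> terminal_pair list \<Rightarrow> nat \<Rightarrow> terminal_pair set \<Rightarrow> bool" where
  "rr_outputs s ts k T0 \<longleftrightarrow>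
     (\<forall>i<k. imem s i < length ts) \<and> inj_on (imem s) {..<k} \<and>
     T0 = (\<lambda>i. ts ! imem s i) ` {..<k}"

end

theory Submission
  imports Defs
begin

text \<open>
  An important path of a solution is determined, up to its terminal pair, by its sequence of inner
  points; moving it to the terminal pair \<open>p\<close> changes the cost only through its first and last inner
  points \<open>r = (a, b)\<close>, namely by \<open>detour r p\<close>. Compute a minimum-cost matching of all \<open>n\<^sup>2\<close> pairs \<open>r\<close>
  into the terminal pairs. An exchange argument with the dual potentials of that matching moves all
  important paths of an optimal solution onto matched terminal pairs without increasing the cost,
  so the \<open>m - n\<^sup>2\<close> unmatched ones can be taken as \<open>T0\<close>.

  The matching is found by the Hungarian method: \<open>n\<^sup>2\<close> phases, each of which grows a search tree in
  time \<open>O(n\<^sup>4 + m)\<close> and space \<open>O(m)\<close>. Unmatched columns have potential zero, so a search only needs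
  the cheapest unmatched column of each row. To find it quickly, the columns are split into blocks of
  \<open>n\<^sup>2\<close>, and a table of about \<open>m\<close> entries stores the cheapest unmatched column for each row and block;
  reading a row of the table takes time \<open>O(m / n\<^sup>2)\<close>, and when a column becomes matched only one block
  per row is recomputed.
\<close>

section \<open>Exchanging terminal pairs\<close>

text \<open>Which rows an optimal solution uses, and where it places them, is unknown. The matching
  must therefore serve all subsets of rows at once. Dual potentials achieve this because they are
  local certificates: their inequalities stay valid on every subset of rows. The two sign
  conditions, column potentials at most zero and equal to zero on unmatched columns, are what pays
  for rerouting a path from an unmatched column to a matched one.

  The time bound rules out scanning all m columns whenever a row joins a search tree: up to n^2
  joins in each of n^2 phases would cost m n^4. The block length n^2 balances the alternatives. A
  join reads about m / n^2 table entries, so the joins of one search cost O(m) for reading. A newly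
  matched column invalidates one block of n^2 columns for each of the n^2 rows, which costs O(n^4)
  per phase. Shorter blocks would make the table larger than O(m), longer ones would make the repair
  too expensive.\<close>

lemma dual_exchange:
  fixes c :: "'a \<Rightarrow> 'b \<Rightarrow> real"
  assumes fin: "finite A" and injN: "inj_on N A" and injM: "inj_on M A" and MK: "M ` A \<subseteq> K"
    and feasible: "\<And>a. a \<in> A \<Longrightarrow> u a + v (N a) \<le> c a (N a)"
    and tight: "\<And>a. a \<in> A \<Longrightarrow> u a + v (M a) = c a (M a)"
    and v_nonpos: "\<And>b. b \<in> K \<Longrightarrow> v b \<le> 0"
    and v_zero: "\<And>b. b \<in> N ` A - K \<Longrightarrow> v b = 0"
  obtains N' where "inj_on N' A" "N' ` A \<subseteq> K" "(\<Sum>a\<in>A. c a (N' a)) \<le> (\<Sum>a\<in>A. c a (N a))"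
proof -
  \<comment> \<open>An edge leads from a row to the row that currently occupies its matched column.
    Sending every row that sits outside \<open>K\<close> to its matched column evicts the occupant
    there, which moves on in turn; \<open>X\<close> collects all rows moved in this way.\<close>
  define E where "E = {(a, a'). a' \<in> A \<and> N a' = M a}"
  define X where "X = E\<^sup>* `` {a \<in> A. N a \<notin> K}"
  have closed: "a' \<in> X" if "a \<in> X" "a' \<in> A" "N a' = M a" for a a'
    using that unfolding X_def E_def by (auto intro: rtrancl_into_rtrancl)
  have XA: "X \<subseteq> A"
  proof
    fix x assume "x \<in> X"
    then obtain a where "a \<in> A" "(a, x) \<in> E\<^sup>*" unfolding X_def by auto
    then show "x \<in> A" by (auto simp: E_def elim: rtranclE)
  qed
  \<comment> \<open>A moved row that sat inside \<open>K\<close> was evicted, so its old column is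
    the new column of another moved row. Hence the moves vacate only columns outside
    \<open>K\<close>.\<close>
  have origin: "N x \<in> M ` X" if x: "x \<in> X" "N x \<in> K" for x
  proof -
    obtain a where a: "a \<in> A" "N a \<notin> K" "(a, x) \<in> E\<^sup>*" using x unfolding X_def by auto
    with x have "a \<noteq> x" by auto
    with a(3) obtain y where y: "(a, y) \<in> E\<^sup>*" "(y, x) \<in> E" by (auto elim: rtranclE)
    with a have "y \<in> X" unfolding X_def by auto
    with y show ?thesis by (auto simp: E_def)
  qed
  have finX: "finite X" using XA fin finite_subset by blast
  have injMX: "inj_on M X" and injNX: "inj_on N X"
    using XA injM injN inj_on_subset by blast+
  define N' where "N' a = (if a \<in> X then M a else N a)" for a
  have "inj_on N' A"
  proof (rule inj_onI)
    fix a b assume ab: "a \<in> A" "b \<in> A" "N' a = N' b"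
    then show "a = b"
      using closed[of a b] closed[of b a] injM injN
      by (auto simp: N'_def inj_on_def split: if_splits)
  qed
  moreover have "N' ` A \<subseteq> K"
  proof -
    have "N a \<in> K" if "a \<in> A" "a \<notin> X" for a
      using that unfolding X_def by auto
    with MK show ?thesis by (auto simp: N'_def)
  qed
  moreover have "(\<Sum>a\<in>A. c a (N' a)) \<le> (\<Sum>a\<in>A. c a (N a))"
  proof -
    have "(\<Sum>a\<in>X. v (M a)) = sum v (M ` X)"
      by (simp add: sum.reindex[OF injMX])
    \<comment> \<open>The columns that become newly occupied lie in \<open>K\<close>, where
      potentials are at most zero. The vacated ones have potential zero, so the next equality can
      add them for free.\<close>
    also have "\<dots> \<le> sum v (N ` X \<inter> K)"
    proof -
      have "N ` X \<inter> K \<subseteq> M ` X" using origin by auto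
      then show ?thesis
        using finX MK XA
        by (subst sum.subset_diff[of "N ` X \<inter> K" "M ` X"])
          (auto intro!: sum_nonpos v_nonpos simp: subset_iff)
    qed
    also have "\<dots> = sum v (N ` X)"
      using finX v_zero XA by (intro sum.mono_neutral_left) auto
    also have "\<dots> = (\<Sum>a\<in>X. v (N a))"
      by (simp add: sum.reindex[OF injNX])
    finally have "(\<Sum>a\<in>X. u a + v (M a)) \<le> (\<Sum>a\<in>X. u a + v (N a))"
      by (simp add: sum.distrib)
    also have "\<dots> \<le> (\<Sum>a\<in>X. c a (N a))"
      using feasible XA by (intro sum_mono) auto
    finally have le: "(\<Sum>a\<in>X. c a (M a)) \<le> (\<Sum>a\<in>X. c a (N a))"
      using tight XA by (simp add: subset_iff)
    have "(\<Sum>a\<in>A. f a) = (\<Sum>a\<in>A - X. f a) + (\<Sum>a\<in>X. f a)" for f :: "'a \<Rightarrow> real"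
      using sum.subset_diff[OF XA fin] .
    then show ?thesis using le by (simp add: N'_def)
  qed
  ultimately show ?thesis by (rule that)
qed

text \<open>Path systems are total functions with arbitrary values outside \<open>T\<close>;
  restricting them to \<open>T\<close> leaves finitely many solutions without changing any cost. The
  third assumption guarantees that some solution exists: all points can be put on one path.\<close>

lemma gtsp_optimal_exists:
  assumes "finite V" "finite T" "V = {} \<or> T \<noteq> {}"
  shows "\<exists>s. gtsp_optimal V T s"
proof -
  let ?L = "{xs. distinct xs \<and> set xs \<subseteq> V}"
  let ?F = "{s \<in> PiE T (\<lambda>_. ?L). gtsp_solution V T s}"
  have "finite ?L"
    by (rule finite_subset[OF _ finite_lists_length_le[OF assms(1), of "card V"]])
      (auto simp: distinct_card[symmetric] card_mono[OF assms(1)])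
  then have fin: "finite ?F" using assms(2) by (auto intro!: finite_PiE simp: Collect_conj_eq)
  have restr: "restrict s T \<in> ?F" "gtsp_cost T (restrict s T) = gtsp_cost T s"
    if "gtsp_solution V T s" for s
    using that
    by (auto simp: gtsp_solution_def gtsp_cost_def path_vertices_def cong: conj_cong)
  obtain vs where vs: "distinct vs" "set vs = V"
    using finite_distinct_list[OF assms(1)] by auto
  obtain s0 where "gtsp_solution V T s0"
  proof (cases "V = {}")
    case True
    then have "gtsp_solution V T (\<lambda>_. [])" by (simp add: gtsp_solution_def)
    then show ?thesis by (rule that)
  next
    case False
    then obtain p where "p \<in> T" using assms(3) by auto
    then have "gtsp_solution V T ((\<lambda>_. [])(p := vs))"
      using vs by (auto simp: gtsp_solution_def)
    then show ?thesis by (rule that)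
  qed
  then have "?F \<noteq> {}" using restr(1) by blast
  then obtain s where s: "s \<in> ?F" "\<And>s'. s' \<in> ?F \<Longrightarrow> gtsp_cost T s \<le> gtsp_cost T s'"
    using ex_is_arg_min_if_finite[OF fin, of "gtsp_cost T"]
    by (auto simp: is_arg_min_linorder)
  have "gtsp_cost T s \<le> gtsp_cost T s'" if "gtsp_solution V T s'" for s'
    using s(2)[OF restr(1)[OF that]] restr(2)[OF that] by simp
  then show ?thesis using s(1) unfolding gtsp_optimal_def by blast
qed

text \<open>The middle term is the same for all terminal pairs; with it the value is nonnegative by
  the triangle inequality, which lets a new row start with potential zero in the Hungarian method. A
  path with a single inner point has \<open>fst r = snd r\<close>.\<close>

definition detour :: "point \<times> point \<Rightarrow> terminal_pair \<Rightarrow> real" where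
  "detour r p = dist (fst p) (fst r) + dist (fst r) (snd r) + dist (snd r) (snd p)
     - dist (fst p) (snd p)"

lemma detour_nonneg: "detour r p \<ge> 0"
proof -
  have "dist (fst p) (snd p) \<le> dist (fst p) (fst r) + dist (fst r) (snd p)"
    by (rule dist_triangle)
  moreover have "dist (fst r) (snd p) \<le> dist (fst r) (snd r) + dist (snd r) (snd p)"
    by (rule dist_triangle)
  ultimately show ?thesis by (simp add: detour_def)
qed

lemma polyline_length_Cons2:
  "polyline_length (x # y # ps) = dist x y + polyline_length (y # ps)"
  by (simp add: polyline_length_def sum.lessThan_Suc_shift del: sum.lessThan_Suc)

lemma polyline_length_snoc:
  "ps \<noteq> [] \<Longrightarrow> polyline_length (ps @ [x]) = polyline_length ps + dist (last ps) x"
proof (induction ps rule: induct_list012)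
  case (3 a b zs)
  then show ?case by (simp add: polyline_length_Cons2)
qed (simp_all add: polyline_length_def)

text \<open>The innermost bracket depends on \<open>xs\<close> alone, so moving a path to another
  terminal pair changes only its detour; the direct distances of all pairs add up to a
  constant.\<close>

lemma polyline_length_through:
  assumes "xs \<noteq> []"
  shows "polyline_length (fst p # xs @ [snd p]) = dist (fst p) (snd p)
    + (detour (hd xs, last xs) p + (polyline_length xs - dist (hd xs) (last xs)))"
proof -
  obtain x ys where xs: "xs = x # ys" using assms by (cases xs) auto
  have "polyline_length (fst p # xs @ [snd p]) = dist (fst p) x + polyline_length (xs @ [snd p])"
    by (simp add: xs polyline_length_Cons2)
  then show ?thesis using assms
    by (simp add: polyline_length_snoc detour_def) (simp add: xs)
qed

text \<open>This instantiates \<open>dual_exchange\<close> with the important paths, named by their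
  terminal pairs: the current position is the identity, and the target is the column matched to the
  first and last inner points of the path.\<close>

lemma optimal_within_matched:
  assumes opt: "gtsp_optimal V T s" and finT: "finite T"
    and injM: "inj_on M (V \<times> V)" and MT: "M ` (V \<times> V) \<subseteq> T"
    and feasible: "\<And>r p. r \<in> V \<times> V \<Longrightarrow> p \<in> T \<Longrightarrow> u r + v p \<le> detour r p"
    and tight: "\<And>r. r \<in> V \<times> V \<Longrightarrow> u r + v (M r) = detour r (M r)"
    and v_nonpos: "\<And>p. p \<in> T \<Longrightarrow> v p \<le> 0"
    and v_zero: "\<And>p. p \<in> T - M ` (V \<times> V) \<Longrightarrow> v p = 0"
  shows "\<exists>s'. gtsp_optimal V T s' \<and> (\<forall>p\<in>T - M ` (V \<times> V). redundant_path s' p)"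
proof -
  define I where "I = {p \<in> T. s p \<noteq> []}"
  define row where "row p = (hd (s p), last (s p))" for p
  define rest where "rest p = polyline_length (s p) - dist (hd (s p)) (last (s p))" for p
  have sol: "gtsp_solution V T s" using opt by (simp add: gtsp_optimal_def)
  then have sub: "set (s p) \<subseteq> V" "distinct (s p)" if "p \<in> T" for p
    using that by (auto simp: gtsp_solution_def)
  have uniq: "p = q" if "p \<in> T" "q \<in> T" "x \<in> set (s p)" "x \<in> set (s q)" for p q x
    using that sol sub(1)[of p] unfolding gtsp_solution_def by blast
  have finI: "finite I" and IT: "I \<subseteq> T" using finT by (auto simp: I_def)
  have rowV: "row p \<in> V \<times> V" if "p \<in> I" for p
    using that sub(1)[of p] hd_in_set[of "s p"] last_in_set[of "s p"]
    by (auto simp: I_def row_def)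
  \<comment> \<open>Every inner point lies on one path only, so already the first inner points of
    different important paths differ.\<close>
  have "inj_on row I"
    using uniq by (intro inj_onI) (auto simp: I_def row_def intro: hd_in_set; metis hd_in_set)
  then have injMr: "inj_on (M \<circ> row) I"
    using rowV inj_on_subset[OF injM] by (intro comp_inj_on) blast+
  obtain N' where N': "inj_on N' I" "N' ` I \<subseteq> M ` (V \<times> V)"
    "(\<Sum>p\<in>I. detour (row p) (N' p)) \<le> (\<Sum>p\<in>I. detour (row p) p)"
  proof (rule dual_exchange[where A = I and N = "\<lambda>p. p" and M = "M \<circ> row" and u = "u \<circ> row"
        and v = v and c = "\<lambda>p. detour (row p)" and K = "M ` (V \<times> V)"])
    show "(M \<circ> row) ` I \<subseteq> M ` (V \<times> V)" using rowV by auto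
    show "(u \<circ> row) p + v p \<le> detour (row p) p" if "p \<in> I" for p
      using that feasible[OF rowV, of p p] IT by auto
    show "v p \<le> 0" if "p \<in> M ` (V \<times> V)" for p
      using that v_nonpos MT by blast
    show "v p = 0" if "p \<in> (\<lambda>p. p) ` I - M ` (V \<times> V)" for p
      using that v_zero[of p] IT by auto
  qed (use finI injMr rowV tight in \<open>auto simp: inj_on_def\<close>)
  define s' where "s' q = (if q \<in> N' ` I then s (inv_into I N' q) else [])" for q
  have s'N: "s' (N' p) = s p" if "p \<in> I" for p
    using that N'(1) by (simp add: s'_def)
  have N'T: "N' ` I \<subseteq> T" using N'(2) MT by blast
  have sol': "gtsp_solution V T s'"
    unfolding gtsp_solution_def
  proof (intro conjI ballI)
    fix q assume "q \<in> T"
    have "inv_into I N' q \<in> T" if "q \<in> N' ` I"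
      using inv_into_into[OF that] IT by blast
    then show "distinct (s' q)" "set (s' q) \<subseteq> V"
      using sub[of "inv_into I N' q"] by (cases "q \<in> N' ` I"; simp add: s'_def)+
  next
    fix x assume "x \<in> V"
    then obtain p where p: "p \<in> T" "x \<in> set (s p)" using sol by (auto simp: gtsp_solution_def)
    then have pI: "p \<in> I" by (auto simp: I_def)
    show "\<exists>!q. q \<in> T \<and> x \<in> set (s' q)"
    proof (rule ex1I[of _ "N' p"])
      show "N' p \<in> T \<and> x \<in> set (s' (N' p))" using pI p N'T s'N by auto
    next
      fix q assume q: "q \<in> T \<and> x \<in> set (s' q)"
      then have "q \<in> N' ` I" by (auto simp: s'_def split: if_splits)
      then obtain p' where p': "p' \<in> I" "q = N' p'" by auto
      with q s'N have "x \<in> set (s p')" by auto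
      with p p' IT uniq show "q = N' p" by blast
    qed
  qed
  have len: "polyline_length (path_vertices f q) = dist (fst q) (snd q)
      + (if f q = [] then 0 else detour (hd (f q), last (f q)) q
          + (polyline_length (f q) - dist (hd (f q)) (last (f q))))" for f q
    using polyline_length_through[of "f q" q]
    by (simp add: path_vertices_def polyline_length_def)
  have cost: "gtsp_cost T s = (\<Sum>p\<in>T. dist (fst p) (snd p)) + (\<Sum>p\<in>I. detour (row p) p + rest p)"
  proof -
    have "(\<Sum>p\<in>T. if s p = [] then 0 else detour (row p) p + rest p)
        = (\<Sum>p\<in>I. detour (row p) p + rest p)"
      by (rule sum.mono_neutral_cong_right) (auto simp: finT I_def)
    then show ?thesis unfolding gtsp_cost_def len row_def rest_def
      by (subst sum.distrib) simp
  qed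
  have cost': "gtsp_cost T s' = (\<Sum>p\<in>T. dist (fst p) (snd p))
      + (\<Sum>p\<in>I. detour (row p) (N' p) + rest p)"
  proof -
    let ?g = "\<lambda>q. if s' q = [] then 0 else detour (hd (s' q), last (s' q)) q
          + (polyline_length (s' q) - dist (hd (s' q)) (last (s' q)))"
    have "sum ?g T = sum ?g (N' ` I)"
      using N'T by (intro sum.mono_neutral_right) (auto simp: finT s'_def)
    also have "\<dots> = (\<Sum>p\<in>I. ?g (N' p))"
      by (simp add: sum.reindex[OF N'(1)])
    also have "\<dots> = (\<Sum>p\<in>I. detour (row p) (N' p) + rest p)"
      by (intro sum.cong refl) (simp add: s'N row_def rest_def I_def)
    finally show ?thesis unfolding gtsp_cost_def len by (subst sum.distrib) simp
  qed
  have "gtsp_cost T s' \<le> gtsp_cost T s"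
    using N'(3) by (simp add: cost cost' sum.distrib)
  with opt sol' have "gtsp_optimal V T s'"
    unfolding gtsp_optimal_def by (meson order_trans)
  moreover have "redundant_path s' p" if "p \<in> T - M ` (V \<times> V)" for p
    using that N'(2) by (auto simp: redundant_path_def s'_def)
  ultimately show ?thesis by blast
qed

section \<open>The Hungarian method\<close>

lemma inj_on_fun_upd_insert:
  assumes "inj_on f A" "z \<notin> f ` A"
  shows "inj_on (f(p := z)) (insert p A)"
  using assms by (auto simp: inj_on_def)

text \<open>The rows \<open>i < k\<close> are matched to the columns \<open>M i\<close>; \<open>u i\<close> is the potential of row \<open>i\<close> and \<open>v i\<close> that
  of column \<open>M i\<close>, and unmatched columns have potential zero.\<close>

definition row_matching ::
  "(nat \<Rightarrow> nat \<Rightarrow> real) \<Rightarrow> nat \<Rightarrow> nat \<Rightarrow> (nat \<Rightarrow> nat) \<Rightarrow> (nat \<Rightarrow> real) \<Rightarrow> (nat \<Rightarrow> real) \<Rightarrow> bool" where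
  "row_matching c m k M u v \<longleftrightarrow>
     inj_on M {..<k} \<and> (\<forall>i<k. M i < m) \<and> (\<forall>i<k. v i \<le> 0) \<and>
     (\<forall>i<k. u i + v i = c i (M i)) \<and>
     (\<forall>i<k. \<forall>i'<k. u i + v i' \<le> c i (M i')) \<and>
     (\<forall>i<k. \<forall>j<m. j \<notin> M ` {..<k} \<longrightarrow> u i \<le> c i j)"

text \<open>\<open>X\<close> is the set of the rows reached from the root \<open>k\<close> by tight edges, and \<open>par\<close> maps them to their
  predecessors. For \<open>i \<in> X\<close>, \<open>fb i\<close> is the cheapest unmatched column of row \<open>i\<close> and \<open>sl i\<close> its slack; for
  \<open>i \<notin> X\<close>, \<open>sl i\<close> is the least slack of column \<open>M i\<close> over \<open>X\<close>, attained at \<open>par i\<close>. With this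
  convention a change of the potentials by \<open>\<delta>\<close> decreases all entries of \<open>sl\<close> by \<open>\<delta>\<close>. The order in
  which the rows joined is recorded by \<open>stamp\<close>, which exists only in the proof. Before the root joins,
  \<open>X\<close> is empty; hence \<open>insert k X\<close>.\<close>

definition search_tree ::
  "(nat \<Rightarrow> nat \<Rightarrow> real) \<Rightarrow> nat \<Rightarrow> nat \<Rightarrow> (nat \<Rightarrow> nat) \<Rightarrow> nat set \<Rightarrow> (nat \<Rightarrow> real) \<Rightarrow> (nat \<Rightarrow> real)
    \<Rightarrow> (nat \<Rightarrow> real) \<Rightarrow> (nat \<Rightarrow> nat) \<Rightarrow> (nat \<Rightarrow> nat) \<Rightarrow> (nat \<Rightarrow> nat) \<Rightarrow> bool" where
  "search_tree c m k M X u v sl par fb stamp \<longleftrightarrow>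
     row_matching c m k M u v \<and> X \<subseteq> {..k} \<and>
     (\<forall>i<k. u k + v i \<le> c k (M i)) \<and>
     (\<forall>j<m. j \<notin> M ` {..<k} \<longrightarrow> u k \<le> c k j) \<and>
     (\<forall>i\<in>X. fb i < m \<and> fb i \<notin> M ` {..<k} \<and> sl i = c i (fb i) - u i \<and>
        (\<forall>j<m. j \<notin> M ` {..<k} \<longrightarrow> c i (fb i) \<le> c i j)) \<and>
     (\<forall>i<k. i \<notin> X \<longrightarrow> par i \<in> insert k X \<and> sl i = c (par i) (M i) - u (par i) - v i \<and>
        (\<forall>x\<in>X. sl i \<le> c x (M i) - u x - v i)) \<and>
     (\<forall>x\<in>X. stamp x < card X) \<and>
     (\<forall>x\<in>X. x \<noteq> k \<longrightarrow> par x \<in> X \<and> stamp (par x) < stamp x \<and> u (par x) + v x = c (par x) (M x))"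

text \<open>Potential zero is feasible for the new row because costs are nonnegative and matched
  columns have potentials at most zero. The slacks are already those against the root, so the join
  of the root will improve none of them.\<close>

lemma search_tree_init:
  assumes "row_matching c m k M u v" "\<And>i j. c i j \<ge> 0"
    "\<And>i. i < k \<Longrightarrow> sl i = c k (M i) - v i" "\<And>i. i < k \<Longrightarrow> par i = k"
  shows "search_tree c m k M {} (u(k := 0)) v sl par fb stamp"
proof -
  have "0 \<le> c k (M i) - v i" if "i < k" for i
    using that assms(1) assms(2)[of k "M i"] by (auto simp: row_matching_def intro: order_trans)
  then show ?thesis using assms by (auto simp: search_tree_def row_matching_def)
qed

text \<open>A zero slack of \<open>b\<close> outside the tree says that the edge from
  \<open>par b\<close> to the column of \<open>b\<close> is tight, so \<open>par b\<close> is a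
  legitimate predecessor. The hypotheses on the primed functions are what the relaxation loop
  produces entry by entry; a tie keeps the old parent.\<close>

lemma search_tree_join:
  assumes tree: "search_tree c m k M X u v sl par fb stamp"
    and b: "b \<le> k" "b \<notin> X" "X = {} \<and> b = k \<or> k \<in> X \<and> sl b = 0"
    and best: "f < m" "f \<notin> M ` {..<k}" "\<And>j. j < m \<Longrightarrow> j \<notin> M ` {..<k} \<Longrightarrow> c b f \<le> c b j"
    and fb': "fb' b = f" "\<And>i. i \<in> X \<Longrightarrow> fb' i = fb i"
    and slb: "sl' b = c b f - u b"
    and old: "\<And>i. i \<in> X \<Longrightarrow> sl' i = sl i" "\<And>i. i \<in> insert b X \<Longrightarrow> par' i = par i"
    and new: "\<And>i. i < k \<Longrightarrow> i \<notin> insert b X \<Longrightarrow>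
       (if c b (M i) - u b - v i < sl i then sl' i = c b (M i) - u b - v i \<and> par' i = b
        else sl' i = sl i \<and> par' i = par i)"
  shows "\<exists>stamp'. search_tree c m k M (insert b X) u v sl' par' fb' stamp'"
proof -
  have fin: "finite X" using tree finite_subset[of X "{..k}"] by (auto simp: search_tree_def)
  have stamp: "stamp x < card X" if "x \<in> X" for x using that tree by (auto simp: search_tree_def)
  have c5: "par i \<in> insert k X" "sl i = c (par i) (M i) - u (par i) - v i"
    "\<And>x. x \<in> X \<Longrightarrow> sl i \<le> c x (M i) - u x - v i" if "i < k" "i \<notin> X" for i
    using that tree by (auto simp: search_tree_def)
  have c6: "par x \<in> X" "stamp (par x) < stamp x" "u (par x) + v x = c (par x) (M x)"
    if "x \<in> X" "x \<noteq> k" for x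
    using that tree by (auto simp: search_tree_def)
  have k: "k \<in> insert b X" using b by auto
  have out': "par' i \<in> insert k (insert b X) \<and> sl' i = c (par' i) (M i) - u (par' i) - v i \<and>
      (\<forall>x\<in>insert b X. sl' i \<le> c x (M i) - u x - v i)" if i: "i < k" "i \<notin> insert b X" for i
  proof (cases "c b (M i) - u b - v i < sl i")
    case True
    have "sl' i \<le> c x (M i) - u x - v i" if "x \<in> X" for x
      using c5(3)[of i x] i that True new[OF i] by auto
    with new[OF i] True show ?thesis by auto
  next
    case False
    with new[OF i] c5[of i] i show ?thesis by auto
  qed
  \<comment> \<open>The joining row is stamped with the number of earlier members, which exceeds
    every stamp given out so far.\<close>
  have stamp': "(stamp(b := card X)) x < card (insert b X)" if "x \<in> insert b X" for x
    using that stamp[of x] fin b(2) by auto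
  have edges': "par' x \<in> insert b X \<and> (stamp(b := card X)) (par' x) < (stamp(b := card X)) x \<and>
      u (par' x) + v x = c (par' x) (M x)" if x: "x \<in> insert b X" "x \<noteq> k" for x
  proof (cases "x = b")
    case True
    then have "b < k" "k \<in> X" "sl b = 0" using x b by auto
    with c5[of b] b stamp[of "par b"] old(2)[of b] True show ?thesis by auto
  next
    case False
    then have "x \<in> X" using x by auto
    with c6[of x] x False old(2)[of x] b(2) show ?thesis by auto
  qed
  have in': "fb' i < m \<and> fb' i \<notin> M ` {..<k} \<and> sl' i = c i (fb' i) - u i \<and>
        (\<forall>j<m. j \<notin> M ` {..<k} \<longrightarrow> c i (fb' i) \<le> c i j)" if "i \<in> insert b X" for i
  proof (cases "i = b")
    case True
    then show ?thesis using best fb' slb by auto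
  next
    case False
    then have "i \<in> X" using that by auto
    then show ?thesis using tree fb'(2)[of i] old(1)[of i] by (auto simp: search_tree_def)
  qed
  have old_facts: "row_matching c m k M u v" "insert b X \<subseteq> {..k}" "\<forall>i<k. u k + v i \<le> c k (M i)"
    "\<forall>j<m. j \<notin> M ` {..<k} \<longrightarrow> u k \<le> c k j"
    using tree b(1) by (auto simp: search_tree_def)
  have "search_tree c m k M (insert b X) u v sl' par' fb' (stamp(b := card X))"
    unfolding search_tree_def
    by (intro conjI old_facts) (use in' out' stamp' edges' in \<open>simp_all only: Ball_def\<close>, blast+)
  then show ?thesis by blast
qed

text \<open>Every entry of \<open>sl\<close> is the slack of one concrete edge: inside the tree from
  the row to its cheapest free column, outside it from the parent to the matched column. Feasibility
  gives the sign.\<close>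

lemma search_tree_slack_nonneg:
  assumes "search_tree c m k M X u v sl par fb stamp" "k \<in> X" "i \<le> k"
  shows "0 \<le> sl i"
proof (cases "i \<in> X")
  case True
  then have "u i \<le> c i (fb i)" "sl i = c i (fb i) - u i" using assms
    by (cases "i = k"; auto simp: search_tree_def row_matching_def)+
  then show ?thesis by auto
next
  case False
  then have i: "i < k" using assms by (metis le_neq_implies_less)
  then have "par i \<in> X" and sl: "sl i = c (par i) (M i) - u (par i) - v i"
    using assms False by (auto simp: search_tree_def)
  then have "par i \<le> k" using assms by (auto simp: search_tree_def)
  then have "u (par i) + v i \<le> c (par i) (M i)"
    using assms i by (cases "par i = k") (auto simp: search_tree_def row_matching_def)
  then show ?thesis using sl by auto
qed

text \<open>A matched column counts as inside the tree if its row is. Edges with both ends or no end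
  inside keep their slack, edges from outer rows to inner columns gain, and edges from inner rows to
  outer columns lose exactly the step, which is at most their slack by minimality. Afterwards
  \<open>sl' b\<close> is zero, so the search can advance.\<close>

lemma search_tree_update:
  assumes tree: "search_tree c m k M X u v sl par fb stamp"
    and k: "k \<in> X" and b: "b \<le> k" "\<And>i. i \<le> k \<Longrightarrow> sl b \<le> sl i"
    and sl': "\<And>i. i \<le> k \<Longrightarrow> sl' i = sl i - sl b"
    and u': "\<And>i. i \<le> k \<Longrightarrow> u' i = (if i \<in> X then u i + sl b else u i)"
    and v': "\<And>i. i \<le> k \<Longrightarrow> v' i = (if i \<in> X then v i - sl b else v i)"
  shows "search_tree c m k M X u' v' sl' par fb stamp"
proof -
  let ?d = "sl b"
  have d: "0 \<le> ?d" using search_tree_slack_nonneg[OF tree k b(1)] .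
  have X: "X \<subseteq> {..k}" using tree by (auto simp: search_tree_def)
  have matched: "u i + v i' \<le> c i (M i')" if "i \<le> k" "i' < k" for i i'
    using that tree by (cases "i = k") (auto simp: search_tree_def row_matching_def)
  have free: "u i \<le> c i j" if "i \<le> k" "j < m" "j \<notin> M ` {..<k}" for i j
    using that tree by (cases "i = k") (auto simp: search_tree_def row_matching_def)
  have inX: "sl i = c i (fb i) - u i" "\<And>j. j < m \<Longrightarrow> j \<notin> M ` {..<k} \<Longrightarrow> c i (fb i) \<le> c i j"
    if "i \<in> X" for i
    using that tree by (auto simp: search_tree_def)
  have out: "par i \<in> X" "sl i = c (par i) (M i) - u (par i) - v i"
    "\<And>x. x \<in> X \<Longrightarrow> sl i \<le> c x (M i) - u x - v i" if "i < k" "i \<notin> X" for i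
    using that tree k by (auto simp: search_tree_def)
  have matched': "u' i + v' i' \<le> c i (M i')" if i: "i \<le> k" "i' < k" for i i'
    using matched[OF i] out(3)[of i' i] b(2)[of i'] i d u' v' by auto
  have free': "u' i \<le> c i j" if j: "i \<le> k" "j < m" "j \<notin> M ` {..<k}" for i j
  proof (cases "i \<in> X")
    case True
    then show ?thesis using inX(1)[OF True] inX(2)[OF True j(2,3)] b(2)[OF j(1)] u'[OF j(1)] by simp
  next
    case False
    then show ?thesis using free[OF j] u'[OF j(1)] by simp
  qed
  have "row_matching c m k M u' v'"
    using tree matched' free' u' v' d by (auto simp: search_tree_def row_matching_def)
  moreover have "sl' i = c i (fb i) - u' i" if "i \<in> X" for i
    using inX(1)[OF that] that X sl' u' by auto
  moreover have "sl' i = c (par i) (M i) - u' (par i) - v' i" if "i < k" "i \<notin> X" for i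
  proof -
    have "par i \<le> k" using out(1)[OF that] X by auto
    then show ?thesis using out(1,2)[OF that] that sl' u' v' by auto
  qed
  moreover have "sl' i \<le> c x (M i) - u' x - v' i" if "i < k" "i \<notin> X" "x \<in> X" for i x
  proof -
    have "x \<le> k" using that X by auto
    then show ?thesis using out(3)[OF that] that sl' u' v' by auto
  qed
  moreover have "u' (par x) + v' x = c (par x) (M x)" if "x \<in> X" "x \<noteq> k" for x
  proof -
    have p: "par x \<in> X" "u (par x) + v x = c (par x) (M x)"
      using that tree by (auto simp: search_tree_def)
    then have "par x \<le> k" "x \<le> k" using that X by auto
    then show ?thesis using p that u' v' by auto
  qed
  ultimately show ?thesis
    using tree k matched' free' by (auto simp: search_tree_def)
qed

text \<open>\<open>M0\<close> and \<open>v0\<close> are the values before the augmentation; the rows with a larger stamp than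
  \<open>x\<close> have been processed, and \<open>x\<close> is about to receive the column \<open>j\<close> with potential \<open>y\<close>.\<close>

definition augmenting ::
  "(nat \<Rightarrow> nat \<Rightarrow> real) \<Rightarrow> nat \<Rightarrow> (nat \<Rightarrow> nat) \<Rightarrow> (nat \<Rightarrow> real) \<Rightarrow> (nat \<Rightarrow> real) \<Rightarrow> nat set \<Rightarrow> (nat \<Rightarrow> nat)
    \<Rightarrow> nat \<Rightarrow> (nat \<Rightarrow> nat) \<Rightarrow> (nat \<Rightarrow> real) \<Rightarrow> nat \<Rightarrow> nat \<Rightarrow> real \<Rightarrow> bool" where
  "augmenting c k M0 u v0 X stamp f M v x j y \<longleftrightarrow>
     x \<in> X \<and> (\<forall>i\<in>X. stamp i \<le> stamp x \<longrightarrow> M i = M0 i \<and> v i = v0 i) \<and>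
     inj_on (M(x := j)) (insert x {..<k}) \<and>
     (\<forall>i\<in>insert x {..<k}. u i + (v(x := y)) i = c i ((M(x := j)) i) \<and>
        ((M(x := j)) i = f \<and> (v(x := y)) i = 0 \<or>
         (\<exists>i'<k. (M(x := j)) i = M0 i' \<and> (v(x := y)) i = v0 i'))) \<and>
     (x \<noteq> k \<longrightarrow> M0 x \<notin> M(x := j) ` {..<k})"

text \<open>Zero slack of a tree row means that the edge to its cheapest free column, whose
  potential is zero, is tight. Handing this column to \<open>b\<close> starts the augmentation with
  nothing overwritten yet.\<close>

lemma augmenting_init:
  assumes tree: "search_tree c m k M X u v sl par fb stamp" and b: "b \<in> X" "sl b = 0"
  shows "augmenting c k M u v X stamp (fb b) M v b (fb b) 0"
proof -
  have f: "fb b \<notin> M ` {..<k}" "u b = c b (fb b)" "b \<le> k"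
    using tree b by (auto simp: search_tree_def)
  have "inj_on M {..<k}" "\<And>i. i < k \<Longrightarrow> u i + v i = c i (M i)"
    using tree by (auto simp: search_tree_def row_matching_def)
  moreover from this have "inj_on (M(b := fb b)) (insert b {..<k})"
    using f by (intro inj_on_fun_upd_insert) auto
  moreover have "M b \<notin> M(b := fb b) ` {..<k}" if "b < k"
  proof -
    have "M b \<noteq> fb b" using f(1) that by (metis imageI lessThan_iff)
    then show ?thesis using that calculation(1) by (auto simp: inj_on_def)
  qed
  ultimately show ?thesis
    using f b by (auto simp: augmenting_def)
qed

text \<open>Column and potential travel together: \<open>par x\<close> takes the column of
  \<open>x\<close> with the potential stored at \<open>x\<close>, and the tree edge that makes this
  tight is part of the invariant. Both values are still the original ones because rows up to the
  stamp of \<open>x\<close> are unprocessed.\<close>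

lemma augmenting_step:
  assumes tree: "search_tree c m k M0 X u v0 sl par fb stamp"
    and aug: "augmenting c k M0 u v0 X stamp f M v x j y" and x: "x \<noteq> k"
  shows "augmenting c k M0 u v0 X stamp f (M(x := j)) (v(x := y)) (par x) (M x) (v x)"
    and "stamp (par x) < stamp x"
proof -
  have xX: "x \<in> X" and Mx: "M x = M0 x" "v x = v0 x" and xk: "x < k"
    using aug x tree by (auto simp: augmenting_def search_tree_def)
  have p: "par x \<in> X" "stamp (par x) < stamp x" "u (par x) + v0 x = c (par x) (M0 x)"
    using tree xX x by (auto simp: search_tree_def)
  then show "stamp (par x) < stamp x" by simp
  have px: "par x \<noteq> x" using p by auto
  let ?M = "M(x := j)" and ?v = "v(x := y)"
  have dom: "insert x {..<k} = {..<k}" using xk by auto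
  have inj: "inj_on ?M {..<k}" and fresh: "M0 x \<notin> ?M ` {..<k}"
    using aug x unfolding augmenting_def dom by auto
  have img: "u i + ?v i = c i (?M i)"
    "?M i = f \<and> ?v i = 0 \<or> (\<exists>i'<k. ?M i = M0 i' \<and> ?v i = v0 i')" if "i < k" for i
    using aug that unfolding augmenting_def dom by blast+
  have eq: "?M i = M0 i \<and> ?v i = v0 i" if "i \<in> X" "stamp i \<le> stamp (par x)" for i
    using that aug p by (auto simp: augmenting_def)
  have inj': "inj_on (?M(par x := M0 x)) (insert (par x) {..<k})"
    by (rule inj_on_fun_upd_insert[OF inj fresh])
  have "u i + (?v(par x := v0 x)) i = c i ((?M(par x := M0 x)) i) \<and>
        ((?M(par x := M0 x)) i = f \<and> (?v(par x := v0 x)) i = 0 \<or>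
         (\<exists>i'<k. (?M(par x := M0 x)) i = M0 i' \<and> (?v(par x := v0 x)) i = v0 i'))"
    if "i \<in> insert (par x) {..<k}" for i
  proof (cases "i = par x")
    case True
    then show ?thesis using p xk by auto
  next
    case False
    then have "i < k" using that by auto
    with img[of i] False show ?thesis by (auto simp del: fun_upd_apply simp: fun_upd_other)
  qed
  \<comment> \<open>The row \<open>par x\<close> still holds its original column and, by
    injectivity, is its only holder. Overwriting it thus releases the column for the next
    step.\<close>
  moreover have "M0 (par x) \<notin> (?M(par x := M0 x)) ` {..<k}" if "par x \<noteq> k"
  proof
    assume "M0 (par x) \<in> (?M(par x := M0 x)) ` {..<k}"
    then obtain i where i: "i < k" "M0 (par x) = (?M(par x := M0 x)) i" by auto
    have pk: "par x < k" using that p tree by (auto simp: search_tree_def)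
    have Mp: "?M (par x) = M0 (par x)" using eq p by auto
    show False
    proof (cases "i = par x")
      case True
      then have "M0 x = ?M (par x)" using i Mp by auto
      then show ?thesis using fresh pk by blast
    next
      case False
      then have "?M i = ?M (par x)" using i Mp by auto
      then show ?thesis using inj i(1) pk False by (auto simp only: inj_on_def)
    qed
  qed
  ultimately show "augmenting c k M0 u v0 X stamp f ?M ?v (par x) (M x) (v x)"
    using p(1) eq inj' unfolding augmenting_def Mx by blast
qed

text \<open>Every column of the new matching is either \<open>f\<close> with potential zero or an
  old column with its old potential, so feasibility is inherited. Equality of cardinalities shows
  that no old column was lost.\<close>

lemma augmenting_final:
  assumes tree: "search_tree c m k M0 X u v0 sl par fb stamp"
    and f: "f < m" "f \<notin> M0 ` {..<k}"
    and aug: "augmenting c k M0 u v0 X stamp f M v k j y"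
  shows "row_matching c m (Suc k) (M(k := j)) u (v(k := y))"
    and "M(k := j) ` {..<Suc k} = insert f (M0 ` {..<k})"
proof -
  let ?M = "M(k := j)" and ?v = "v(k := y)"
  have dom: "insert k {..<k} = {..<Suc k}" by auto
  have inj: "inj_on ?M {..<Suc k}" using aug unfolding augmenting_def dom by blast
  have img: "u i + ?v i = c i (?M i)"
    "?M i = f \<and> ?v i = 0 \<or> (\<exists>i'<k. ?M i = M0 i' \<and> ?v i = v0 i')" if "i < Suc k" for i
    using aug that unfolding augmenting_def dom by blast+
  have matched: "u i + v0 i' \<le> c i (M0 i')" if "i < Suc k" "i' < k" for i i'
    using that tree by (cases "i = k") (auto simp: search_tree_def row_matching_def)
  have free: "u i \<le> c i j" if "i < Suc k" "j < m" "j \<notin> M0 ` {..<k}" for i j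
    using that tree by (cases "i = k") (auto simp: search_tree_def row_matching_def)
  have injM0: "inj_on M0 {..<k}" and M0: "\<And>i. i < k \<Longrightarrow> M0 i < m \<and> v0 i \<le> 0"
    using tree by (auto simp: search_tree_def row_matching_def)
  have "?M ` {..<Suc k} \<subseteq> insert f (M0 ` {..<k})"
    using img(2) by (auto simp del: fun_upd_apply)
  moreover have "card (?M ` {..<Suc k}) = card (insert f (M0 ` {..<k}))"
    unfolding card_image[OF inj] using f(2) by (simp add: card_image[OF injM0])
  ultimately show image: "?M ` {..<Suc k} = insert f (M0 ` {..<k})"
    by (intro card_subset_eq) auto
  have "?M i < m \<and> ?v i \<le> 0" if "i < Suc k" for i
    using img(2)[OF that] M0 f(1) by auto
  moreover have "u i + ?v i' \<le> c i (?M i')" if i: "i < Suc k" "i' < Suc k" for i i'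
    using img(2)[OF i(2)] free[OF i(1) f] matched[OF i(1)] by auto
  moreover have "u i \<le> c i j" if "i < Suc k" "j < m" "j \<notin> ?M ` {..<Suc k}" for i j
    using that free[of i j] unfolding image by auto
  ultimately show "row_matching c m (Suc k) ?M u ?v"
    using inj img(1) unfolding row_matching_def by blast
qed

section \<open>Time-bounded execution of Real RAM programs\<close>

text \<open>Both \<open>ccost\<close> and \<open>wp\<close> are meant for loop-free programs; on loops they have junk values.\<close>

fun ccost :: "com \<Rightarrow> nat" where
  "ccost Skip = 1"
| "ccost (ISet r e) = 1 + icost e"
| "ccost (RSet r e) = 1 + rcost e"
| "ccost (IStore d e) = 1 + icost d + icost e"
| "ccost (RStore d e) = 1 + icost d + rcost e"
| "ccost (Seq c d) = ccost c + ccost d"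
| "ccost (Cond b c d) = 1 + bcost b + ccost c + ccost d"
| "ccost (While b c) = 0"

fun wp :: "nat \<Rightarrow> nat \<Rightarrow> com \<Rightarrow> (rr_state \<Rightarrow> bool) \<Rightarrow> rr_state \<Rightarrow> bool" where
  "wp w S Skip Q s = Q s"
| "wp w S (ISet r e) Q s =
     (case ieval w S s e of None \<Rightarrow> False | Some x \<Rightarrow> Q (s\<lparr>ireg := (ireg s)(r := x)\<rparr>))"
| "wp w S (RSet r e) Q s =
     (case reval w S s e of None \<Rightarrow> False | Some x \<Rightarrow> Q (s\<lparr>rreg := (rreg s)(r := x)\<rparr>))"
| "wp w S (IStore d e) Q s =
     (case ieval w S s d of None \<Rightarrow> False | Some a \<Rightarrow> a < S \<and>
       (case ieval w S s e of None \<Rightarrow> False | Some x \<Rightarrow> Q (s\<lparr>imem := (imem s)(a := x)\<rparr>)))"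
| "wp w S (RStore d e) Q s =
     (case ieval w S s d of None \<Rightarrow> False | Some a \<Rightarrow> a < S \<and>
       (case reval w S s e of None \<Rightarrow> False | Some x \<Rightarrow> Q (s\<lparr>rmem := (rmem s)(a := x)\<rparr>)))"
| "wp w S (Seq c d) Q s = wp w S c (wp w S d Q) s"
| "wp w S (Cond b c d) Q s =
     (case beval w S s b of None \<Rightarrow> False | Some t \<Rightarrow> if t then wp w S c Q s else wp w S d Q s)"
| "wp w S (While b c) Q s = False"

definition runs :: "nat \<Rightarrow> nat \<Rightarrow> com \<Rightarrow> rr_state \<Rightarrow> nat \<Rightarrow> (rr_state \<Rightarrow> bool) \<Rightarrow> bool" where
  "runs w S c s t Q \<longleftrightarrow> (\<exists>k s'. rr_exec w S c s k s' \<and> k \<le> t \<and> Q s')"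

lemma runsI: "rr_exec w S c s k s' \<Longrightarrow> k \<le> t \<Longrightarrow> Q s' \<Longrightarrow> runs w S c s t Q"
  by (auto simp: runs_def)

lemma runs_Seq:
  assumes "runs w S c s t (\<lambda>s'. runs w S d s' t' Q)"
  shows "runs w S (Seq c d) s (t + t') Q"
  using assms unfolding runs_def by (meson rr_exec.Seq add_mono)

lemma runs_Cond:
  assumes "beval w S s b = Some x" "x \<Longrightarrow> runs w S c s t Q" "\<not> x \<Longrightarrow> runs w S d s t' Q"
  shows "runs w S (Cond b c d) s (1 + bcost b + (t + t')) Q"
proof (cases x)
  case True
  with assms obtain k s' where "rr_exec w S c s k s'" "k \<le> t" "Q s'" by (auto simp: runs_def)
  with assms(1) True show ?thesis by (intro runsI[OF rr_exec.CondTrue]) auto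
next
  case False
  with assms obtain k s' where "rr_exec w S d s k s'" "k \<le> t'" "Q s'" by (auto simp: runs_def)
  with assms(1) False show ?thesis by (intro runsI[OF rr_exec.CondFalse]) auto
qed

lemma runs_wp: "wp w S c Q s \<Longrightarrow> runs w S c s (ccost c) Q"
proof (induction c arbitrary: Q s)
  case Skip
  then show ?case by (intro runsI[OF rr_exec.Skip]) simp_all
next
  case (ISet r e)
  then show ?case by (auto split: option.splits intro!: runsI[OF rr_exec.ISet])
next
  case (RSet r e)
  then show ?case by (auto split: option.splits intro!: runsI[OF rr_exec.RSet])
next
  case (IStore d e)
  then show ?case by (auto split: option.splits intro!: runsI[OF rr_exec.IStore])
next
  case (RStore d e)
  then show ?case by (auto split: option.splits intro!: runsI[OF rr_exec.RStore])
next
  case (Seq c d)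
  have "runs w S c s (ccost c) (\<lambda>s'. runs w S d s' (ccost d) Q)"
    using Seq.IH(1)[of "wp w S d Q" s] Seq.IH(2)[of Q] Seq.prems by (auto simp: runs_def) metis
  then show ?case using runs_Seq by simp
next
  case (Cond b c d)
  then obtain t where t: "beval w S s b = Some t" "if t then wp w S c Q s else wp w S d Q s"
    by (auto split: option.splits)
  show ?case
    using runs_Cond[OF t(1), of c "ccost c" Q d "ccost d"] t(2) Cond.IH
    by (simp add: add.assoc split: if_splits)
qed simp

lemma runs_mono: "runs w S c s t Q \<Longrightarrow> t \<le> t' \<Longrightarrow> (\<And>s'. Q s' \<Longrightarrow> Q' s') \<Longrightarrow> runs w S c s t' Q'"
  unfolding runs_def by (meson order_trans)

lemma runs_While:
  fixes \<mu> :: "rr_state \<Rightarrow> nat"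
  assumes "I s"
    and "\<And>s. I s \<Longrightarrow> beval w S s b = Some (g s)"
    and "\<And>s. I s \<Longrightarrow> g s \<Longrightarrow> runs w S c s t (\<lambda>s'. I s' \<and> \<mu> s' < \<mu> s)"
  shows "runs w S (While b c) s (\<mu> s * (1 + bcost b + t) + (1 + bcost b)) (\<lambda>s'. I s' \<and> \<not> g s')"
  using assms(1)
proof (induction "\<mu> s" arbitrary: s rule: less_induct)
  case less
  show ?case
  proof (cases "g s")
    case False
    with assms(2)[OF less.prems] have "rr_exec w S (While b c) s (1 + bcost b) s"
      by (intro rr_exec.WhileFalse) simp
    with False less.prems show ?thesis by (fastforce simp: runs_def)
  next
    case True
    from assms(3)[OF less.prems True] obtain k s'
      where s': "rr_exec w S c s k s'" "k \<le> t" "I s'" "\<mu> s' < \<mu> s" by (auto simp: runs_def)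
    from less.hyps[OF s'(4,3)] obtain l s''
      where s'': "rr_exec w S (While b c) s' l s''"
        "l \<le> \<mu> s' * (1 + bcost b + t) + (1 + bcost b)" "I s''" "\<not> g s''"
      by (auto simp: runs_def)
    have exec: "rr_exec w S (While b c) s (1 + bcost b + k + l) s''"
      using assms(2)[OF less.prems] True s'(1) s''(1) by (intro rr_exec.WhileTrue) simp_all
    have "1 + bcost b + k + l \<le> Suc (\<mu> s') * (1 + bcost b + t) + (1 + bcost b)"
      using s'(2) s''(2) by simp
    also have "\<dots> \<le> \<mu> s * (1 + bcost b + t) + (1 + bcost b)"
      using s'(4) by (intro add_right_mono mult_right_mono) auto
    finally show ?thesis using exec s''(3,4) unfolding runs_def by blast
  qed
qed

lemma runs_Seq_rule:
  assumes "runs w S c s t Q" "\<And>s'. Q s' \<Longrightarrow> runs w S d s' t' Q'" "t + t' \<le> t''"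
  shows "runs w S (Seq c d) s t'' Q'"
  by (rule runs_mono[OF runs_Seq[OF runs_mono[OF assms(1) order_refl assms(2)]] assms(3)])

lemma runs_wp_rule: "wp w S c Q s \<Longrightarrow> ccost c \<le> t \<Longrightarrow> runs w S c s t Q"
  by (rule runs_mono[OF runs_wp])

lemma runs_While_rule:
  fixes \<mu> :: "rr_state \<Rightarrow> nat"
  assumes "I s"
    and "\<And>s. I s \<Longrightarrow> beval w S s b = Some (g s)"
    and "\<And>s. I s \<Longrightarrow> g s \<Longrightarrow> runs w S c s t (\<lambda>s'. I s' \<and> \<mu> s' < \<mu> s)"
    and "\<And>s'. I s' \<Longrightarrow> \<not> g s' \<Longrightarrow> Q s'"
    and "\<mu> s \<le> N" "N * (1 + bcost b + t) + (1 + bcost b) \<le> T"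
  shows "runs w S (While b c) s T Q"
proof (rule runs_mono[OF runs_While[of I s w S b g c t \<mu>]])
  have "\<mu> s * (1 + bcost b + t) + (1 + bcost b) \<le> N * (1 + bcost b + t) + (1 + bcost b)"
    using assms(5) by (intro add_right_mono mult_right_mono) auto
  also note assms(6)
  finally show "\<mu> s * (1 + bcost b + t) + (1 + bcost b) \<le> T" .
qed (use assms in auto)

text \<open>The memories are divided into arrays of length \<open>6 * m\<close>, which is enough for the \<open>2 * n + 4 * m\<close>
  input coordinates in the real array \<open>0\<close>. Padding the arrays by zeros makes an unmodified array
  literally the same function.\<close>

definition iarr :: "nat \<Rightarrow> rr_state \<Rightarrow> nat \<Rightarrow> nat \<Rightarrow> nat" where
  "iarr m s t i = (if i < 6 * m then imem s (6 * t * m + i) else 0)"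

definition rarr :: "nat \<Rightarrow> rr_state \<Rightarrow> nat \<Rightarrow> nat \<Rightarrow> real" where
  "rarr m s t i = (if i < 6 * m then rmem s (6 * t * m + i) else 0)"

definition loc :: "nat \<Rightarrow> iexp \<Rightarrow> iexp" where
  "loc t e = IBin IAdd (IBin IMul (INum (6 * t)) (IReg 1)) e"

definition IGet :: "nat \<Rightarrow> iexp \<Rightarrow> iexp" where "IGet t e = IMem (loc t e)"
definition RGet :: "nat \<Rightarrow> iexp \<Rightarrow> rexp" where "RGet t e = RMem (loc t e)"
definition IPut :: "nat \<Rightarrow> iexp \<Rightarrow> iexp \<Rightarrow> com" where "IPut t d e = IStore (loc t d) e"
definition RPut :: "nat \<Rightarrow> iexp \<Rightarrow> rexp \<Rightarrow> com" where "RPut t d e = RStore (loc t d) e"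

lemma icost_loc [simp]: "icost (loc t e) = 4 + icost e"
  and icost_IGet [simp]: "icost (IGet t e) = 5 + icost e"
  and rcost_RGet [simp]: "rcost (RGet t e) = 5 + icost e"
  and ccost_IPut [simp]: "ccost (IPut t d e) = 5 + icost d + icost e"
  and ccost_RPut [simp]: "ccost (RPut t d f) = 5 + icost d + rcost f"
  by (simp_all add: loc_def IGet_def RGet_def IPut_def RPut_def)

lemma iarr_upd [simp]:
  "iarr m (s\<lparr>ireg := f\<rparr>) = iarr m s" "iarr m (s\<lparr>rreg := h\<rparr>) = iarr m s" "iarr m (s\<lparr>rmem := h\<rparr>) = iarr m s"
  "rarr m (s\<lparr>ireg := f\<rparr>) = rarr m s" "rarr m (s\<lparr>rreg := h\<rparr>) = rarr m s" "rarr m (s\<lparr>imem := f\<rparr>) = rarr m s"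
  by (auto simp: iarr_def rarr_def fun_eq_iff)

lemma location_eq_iff:
  fixes m :: nat
  assumes "i < 6 * m" "j < 6 * m"
  shows "6 * t * m + i = 6 * t' * m + j \<longleftrightarrow> t = t' \<and> i = j"
proof
  assume eq: "6 * t * m + i = 6 * t' * m + j"
  have "(t * (6 * m) + i) div (6 * m) = t" "(t' * (6 * m) + j) div (6 * m) = t'"
    using assms by auto
  moreover have "t * (6 * m) + i = t' * (6 * m) + j" using eq by (simp add: algebra_simps)
  ultimately have "t = t'" by metis
  with eq show "t = t' \<and> i = j" by simp
qed auto

lemma iarr_put:
  "i < 6 * m \<Longrightarrow> iarr m (s\<lparr>imem := (imem s)(6 * t * m + i := x)\<rparr>) = (iarr m s)(t := (iarr m s t)(i := x))"
  by (auto simp: iarr_def fun_eq_iff location_eq_iff)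

lemma rarr_put:
  "i < 6 * m \<Longrightarrow> rarr m (s\<lparr>rmem := (rmem s)(6 * t * m + i := x)\<rparr>) = (rarr m s)(t := (rarr m s t)(i := x))"
  by (auto simp: rarr_def fun_eq_iff location_eq_iff)

text \<open>These keep array writes symbolic: through \<open>put_simps\<close> the simplifier turns
  them into function updates of whole arrays and never reasons about addresses.\<close>

definition iput :: "nat \<Rightarrow> nat \<Rightarrow> nat \<Rightarrow> nat \<Rightarrow> rr_state \<Rightarrow> rr_state" where
  "iput m t i x s = s\<lparr>imem := (imem s)(6 * t * m + i := x)\<rparr>"
definition rput :: "nat \<Rightarrow> nat \<Rightarrow> nat \<Rightarrow> real \<Rightarrow> rr_state \<Rightarrow> rr_state" where
  "rput m t i x s = s\<lparr>rmem := (rmem s)(6 * t * m + i := x)\<rparr>"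

lemma put_simps [simp]:
  "ireg (iput m t i x s) = ireg s" "rreg (iput m t i x s) = rreg s" "rarr m (iput m t i x s) = rarr m s"
  "ireg (rput m t i y s) = ireg s" "rreg (rput m t i y s) = rreg s" "iarr m (rput m t i y s) = iarr m s"
  "i < 6 * m \<Longrightarrow> iarr m (iput m t i x s) = (iarr m s)(t := (iarr m s t)(i := x))"
  "i < 6 * m \<Longrightarrow> rarr m (rput m t i y s) = (rarr m s)(t := (rarr m s t)(i := y))"
  by (simp_all add: iput_def rput_def iarr_put rarr_put)

text \<open>Eight arrays of length \<open>6 * m\<close> occupy the addresses below
  \<open>48 * m\<close>. The additive 50 in the word bound admits the constants \<open>6 * t\<close>
  with \<open>t \<le> 7\<close> even for small \<open>m\<close>.\<close>

locale array_machine =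
  fixes w S m :: nat
  assumes words: "50 * m + 50 \<le> w" and memory: "50 * m \<le> S"
begin

lemma word_Some: "x \<le> 50 * m + 49 \<Longrightarrow> word w x = Some x"
  using words by (simp add: word_def)

text \<open>The evaluation rules avoid extra variables in their conditions, so that the simplifier can
  execute loop-free programs; \<open>iget\<close>, \<open>rget\<close> and the \<open>_at\<close> constants leave the index unchecked.\<close>

definition "iget s t i = Option.bind (word w (6 * t * m + i)) (\<lambda>a. if a < S then Some (imem s a) else None)"
definition "rget s t i = Option.bind (word w (6 * t * m + i)) (\<lambda>a. if a < S then Some (rmem s a) else None)"
definition "iput_at s t i x Q \<longleftrightarrow> word w (6 * t * m + i) \<noteq> None \<and> 6 * t * m + i < S \<and> Q (iput m t i x s)"
definition "rput_at s t i x Q \<longleftrightarrow> word w (6 * t * m + i) \<noteq> None \<and> 6 * t * m + i < S \<and> Q (rput m t i x s)"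

lemma location_bounds:
  assumes "t \<le> 7" "i < 6 * m"
  shows "word w (6 * t * m + i) = Some (6 * t * m + i)" "6 * t * m + i < S"
proof -
  have "6 * t * m \<le> 42 * m" using assms(1) by (intro mult_right_mono) simp_all
  then have "6 * t * m + i < 48 * m" using assms(2) by linarith
  then show "word w (6 * t * m + i) = Some (6 * t * m + i)" "6 * t * m + i < S"
    using memory words by (simp_all add: word_def)
qed

lemma array_access [simp]:
  assumes "t \<le> 7" "i < 6 * m"
  shows "iget s t i = Some (iarr m s t i)" "rget s t i = Some (rarr m s t i)"
    "iput_at s t i x Q = Q (iput m t i x s)" "rput_at s t i y Q = Q (rput m t i y s)"
  using assms location_bounds[OF assms]
  by (simp_all add: iget_def rget_def iarr_def rarr_def iput_at_def rput_at_def)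

lemma ieval_loc:
  assumes "ireg s 1 = m" "t \<le> 7"
  shows "ieval w S s (loc t e) = Option.bind (ieval w S s e) (\<lambda>i. word w (6 * t * m + i))"
proof -
  have "6 * t * m \<le> 42 * m" using assms(2) by (intro mult_right_mono) simp_all
  then have "word w (6 * t) = Some (6 * t)" "word w (6 * t * m) = Some (6 * t * m)"
    using assms(2) by (intro word_Some; linarith)+
  then show ?thesis using assms(1) by (cases "ieval w S s e") (simp_all add: loc_def)
qed

lemma array_eval [simp]:
  assumes "ireg s (Suc 0) = m" "t \<le> 7"
  shows "ieval w S s (IGet t d) = Option.bind (ieval w S s d) (iget s t)"
    and "reval w S s (RGet t d) = Option.bind (ieval w S s d) (rget s t)"
    and "wp w S (IPut t d e) Q s = (case ieval w S s d of None \<Rightarrow> False | Some i \<Rightarrow>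
           (case ieval w S s e of None \<Rightarrow> False | Some x \<Rightarrow> iput_at s t i x Q))"
    and "wp w S (RPut t d f) Q s = (case ieval w S s d of None \<Rightarrow> False | Some i \<Rightarrow>
           (case reval w S s f of None \<Rightarrow> False | Some x \<Rightarrow> rput_at s t i x Q))"
  using assms
  by (auto simp: IGet_def RGet_def IPut_def RPut_def ieval_loc iget_def rget_def iput_at_def
      rput_at_def iput_def rput_def word_def fun_eq_iff split: option.splits Option.bind_splits if_splits)

end

section \<open>Matching on the Real RAM\<close>

text \<open>
  Word registers: 0 \<open>n\<close>; 1 \<open>m\<close>; 2 the number \<open>R\<close> of rows; 3 the number \<open>G\<close> of blocks; 4 the row \<open>k\<close>
  of the current phase; 5 row, 6 block, 7 best column so far, 8 column under consideration (in the
  searches for cheapest columns); 10 the row that joins the search tree next; 11 loop counter; 12 row,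
  13 column and 14 new column of an augmentation; 15 scratch; 16 number of outputs.
  Word arrays: 0 output; 1 flags of the matched columns; 2 the matching; 3 parents in the search tree;
  4 flags of the rows in the tree; 5 the block table; 6 cheapest unmatched columns of the rows in the
  tree. Real registers: 0 slack, 1 and 2 column potentials. Real arrays: 0 input; 1 row potentials;
  2 potentials of the matched columns, indexed by row; 3 slacks.
\<close>

definition plus1 :: "iexp \<Rightarrow> iexp" where "plus1 e = IBin IAdd e (INum 1)"

definition inner_coord :: "iexp \<Rightarrow> nat \<Rightarrow> rexp" where
  "inner_coord e q = RGet 0 (IBin IAdd (IBin IMul (INum 2) e) (INum q))"

definition terminal_coord :: "iexp \<Rightarrow> nat \<Rightarrow> rexp" where
  "terminal_coord e q = RGet 0
     (IBin IAdd (IBin IMul (INum 2) (IReg 0)) (IBin IAdd (IBin IMul (INum 4) e) (INum q)))"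

definition dist_exp :: "rexp \<Rightarrow> rexp \<Rightarrow> rexp \<Rightarrow> rexp \<Rightarrow> rexp" where
  "dist_exp x y x' y' = RSqrt (RBin RAdd (RBin RMul (RBin RSub x x') (RBin RSub x x'))
     (RBin RMul (RBin RSub y y') (RBin RSub y y')))"

text \<open>A row number encodes an ordered pair of inner points in base \<open>n\<close>. Costs are
  recomputed from the coordinates at every use, because a stored cost matrix would have
  \<open>n * n * m\<close> entries.\<close>

definition detour_exp :: "iexp \<Rightarrow> iexp \<Rightarrow> rexp" where
  "detour_exp d e = (let a = IBin IDiv d (IReg 0); b = IBin IMod d (IReg 0) in
     RBin RSub (RBin RAdd (RBin RAdd
       (dist_exp (terminal_coord e 0) (terminal_coord e 1) (inner_coord a 0) (inner_coord a 1))
       (dist_exp (inner_coord a 0) (inner_coord a 1) (inner_coord b 0) (inner_coord b 1)))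
       (dist_exp (inner_coord b 0) (inner_coord b 1) (terminal_coord e 2) (terminal_coord e 3)))
       (dist_exp (terminal_coord e 0) (terminal_coord e 1) (terminal_coord e 2) (terminal_coord e 3)))"

lemma rcost_dist_exp: "rcost (dist_exp x y x' y') = 8 + 2 * (rcost x + rcost y + rcost x' + rcost y')"
  by (simp add: dist_exp_def)

lemma rcost_coord: "rcost (inner_coord e q) = 9 + icost e" "rcost (terminal_coord e q) = 13 + icost e"
  by (simp_all add: inner_coord_def terminal_coord_def)

text \<open>Eight inner and eight terminal coordinates occur, each evaluated twice because a square
  is a product of two copies; this explains the factors 16. With registers as operands the cost is
  451, the largest share of the loop constants that involve detours.\<close>

lemma rcost_detour_exp [simp]: "rcost (detour_exp d e) = 419 + 16 * icost d + 16 * icost e"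
  by (simp add: detour_exp_def Let_def rcost_dist_exp rcost_coord)

lemma dist_point: "dist (x :: point) y = sqrt ((x $ 1 - y $ 1) * (x $ 1 - y $ 1) + (x $ 2 - y $ 2) * (x $ 2 - y $ 2))"
  by (simp add: dist_vec_def L2_set_def sum_2 dist_real_def power2_eq_square)

lemma length_coords [simp]: "length (coords x) = 2"
  by (simp add: coords_def)

lemma nth_concat_coords:
  "i < length vs \<Longrightarrow> q < 2 \<Longrightarrow> concat (map coords vs) ! (2 * i + q) = coords (vs ! i) ! q"
proof (induction vs arbitrary: i)
  case (Cons v vs)
  then show ?case by (cases i) (auto simp: nth_append)
qed simp

lemma length_concat_coords: "length (concat (map coords vs)) = 2 * length vs"
  by (induction vs) auto

lemma nth_concat_terminals:
  "j < length ts \<Longrightarrow> q < 4 \<Longrightarrow>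
    concat (map (\<lambda>p. coords (fst p) @ coords (snd p)) ts) ! (4 * j + q)
      = (coords (fst (ts ! j)) @ coords (snd (ts ! j))) ! q"
proof (induction ts arbitrary: j)
  case (Cons t ts)
  then show ?case by (cases j) (auto simp: nth_append)
qed simp

lemma length_concat_terminals:
  "length (concat (map (\<lambda>p. coords (fst p) @ coords (snd p)) ts)) = 4 * length ts"
  by (induction ts) auto

locale gtsp_machine = array_machine w S m for w S m :: nat +
  fixes n :: nat and vs :: "point list" and ts :: "terminal_pair list"
  assumes length_vs: "length vs = n" and length_ts: "length ts = m"
    and n_pos: "0 < n" and n2_le_m: "n * n \<le> m"
begin

definition R :: nat where "R = n * n"
text \<open>For positive \<open>m\<close> this is \<open>m / R\<close> rounded up; the last block
  may be shorter than \<open>R\<close>.\<close>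

definition G :: nat where "G = (m - 1) div R + 1"
definition c :: "nat \<Rightarrow> nat \<Rightarrow> real" where "c i j = detour (vs ! (i div n), vs ! (i mod n)) (ts ! j)"

lemma R_pos: "0 < R" and R_le_m: "R \<le> m" and n_le_R: "n \<le> R"
  using n_pos n2_le_m by (auto simp: R_def)

lemma m_pos: "0 < m" using R_pos R_le_m by simp

text \<open>Rounding up costs at most one extra block of \<open>R \<le> m\<close> columns. This
  bound gives both the linear space of the table and the time \<open>O(m)\<close> for the table rows
  read in one search.\<close>

lemma RG_le: "R * G \<le> 2 * m"
proof -
  have "R * ((m - 1) div R) \<le> m - 1" by simp
  moreover have "R * G = R * ((m - 1) div R) + R" by (simp add: G_def)
  ultimately show ?thesis using R_le_m by linarith
qed

lemma G_pos: "0 < G" by (simp add: G_def)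

text \<open>No block is empty, so its first column can serve as the initial candidate.\<close>

lemma block_start: assumes "g < G" shows "g * R < m"
proof -
  have "g \<le> (m - 1) div R" using assms by (simp add: G_def)
  then have "g * R \<le> (m - 1) div R * R" by simp
  also have "\<dots> \<le> m - 1" by simp
  finally show ?thesis using m_pos by simp
qed

lemma block_of: assumes "j < m" shows "j div R < G"
proof -
  have "j \<le> m - 1" using assms by simp
  then show ?thesis using div_le_mono[of j "m - 1" R] by (simp add: G_def)
qed

lemma table_index: assumes "i < R" "g < G" shows "i * G + g < 2 * m"
proof -
  have "i * G + g < i * G + G" using assms by simp
  also have "\<dots> = (i + 1) * G" by simp
  also have "\<dots> \<le> R * G" using assms by (intro mult_right_mono) auto
  also have "\<dots> \<le> 2 * m" by (rule RG_le)
  finally show ?thesis .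
qed

definition loaded :: "rr_state \<Rightarrow> bool" where
  "loaded s \<longleftrightarrow> ireg s 0 = n \<and> ireg s 1 = m \<and> rarr m s 0 = rarr m (rr_input vs ts) 0"

definition configured :: "rr_state \<Rightarrow> bool" where
  "configured s \<longleftrightarrow> loaded s \<and> ireg s 2 = R \<and> ireg s 3 = G"

lemma input_cell:
  assumes "loaded s" "a < 2 * n + 4 * m"
  shows "rarr m s 0 a = input_reals vs ts ! a"
proof -
  have "a < 6 * m" using assms(2) n_le_R R_le_m by linarith
  moreover have "length (input_reals vs ts) = 2 * n + 4 * m"
    by (simp add: input_reals_def length_concat_coords length_concat_terminals length_vs length_ts)
  ultimately have "rarr m (rr_input vs ts) 0 a = input_reals vs ts ! a"
    using assms(2) by (simp add: rarr_def rr_input_def)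
  then show ?thesis using assms(1) unfolding loaded_def by simp
qed

lemma input_inner:
  assumes "loaded s" "i < n" "q < 2"
  shows "rarr m s 0 (2 * i + q) = coords (vs ! i) ! q"
proof -
  have lt: "2 * i + q < 2 * n" using assms by linarith
  have "rarr m s 0 (2 * i + q) = input_reals vs ts ! (2 * i + q)"
    using lt by (intro input_cell assms(1)) simp
  also have "\<dots> = concat (map coords vs) ! (2 * i + q)"
    unfolding input_reals_def nth_append length_concat_coords length_vs using lt by (rule if_P)
  also have "\<dots> = coords (vs ! i) ! q"
    by (rule nth_concat_coords) (use assms length_vs in simp_all)
  finally show ?thesis .
qed

lemma input_terminal:
  assumes "loaded s" "j < m" "q < 4"
  shows "rarr m s 0 (2 * n + (4 * j + q)) = (coords (fst (ts ! j)) @ coords (snd (ts ! j))) ! q"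
proof -
  have lt: "4 * j + q < 4 * m" using assms by linarith
  have "rarr m s 0 (2 * n + (4 * j + q)) = input_reals vs ts ! (2 * n + (4 * j + q))"
    using lt by (intro input_cell assms(1)) simp
  also have "\<dots> = concat (map (\<lambda>p. coords (fst p) @ coords (snd p)) ts) ! (4 * j + q)"
    unfolding input_reals_def nth_append length_concat_coords length_vs by simp
  also have "\<dots> = (coords (fst (ts ! j)) @ coords (snd (ts ! j))) ! q"
    by (rule nth_concat_terminals) (use assms length_ts in simp_all)
  finally show ?thesis .
qed

lemma reval_inner_coord:
  assumes "loaded s" "ieval w S s e = Some i" "i < n"
  shows "reval w S s (inner_coord e 0) = Some (vs ! i $ 1)" "reval w S s (inner_coord e 1) = Some (vs ! i $ 2)"
  using assms n_le_R R_le_m input_inner[OF assms(1,3), of 0] input_inner[OF assms(1,3), of 1]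
  by (simp_all add: inner_coord_def loaded_def word_Some coords_def)

lemma reval_terminal_coord:
  assumes "loaded s" "ieval w S s e = Some j" "j < m" "q < 4"
  shows "reval w S s (terminal_coord e q) = Some ((coords (fst (ts ! j)) @ coords (snd (ts ! j))) ! q)"
proof -
  have "n \<le> m" using n_le_R R_le_m by simp
  then have "2 * n + (4 * j + q) < 6 * m" "4 * j + q < 4 * m" using assms by linarith+
  then show ?thesis
    using assms input_terminal[OF assms(1,3,4)] \<open>n \<le> m\<close> by (simp add: terminal_coord_def loaded_def word_Some)
qed

lemma reval_dist_exp:
  assumes "reval w S s x = Some (p $ 1)" "reval w S s y = Some (p $ 2)"
    "reval w S s x' = Some (q $ 1)" "reval w S s y' = Some ((q :: point) $ 2)"
  shows "reval w S s (dist_exp x y x' y') = Some (dist p q)"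
  using assms by (simp add: dist_exp_def dist_point not_less)

lemma reval_detour_exp:
  assumes "loaded s" "ieval w S s d = Some i" "i < R" "ieval w S s e = Some j" "j < m"
  shows "reval w S s (detour_exp d e) = Some (c i j)"
proof -
  have i: "i div n < n" "i mod n < n" using assms(3) n_pos
    by (auto simp: R_def less_mult_imp_div_less)
  moreover have "n \<le> m" using n_le_R R_le_m by simp
  ultimately have div: "ieval w S s (IBin IDiv d (IReg 0)) = Some (i div n)"
    "ieval w S s (IBin IMod d (IReg 0)) = Some (i mod n)"
    using assms n_pos word_Some[of "i div n"] word_Some[of "i mod n"]
    by (simp_all add: loaded_def less_imp_le order_trans[OF less_imp_le[of "i mod n" n]])
  note t = reval_terminal_coord[OF assms(1,4,5)]
  have t: "reval w S s (terminal_coord e 0) = Some (fst (ts ! j) $ 1)"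
    "reval w S s (terminal_coord e 1) = Some (fst (ts ! j) $ 2)"
    "reval w S s (terminal_coord e 2) = Some (snd (ts ! j) $ 1)"
    "reval w S s (terminal_coord e 3) = Some (snd (ts ! j) $ 2)"
    using t[of 0] t[of 1] t[of 2] t[of 3] by (simp_all add: coords_def)
  note a = reval_inner_coord[OF assms(1) div(1) i(1)] and b = reval_inner_coord[OF assms(1) div(2) i(2)]
  show ?thesis
    unfolding detour_exp_def Let_def reval.simps reval_dist_exp[OF t(1,2) a] reval_dist_exp[OF a b]
      reval_dist_exp[OF b t(3,4)] reval_dist_exp[OF t(1,2) t(3,4)]
    by (simp add: c_def detour_def)
qed

lemma configuredD:
  assumes "configured s"
  shows "ireg s 0 = n" "ireg s (Suc 0) = m" "ireg s 2 = R" "ireg s 3 = G"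
  using assms by (simp_all add: configured_def loaded_def)

lemma c_nonneg: "0 \<le> c i j" by (simp add: c_def detour_nonneg)

end

section \<open>Cheapest free columns and the block table\<close>

definition is_zero :: "iexp \<Rightarrow> bexp" where "is_zero e = BNot (ILess (INum 0) e)"

text \<open>The negated conjunction expresses "column 7 is matched or column 8 is cheaper". Since
  both arguments of a connective are evaluated, register 7 must hold a valid column even when no
  free one has been seen.\<close>

definition improve_com :: com where
  "improve_com = Cond
     (BAnd (is_zero (IGet 1 (IReg 8)))
       (BNot (BAnd (is_zero (IGet 1 (IReg 7)))
         (BNot (RLess (detour_exp (IReg 5) (IReg 8)) (detour_exp (IReg 5) (IReg 7)))))))
     (ISet 7 (IReg 8)) Skip"

definition block_com :: com where
  "block_com =
     Seq (Seq (ISet 7 (IBin IMul (IReg 6) (IReg 2))) (ISet 8 (IReg 7)))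
    (Seq (While (BAnd (ILess (IReg 8) (IReg 1))
                      (ILess (IReg 8) (IBin IAdd (IBin IMul (IReg 6) (IReg 2)) (IReg 2))))
           (Seq improve_com (ISet 8 (plus1 (IReg 8)))))
     (IPut 5 (IBin IAdd (IBin IMul (IReg 5) (IReg 3)) (IReg 6)) (IReg 7)))"

definition best_com :: com where
  "best_com =
     Seq (Seq (ISet 7 (IGet 5 (IBin IMul (IReg 5) (IReg 3)))) (ISet 6 (INum 0)))
     (While (ILess (IReg 6) (IReg 3))
       (Seq (ISet 8 (IGet 5 (IBin IAdd (IBin IMul (IReg 5) (IReg 3)) (IReg 6))))
       (Seq improve_com (ISet 6 (plus1 (IReg 6))))))"

definition modifies ::
  "nat \<Rightarrow> rr_state \<Rightarrow> rr_state \<Rightarrow> nat set \<Rightarrow> nat set \<Rightarrow> nat set \<Rightarrow> nat set \<Rightarrow> bool" where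
  "modifies m s s' A B C D \<longleftrightarrow>
     (\<forall>r. r \<notin> A \<longrightarrow> ireg s' r = ireg s r) \<and> (\<forall>r. r \<notin> B \<longrightarrow> rreg s' r = rreg s r) \<and>
     (\<forall>t. t \<notin> C \<longrightarrow> iarr m s' t = iarr m s t) \<and> (\<forall>t. t \<notin> D \<longrightarrow> rarr m s' t = rarr m s t)"

lemma modifiesD:
  assumes "modifies m s s' A B C D"
  shows "r \<notin> A \<Longrightarrow> ireg s' r = ireg s r" "r \<notin> B \<Longrightarrow> rreg s' r = rreg s r"
    "r \<notin> C \<Longrightarrow> iarr m s' r = iarr m s r" "r \<notin> D \<Longrightarrow> rarr m s' r = rarr m s r"
  using assms by (auto simp: modifies_def)

lemma modifies_refl: "modifies m s s A B C D"
  by (simp add: modifies_def)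

lemma modifies_trans:
  assumes "modifies m s s' A B C D" "modifies m s' s'' A' B' C' D'"
    "A \<union> A' \<subseteq> A''" "B \<union> B' \<subseteq> B''" "C \<union> C' \<subseteq> C''" "D \<union> D' \<subseteq> D''"
  shows "modifies m s s'' A'' B'' C'' D''"
  using assms unfolding modifies_def by (intro conjI allI impI) (metis UnCI subset_iff)+

lemma div_eq_iff_interval:
  fixes j :: nat
  assumes "0 < R"
  shows "j div R = g \<longleftrightarrow> g * R \<le> j \<and> j < g * R + R"
proof
  assume "j div R = g"
  moreover have "j div R * R + j mod R = j" "j mod R < R" using assms by simp_all
  ultimately show "g * R \<le> j \<and> j < g * R + R" by auto
qed (use assms in \<open>auto intro!: div_nat_eqI simp: algebra_simps\<close>)

context gtsp_machine
begin

definition free :: "rr_state \<Rightarrow> nat set" where "free s = {j. j < m \<and> iarr m s 1 j = 0}"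
definition block :: "nat \<Rightarrow> nat set" where "block g = {j. j < m \<and> j div R = g}"

definition candidate :: "nat set \<Rightarrow> nat \<Rightarrow> nat set \<Rightarrow> nat \<Rightarrow> bool" where
  "candidate F i B a \<longleftrightarrow> a \<in> B \<and> (\<forall>j\<in>B \<inter> F. a \<in> F \<and> c i a \<le> c i j)"

text \<open>The selected value is the one computed by \<open>improve_com\<close>, which makes this
  the invariant step of both scanning loops.\<close>

lemma candidate_Un:
  assumes "candidate F i B a" "candidate F i B' b"
  shows "candidate F i (B \<union> B') (if b \<in> F \<and> \<not> (a \<in> F \<and> \<not> c i b < c i a) then b else a)"
  using assms unfolding candidate_def by (auto 4 3 intro: order_trans[of "c i b" "c i a"] order_trans[of "c i a" "c i b"])

lemma modifies_configured:
  "modifies m s s' A B C D \<Longrightarrow> configured s \<Longrightarrow> {0, Suc 0, 2, 3} \<inter> A = {} \<Longrightarrow> 0 \<notin> D \<Longrightarrow> configured s'"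
  by (auto simp: modifies_def configured_def loaded_def)

lemma reval_detour_reg:
  "loaded s \<Longrightarrow> ireg s a < R \<Longrightarrow> ireg s b < m \<Longrightarrow>
    reval w S s (detour_exp (IReg a) (IReg b)) = Some (c (ireg s a) (ireg s b))"
  by (intro reval_detour_exp) simp_all

lemma wp_improve_com:
  assumes "loaded s" "ireg s 5 < R" "ireg s 7 < m" "ireg s 8 < m"
  shows "wp w S improve_com Q s =
    Q (s\<lparr>ireg := (ireg s)(7 := if ireg s 8 \<in> free s \<and>
        \<not> (ireg s 7 \<in> free s \<and> \<not> c (ireg s 5) (ireg s 8) < c (ireg s 5) (ireg s 7))
        then ireg s 8 else ireg s 7)\<rparr>)"
proof -
  have "ireg s (Suc 0) = m" using assms(1) by (simp add: loaded_def)
  then show ?thesis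
    using assms
    by (auto simp: improve_com_def is_zero_def word_Some reval_detour_reg free_def)
qed

lemma runs_block_com:
  assumes conf: "configured s" and i: "ireg s 5 < R" and g: "ireg s 6 < G"
  shows "runs w S block_com s (1100 * (R + 1)) (\<lambda>s'. modifies m s s' {7, 8} {} {5} {} \<and>
    (\<exists>a. candidate (free s) (ireg s 5) (block (ireg s 6)) a \<and>
      iarr m s' 5 = (iarr m s 5)(ireg s 5 * G + ireg s 6 := a)))"
proof -
  let ?i = "ireg s 5" and ?g = "ireg s 6"
  let ?st = "ireg s 6 * R"
  note regs = configuredD[OF conf]
  have st: "?st < m" by (rule block_start[OF g])
  have ti: "?i * G + ?g < 2 * m" by (rule table_index[OF i g])
  \<comment> \<open>The first column of the block is included although the loop has not visited it
    yet, because register 7 is initialised with it.\<close>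
  define I where "I s' \<longleftrightarrow> modifies m s s' {7, 8} {} {} {} \<and> ?st \<le> ireg s' 8 \<and> ireg s' 8 \<le> m \<and>
    ireg s' 8 \<le> ?st + R \<and> ireg s' 7 < m \<and>
    candidate (free s) ?i (insert ?st {?st..<ireg s' 8}) (ireg s' 7)" for s'
  let ?b = "BAnd (ILess (IReg 8) (IReg 1))
     (ILess (IReg 8) (IBin IAdd (IBin IMul (IReg 6) (IReg 2)) (IReg 2)))"
  let ?body = "Seq improve_com (ISet 8 (plus1 (IReg 8)))"
  have ID: "configured s'" "ireg s' 0 = n" "ireg s' (Suc 0) = m" "ireg s' 2 = R" "ireg s' 3 = G"
    "ireg s' 5 = ?i" "ireg s' 6 = ?g" "free s' = free s" if "I s'" for s'
  proof -
    have mo: "modifies m s s' {7, 8} {} {} {}" using that by (simp add: I_def)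
    show conf': "configured s'" by (rule modifies_configured[OF mo conf]) auto
    show "ireg s' 0 = n" "ireg s' (Suc 0) = m" "ireg s' 2 = R" "ireg s' 3 = G"
      by (rule configuredD[OF conf'])+
    show "ireg s' 5 = ?i" "ireg s' 6 = ?g" "free s' = free s"
      by (simp_all add: free_def modifiesD[OF mo])
  qed
  show ?thesis
    unfolding block_com_def
  proof (rule runs_Seq_rule)
    show "runs w S (Seq (ISet 7 (IBin IMul (IReg 6) (IReg 2))) (ISet 8 (IReg 7))) s 10
      (\<lambda>s'. I s' \<and> ireg s' 8 = ?st)"
      using regs st by (intro runs_wp_rule) (auto simp: word_Some I_def modifies_def candidate_def)
  next
    fix s1 assume s1: "I s1 \<and> ireg s1 8 = ?st"
    show "runs w S (Seq (While ?b ?body) (IPut 5 (IBin IAdd (IBin IMul (IReg 5) (IReg 3)) (IReg 6)) (IReg 7)))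
      s1 (1000 * (R + 1) + 20) (\<lambda>s'. modifies m s s' {7, 8} {} {5} {} \<and>
      (\<exists>a. candidate (free s) (ireg s 5) (block (ireg s 6)) a \<and>
      iarr m s' 5 = (iarr m s 5)(ireg s 5 * G + ireg s 6 := a)))"
    proof (rule runs_Seq_rule)
      show "runs w S (While ?b ?body) s1 (1000 * (R + 1))
        (\<lambda>s'. I s' \<and> \<not> (ireg s' 8 < m \<and> ireg s' 8 < ?st + R))"
      proof (rule runs_While_rule[where I = I and \<mu> = "\<lambda>s'. ?st + R - ireg s' 8" and N = R
            and t = "ccost ?body"])
        fix s' assume Is: "I s'"
        show "beval w S s' ?b = Some (ireg s' 8 < m \<and> ireg s' 8 < ?st + R)"
          using ID[OF Is] st R_le_m by (simp add: word_Some)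
        assume lt: "ireg s' 8 < m \<and> ireg s' 8 < ?st + R"
        have ld: "loaded s'" using ID(1)[OF Is] by (simp add: configured_def)
        have s7: "ireg s' 7 < m" using Is by (simp add: I_def)
        let ?a = "if ireg s' 8 \<in> free s \<and> \<not> (ireg s' 7 \<in> free s \<and> \<not> c ?i (ireg s' 8) < c ?i (ireg s' 7))
          then ireg s' 8 else ireg s' 7"
        have "candidate (free s) ?i (insert ?st {?st..<ireg s' 8} \<union> {ireg s' 8}) ?a"
          by (rule candidate_Un) (use Is in \<open>auto simp: I_def candidate_def\<close>)
        also have "insert ?st {?st..<ireg s' 8} \<union> {ireg s' 8} = insert ?st {?st..<Suc (ireg s' 8)}"
          using Is by (auto simp: I_def)
        finally have cand: "candidate (free s) ?i (insert ?st {?st..<Suc (ireg s' 8)}) ?a" .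
        show "runs w S ?body s' (ccost ?body) (\<lambda>s''. I s'' \<and> ?st + R - ireg s'' 8 < ?st + R - ireg s' 8)"
          apply (rule runs_wp, unfold wp.simps, subst wp_improve_com[OF ld])
          using ID[OF Is] i s7 lt Is cand unfolding I_def
          by (auto simp: plus1_def word_Some modifies_def simp del: atLeastLessThan_iff)
      qed (use s1 in \<open>simp_all add: improve_com_def is_zero_def plus1_def\<close>)
    next
      fix s2 assume s2: "I s2 \<and> \<not> (ireg s2 8 < m \<and> ireg s2 8 < ?st + R)"
      then have Is2: "I s2" by simp
      \<comment> \<open>The scan ends at the end of the block or at \<open>m\<close>, whichever
        comes first; the second case is the truncated last block.\<close>
      have "block ?g = insert ?st {?st..<ireg s2 8}"
        using s2 st R_pos by (auto simp: block_def I_def div_eq_iff_interval[OF R_pos])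
      then have "candidate (free s) ?i (block ?g) (ireg s2 7)" using Is2 by (simp add: I_def)
      moreover have "modifies m s s2 {7, 8} {} {} {}" using Is2 by (simp add: I_def)
      ultimately show "runs w S (IPut 5 (IBin IAdd (IBin IMul (IReg 5) (IReg 3)) (IReg 6)) (IReg 7)) s2 20
        (\<lambda>s'. modifies m s s' {7, 8} {} {5} {} \<and> (\<exists>a. candidate (free s) ?i (block ?g) a \<and>
          iarr m s' 5 = (iarr m s 5)(?i * G + ?g := a)))"
        using ID[OF Is2] ti modifiesD(3)[of m s s2 "{7, 8}" "{}" "{}" "{}"]
        by (intro runs_wp_rule) (auto simp: word_Some modifies_def)
    qed simp
  qed simp
qed

end

section \<open>Joining a row to the search tree\<close>

definition relax_com :: com where
  "relax_com =
     Seq (ISet 15 (IGet 2 (IReg 11)))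
    (Seq (Cond (is_zero (IGet 4 (IReg 11)))
           (Seq (RSet 0 (RBin RSub (RBin RSub (detour_exp (IReg 10) (IReg 15)) (RGet 1 (IReg 10)))
                  (RGet 2 (IReg 11))))
             (Cond (RLess (RReg 0) (RGet 3 (IReg 11)))
               (Seq (RPut 3 (IReg 11) (RReg 0)) (IPut 3 (IReg 11) (IReg 10))) Skip))
           Skip)
     (ISet 11 (plus1 (IReg 11))))"

definition join_com :: com where
  "join_com =
     Seq (Seq (IPut 4 (IReg 10) (INum 1)) (ISet 5 (IReg 10)))
    (Seq best_com
    (Seq (Seq (IPut 6 (IReg 10) (IReg 7))
         (Seq (RPut 3 (IReg 10) (RBin RSub (detour_exp (IReg 10) (IReg 7)) (RGet 1 (IReg 10))))
              (ISet 11 (INum 0))))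
     (While (ILess (IReg 11) (IReg 4)) relax_com)))"

context gtsp_machine
begin

lemma loadedD:
  "configured s \<Longrightarrow> rarr m s 0 = rarr m (rr_input vs ts) 0"
  by (simp add: configured_def loaded_def)

definition table_ok :: "rr_state \<Rightarrow> bool" where
  "table_ok s \<longleftrightarrow> (\<forall>i<R. \<forall>g<G. candidate (free s) i (block g) (iarr m s 5 (i * G + g)))"

lemma runs_best_com:
  assumes conf: "configured s" and tab: "table_ok s" and i: "ireg s 5 < R" and ne: "free s \<noteq> {}"
  shows "runs w S best_com s (1100 * (G + 1)) (\<lambda>s'. modifies m s s' {6, 7, 8} {} {} {} \<and>
    ireg s' 7 \<in> free s \<and> (\<forall>j\<in>free s. c (ireg s 5) (ireg s' 7) \<le> c (ireg s 5) j))"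
proof -
  let ?i = "ireg s 5"
  note regs = configuredD[OF conf]
  have ti: "?i * G + g < 2 * m" if "g < G" for g by (rule table_index[OF i that])
  have cand: "candidate (free s) ?i (block g) (iarr m s 5 (?i * G + g))" if "g < G" for g
    using tab i that by (simp add: table_ok_def)
  then have tm: "iarr m s 5 (?i * G + g) < m" if "g < G" for g
    using that by (force simp: candidate_def block_def)
  \<comment> \<open>Block 0 belongs to \<open>B g\<close> even for \<open>g = 0\<close>, because
    register 7 starts with its entry; the loop then looks at that entry once more.\<close>
  define B where "B g = {j. j < m \<and> (j div R = 0 \<or> j div R < g)}" for g
  define I where "I s' \<longleftrightarrow> modifies m s s' {6, 7, 8} {} {} {} \<and> ireg s' 6 \<le> G \<and> ireg s' 7 < m \<and>
    candidate (free s) ?i (B (ireg s' 6)) (ireg s' 7)" for s'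
  let ?b = "ILess (IReg 6) (IReg 3)"
  let ?body = "Seq (ISet 8 (IGet 5 (IBin IAdd (IBin IMul (IReg 5) (IReg 3)) (IReg 6))))
       (Seq improve_com (ISet 6 (plus1 (IReg 6))))"
  have ID: "ireg s' 0 = n" "ireg s' (Suc 0) = m" "ireg s' 2 = R" "ireg s' 3 = G"
    "ireg s' 5 = ?i" "free s' = free s" "iarr m s' = iarr m s" "rarr m s' 0 = rarr m (rr_input vs ts) 0"
    if "I s'" for s'
  proof -
    have mo: "modifies m s s' {6, 7, 8} {} {} {}" using that by (simp add: I_def)
    show "ireg s' 0 = n" "ireg s' (Suc 0) = m" "ireg s' 2 = R" "ireg s' 3 = G" "ireg s' 5 = ?i"
      "free s' = free s" "iarr m s' = iarr m s" "rarr m s' 0 = rarr m (rr_input vs ts) 0"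
      using regs loadedD[OF conf] by (simp_all add: free_def modifiesD[OF mo] fun_eq_iff)
  qed
  show ?thesis
    unfolding best_com_def
  proof (rule runs_Seq_rule)
    have "B 0 = block 0" by (auto simp: B_def block_def)
    then show "runs w S (Seq (ISet 7 (IGet 5 (IBin IMul (IReg 5) (IReg 3)))) (ISet 6 (INum 0))) s 20
      (\<lambda>s'. I s' \<and> ireg s' 6 = 0)"
      using regs cand[OF G_pos] ti[OF G_pos] tm[OF G_pos]
      by (intro runs_wp_rule) (auto simp: word_Some I_def modifies_def)
  next
    fix s1 assume s1: "I s1 \<and> ireg s1 6 = 0"
    show "runs w S (While ?b ?body) s1 (1050 * (G + 1)) (\<lambda>s'. modifies m s s' {6, 7, 8} {} {} {} \<and>
      ireg s' 7 \<in> free s \<and> (\<forall>j\<in>free s. c ?i (ireg s' 7) \<le> c ?i j))"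
    proof (rule runs_While_rule[where I = I and \<mu> = "\<lambda>s'. G - ireg s' 6" and N = G
          and t = "ccost ?body" and g = "\<lambda>s'. ireg s' 6 < G"])
      fix s' assume Is: "I s'"
      show "beval w S s' ?b = Some (ireg s' 6 < G)"
        using ID[OF Is] by simp
      {
        assume lt: "ireg s' 6 < G"
        have s7: "ireg s' 7 < m" using Is by (simp add: I_def)
        let ?j = "iarr m s 5 (?i * G + ireg s' 6)"
        let ?a = "if ?j \<in> free s \<and> \<not> (ireg s' 7 \<in> free s \<and> \<not> c ?i ?j < c ?i (ireg s' 7))
          then ?j else ireg s' 7"
        have "candidate (free s) ?i (B (ireg s' 6) \<union> block (ireg s' 6)) ?a"
          by (rule candidate_Un) (use Is cand lt in \<open>auto simp: I_def\<close>)
        also have "B (ireg s' 6) \<union> block (ireg s' 6) = B (Suc (ireg s' 6))"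
          by (auto simp: B_def block_def)
        finally have cand': "candidate (free s) ?i (B (Suc (ireg s' 6))) ?a" .
        have bounds: "ireg s' 6 \<le> 6 * m" "?i * G \<le> 2 * m" using ti[OF lt] by linarith+
        show "runs w S ?body s' (ccost ?body) (\<lambda>s''. I s'' \<and> G - ireg s'' 6 < G - ireg s' 6)"
          apply (rule runs_wp)
          using ID[OF Is] i s7 lt Is cand' ti[OF lt] bounds tm[OF lt] unfolding I_def
          by (auto simp: plus1_def word_Some modifies_def wp_improve_com loaded_def free_def)
      }
      assume "\<not> ireg s' 6 < G"
      then have "B (ireg s' 6) = {..<m}" using Is block_of by (auto simp: B_def I_def)
      then have "candidate (free s) ?i {..<m} (ireg s' 7)" using Is by (simp add: I_def)
      moreover have "free s \<subseteq> {..<m}" by (auto simp: free_def)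
      ultimately have "ireg s' 7 \<in> free s \<and> (\<forall>j\<in>free s. c ?i (ireg s' 7) \<le> c ?i j)"
        using ne by (auto simp: candidate_def)
      then show "modifies m s s' {6, 7, 8} {} {} {} \<and> ireg s' 7 \<in> free s \<and>
          (\<forall>j\<in>free s. c ?i (ireg s' 7) \<le> c ?i j)"
        using Is by (simp add: I_def)
    qed (use s1 in \<open>simp_all add: improve_com_def is_zero_def plus1_def\<close>)
  qed simp
qed

definition tree_set :: "nat \<Rightarrow> rr_state \<Rightarrow> nat set" where
  "tree_set k s = {i. i \<le> k \<and> iarr m s 4 i \<noteq> 0}"

definition tree :: "nat \<Rightarrow> rr_state \<Rightarrow> bool" where
  "tree k s \<longleftrightarrow> (\<exists>stamp. search_tree c m k (iarr m s 2) (tree_set k s) (rarr m s 1) (rarr m s 2)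
     (rarr m s 3) (iarr m s 3) (iarr m s 6) stamp)"

text \<open>These facts survive the whole search, which writes none of the word arrays 1, 2 and 5.
  The potentials do change during the search and are therefore left to \<open>tree\<close>.\<close>

definition in_phase :: "nat \<Rightarrow> rr_state \<Rightarrow> bool" where
  "in_phase k s \<longleftrightarrow> configured s \<and> table_ok s \<and> ireg s 4 = k \<and> k < R \<and>
     free s = {..<m} - iarr m s 2 ` {..<k} \<and> (\<forall>i<k. iarr m s 2 i < m)"

lemma in_phase_modifies:
  assumes "in_phase k s" "modifies m s s' A B C D" "{0, Suc 0, 2, 3, 4} \<inter> A = {}" "0 \<notin> D"
    "{1, 2, 5} \<inter> C = {}"
  shows "in_phase k s'"
proof -
  have "configured s'" by (rule modifies_configured[OF assms(2)]) (use assms in \<open>auto simp: in_phase_def\<close>)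
  moreover have "free s' = free s" "iarr m s' 2 = iarr m s 2" "iarr m s' 5 = iarr m s 5" "ireg s' 4 = ireg s 4"
    using assms by (auto simp: free_def modifies_def)
  ultimately show ?thesis using assms(1) by (auto simp: in_phase_def table_ok_def)
qed

lemma free_nonempty: assumes "in_phase k s" shows "free s \<noteq> {}"
proof
  assume "free s = {}"
  then have "{..<m} \<subseteq> iarr m s 2 ` {..<k}" using assms by (auto simp: in_phase_def)
  then have "card {..<m} \<le> card (iarr m s 2 ` {..<k})" by (intro card_mono) auto
  also have "\<dots> \<le> k" using card_image_le[of "{..<k}"] by simp
  finally show False using assms R_le_m by (simp add: in_phase_def)
qed

lemma runs_join_com:
  assumes ph: "in_phase k s" and tr: "tree k s" and b: "ireg s 10 \<le> k" "ireg s 10 \<notin> tree_set k s"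
    "tree_set k s = {} \<and> ireg s 10 = k \<or> k \<in> tree_set k s \<and> rarr m s 3 (ireg s 10) = 0"
  shows "runs w S join_com s (1300 * (G + R + 1)) (\<lambda>s'. modifies m s s' {5, 6, 7, 8, 11, 15} {0} {3, 4, 6} {3} \<and>
    tree_set k s' = insert (ireg s 10) (tree_set k s) \<and> tree k s')"
proof -
  let ?b = "ireg s 10" and ?M = "iarr m s 2" and ?u = "rarr m s 1" and ?v = "rarr m s 2"
  have conf: "configured s" and k: "ireg s 4 = k" "k < R" using ph by (auto simp: in_phase_def)
  note regs = configuredD[OF conf]
  have km: "k < m" using k R_le_m by simp
  have Mm: "\<And>i. i < k \<Longrightarrow> ?M i < m" using ph by (simp add: in_phase_def)
  show ?thesis
    unfolding join_com_def
  proof (rule runs_Seq_rule)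
    show "runs w S (Seq (IPut 4 (IReg 10) (INum 1)) (ISet 5 (IReg 10))) s 12
      (\<lambda>s1. modifies m s s1 {5} {} {4} {} \<and> iarr m s1 4 = (iarr m s 4)(?b := 1) \<and> ireg s1 5 = ?b)"
      using regs b km by (intro runs_wp_rule) (auto simp: word_Some modifies_def)
  next
    fix s1 assume s1: "modifies m s s1 {5} {} {4} {} \<and> iarr m s1 4 = (iarr m s 4)(?b := 1) \<and> ireg s1 5 = ?b"
    then have mo1: "modifies m s s1 {5} {} {4} {}" by simp
    have ph1: "in_phase k s1" by (rule in_phase_modifies[OF ph mo1]) auto
    have f1: "free s1 = free s" by (simp add: free_def modifiesD[OF mo1])
    show "runs w S (Seq best_com
      (Seq (Seq (IPut 6 (IReg 10) (IReg 7))
         (Seq (RPut 3 (IReg 10) (RBin RSub (detour_exp (IReg 10) (IReg 7)) (RGet 1 (IReg 10))))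
              (ISet 11 (INum 0))))
       (While (ILess (IReg 11) (IReg 4)) relax_com))) s1 (1100 * (G + 1) + (600 + (700 * k + 20)))
     (\<lambda>s'. modifies m s s' {5, 6, 7, 8, 11, 15} {0} {3, 4, 6} {3} \<and>
    tree_set k s' = insert (ireg s 10) (tree_set k s) \<and> tree k s')"
    proof (rule runs_Seq_rule)
      show "runs w S best_com s1 (1100 * (G + 1)) (\<lambda>s'. modifies m s1 s' {6, 7, 8} {} {} {} \<and>
        ireg s' 7 \<in> free s1 \<and> (\<forall>j\<in>free s1. c (ireg s1 5) (ireg s' 7) \<le> c (ireg s1 5) j))"
        by (rule runs_best_com) (use ph1 s1 b k free_nonempty[OF ph1] in \<open>auto simp: in_phase_def\<close>)
    next
      fix s2 assume s2: "modifies m s1 s2 {6, 7, 8} {} {} {} \<and>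
        ireg s2 7 \<in> free s1 \<and> (\<forall>j\<in>free s1. c (ireg s1 5) (ireg s2 7) \<le> c (ireg s1 5) j)"
      then have mo2: "modifies m s s2 {5, 6, 7, 8} {} {4} {}" by (intro modifies_trans[OF mo1]) auto
      define f where "f = ireg s2 7"
      have f: "f \<in> free s" "\<And>j. j \<in> free s \<Longrightarrow> c ?b f \<le> c ?b j"
        using s2 s1 f1 by (auto simp: f_def)
      then have fm: "f < m" by (simp add: free_def)
      have s24: "iarr m s2 4 = (iarr m s 4)(?b := 1)" using s1 s2 by (auto simp: modifies_def)
      note E2 = modifiesD[OF mo2]
      show "runs w S (Seq (Seq (IPut 6 (IReg 10) (IReg 7))
         (Seq (RPut 3 (IReg 10) (RBin RSub (detour_exp (IReg 10) (IReg 7)) (RGet 1 (IReg 10))))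
              (ISet 11 (INum 0))))
       (While (ILess (IReg 11) (IReg 4)) relax_com)) s2 (600 + (700 * k + 20))
        (\<lambda>s'. modifies m s s' {5, 6, 7, 8, 11, 15} {0} {3, 4, 6} {3} \<and>
          tree_set k s' = insert (ireg s 10) (tree_set k s) \<and> tree k s')"
      proof (rule runs_Seq_rule)
        show "runs w S (Seq (IPut 6 (IReg 10) (IReg 7))
         (Seq (RPut 3 (IReg 10) (RBin RSub (detour_exp (IReg 10) (IReg 7)) (RGet 1 (IReg 10))))
              (ISet 11 (INum 0)))) s2 600 (\<lambda>s3. modifies m s s3 {5, 6, 7, 8, 11} {} {4, 6} {3} \<and>
            iarr m s3 4 = (iarr m s 4)(?b := 1) \<and> iarr m s3 6 = (iarr m s 6)(?b := f) \<and>
            rarr m s3 3 = (rarr m s 3)(?b := c ?b f - ?u ?b) \<and> ireg s3 11 = 0)"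
          apply (rule runs_wp_rule)
          using regs b km k E2 s24 fm f_def[symmetric] loadedD[OF conf]
           apply (auto simp: word_Some reval_detour_reg loaded_def)
          apply (auto simp: modifies_def)
          done
      next
        fix s3 assume s3: "modifies m s s3 {5, 6, 7, 8, 11} {} {4, 6} {3} \<and>
            iarr m s3 4 = (iarr m s 4)(?b := 1) \<and> iarr m s3 6 = (iarr m s 6)(?b := f) \<and>
            rarr m s3 3 = (rarr m s 3)(?b := c ?b f - ?u ?b) \<and> ireg s3 11 = 0"
        then have mo3: "modifies m s s3 {5, 6, 7, 8, 11} {} {4, 6} {3}" by simp
        let ?sl = "rarr m s3 3" and ?par = "iarr m s3 3"
        define new where "new i = c ?b (?M i) - ?u ?b - ?v i" for i
        \<comment> \<open>Each index is visited once, so the comparison always meets the slack from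
          \<open>s3\<close>; the loop result can thus be described pointwise from \<open>s3\<close>
          alone.\<close>
        define I where "I s' \<longleftrightarrow> modifies m s3 s' {11, 15} {0} {3} {3} \<and> ireg s' 11 \<le> k \<and>
          (\<forall>i. if i < ireg s' 11 \<and> iarr m s3 4 i = 0 \<and> new i < ?sl i
            then rarr m s' 3 i = new i \<and> iarr m s' 3 i = ?b
            else rarr m s' 3 i = ?sl i \<and> iarr m s' 3 i = ?par i)" for s'
        show "runs w S (While (ILess (IReg 11) (IReg 4)) relax_com) s3 (700 * k + 20)
          (\<lambda>s'. modifies m s s' {5, 6, 7, 8, 11, 15} {0} {3, 4, 6} {3} \<and>
            tree_set k s' = insert (ireg s 10) (tree_set k s) \<and> tree k s')"
        proof (rule runs_While_rule[where I = I and \<mu> = "\<lambda>s'. k - ireg s' 11" and N = k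
              and t = "ccost relax_com" and g = "\<lambda>s'. ireg s' 11 < k"])
          show "I s3" using s3 by (simp add: I_def modifies_refl)
        next
          fix s' assume Is: "I s'"
          then have mo: "modifies m s s' {5, 6, 7, 8, 11, 15} {0} {3, 4, 6} {3}"
            by (intro modifies_trans[OF mo3]) (auto simp: I_def)
          have "iarr m s' 4 = iarr m s3 4" and s'6: "iarr m s' 6 = (iarr m s 6)(?b := f)"
            using Is s3 by (auto simp: I_def modifies_def)
          note E = modifiesD[OF mo] this
          show "beval w S s' (ILess (IReg 11) (IReg 4)) = Some (ireg s' 11 < k)" using E k by simp
          {
            assume lt: "ireg s' 11 < k"
            have sl: "rarr m s' 3 (ireg s' 11) = ?sl (ireg s' 11)" using Is by (simp add: I_def)
            let ?i = "ireg s' 11"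
            let ?P = "iarr m s3 4 ?i = 0 \<and> new ?i < ?sl ?i"
            have eff: "runs w S relax_com s' (ccost relax_com) (\<lambda>s''. modifies m s' s'' {11, 15} {0} {3} {3} \<and>
              ireg s'' 11 = Suc ?i \<and>
              rarr m s'' 3 = (if ?P then (rarr m s' 3)(?i := new ?i) else rarr m s' 3) \<and>
              iarr m s'' 3 = (if ?P then (iarr m s' 3)(?i := ?b) else iarr m s' 3))"
              using regs b(1) km k lt Mm[OF lt] loadedD[OF conf] sl
              by (intro runs_wp)
                (simp add: relax_com_def E word_Some reval_detour_reg loaded_def is_zero_def plus1_def
                  new_def modifies_def)
            show "runs w S relax_com s' (ccost relax_com) (\<lambda>s''. I s'' \<and> k - ireg s'' 11 < k - ireg s' 11)"
            proof (rule runs_mono[OF eff order_refl], elim conjE, intro conjI)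
              fix s'' assume s'': "modifies m s' s'' {11, 15} {0} {3} {3}" "ireg s'' 11 = Suc ?i"
                "rarr m s'' 3 = (if ?P then (rarr m s' 3)(?i := new ?i) else rarr m s' 3)"
                "iarr m s'' 3 = (if ?P then (iarr m s' 3)(?i := ?b) else iarr m s' 3)"
              have "modifies m s3 s'' {11, 15} {0} {3} {3}"
                by (rule modifies_trans[OF _ s''(1)]) (use Is in \<open>auto simp: I_def\<close>)
              with s'' Is lt show "I s''" by (auto simp: I_def less_Suc_eq)
              show "k - ireg s'' 11 < k - ?i" using s''(2) lt by simp
            qed
          }
          assume "\<not> ireg s' 11 < k"
          then have new: "if i < k \<and> iarr m s3 4 i = 0 \<and> new i < ?sl i
            then rarr m s' 3 i = new i \<and> iarr m s' 3 i = ?b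
            else rarr m s' 3 i = ?sl i \<and> iarr m s' 3 i = ?par i" for i
            using Is by (simp add: I_def)
          show "modifies m s s' {5, 6, 7, 8, 11, 15} {0} {3, 4, 6} {3} \<and>
            tree_set k s' = insert (ireg s 10) (tree_set k s) \<and> tree k s'"
          proof (intro conjI mo)
            let ?X = "tree_set k s"
            show X': "tree_set k s' = insert ?b ?X"
              using E(5) s3 b(1) by (auto simp: tree_set_def)
            obtain stamp where stamp: "search_tree c m k ?M ?X ?u ?v (rarr m s 3) (iarr m s 3) (iarr m s 6) stamp"
              using tr by (auto simp: tree_def)
            have "\<exists>stamp'. search_tree c m k ?M (insert ?b ?X) ?u ?v (rarr m s' 3) (iarr m s' 3) (iarr m s' 6) stamp'"
            proof (rule search_tree_join[OF stamp b, where f = f])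
              show "f < m" "f \<notin> ?M ` {..<k}" "\<And>j. j < m \<Longrightarrow> j \<notin> ?M ` {..<k} \<Longrightarrow> c ?b f \<le> c ?b j"
                using f ph by (auto simp: in_phase_def)
              show "iarr m s' 6 ?b = f" "\<And>i. i \<in> ?X \<Longrightarrow> iarr m s' 6 i = iarr m s 6 i"
                using s'6 b(2) by auto
              \<comment> \<open>The flag of the joining row is set before the loop, so the
                relaxation skips it and leaves its new slack alone.\<close>
              have old: "rarr m s' 3 i = ?sl i" "iarr m s' 3 i = iarr m s 3 i" if "i \<in> insert ?b ?X" for i
                using new[of i] that s3 modifiesD(3)[OF mo3, of 3] by (auto simp: tree_set_def split: if_splits)
              show "rarr m s' 3 ?b = c ?b f - ?u ?b" using old(1)[of ?b] s3 by simp
              show "rarr m s' 3 i = rarr m s 3 i" if "i \<in> ?X" for i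
                using old(1)[of i] s3 that b(2) by auto
              show "iarr m s' 3 i = iarr m s 3 i" if "i \<in> insert ?b ?X" for i
                by (rule old(2)[OF that])
              show "if c ?b (?M i) - ?u ?b - ?v i < rarr m s 3 i
                then rarr m s' 3 i = c ?b (?M i) - ?u ?b - ?v i \<and> iarr m s' 3 i = ?b
                else rarr m s' 3 i = rarr m s 3 i \<and> iarr m s' 3 i = iarr m s 3 i"
                if "i < k" "i \<notin> insert ?b ?X" for i
                using new[of i] that s3 modifiesD(3)[OF mo3, of 3]
                by (auto simp: tree_set_def new_def split: if_splits)
            qed
            then show "tree k s'" unfolding tree_def X' using E by simp
          qed
        qed (use s3 in \<open>simp_all add: relax_com_def is_zero_def plus1_def\<close>)
      qed simp
    qed simp
  qed (use k in simp)
qed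

end

section \<open>The search of one phase\<close>

definition prepare_com :: com where
  "prepare_com =
     Seq (ISet 11 (INum 0))
    (Seq (While (ILess (IReg 11) (IReg 4))
           (Seq (ISet 15 (IGet 2 (IReg 11)))
           (Seq (IPut 4 (IReg 11) (INum 0))
           (Seq (RPut 3 (IReg 11) (RBin RSub (detour_exp (IReg 4) (IReg 15)) (RGet 2 (IReg 11))))
           (Seq (IPut 3 (IReg 11) (IReg 4))
                (ISet 11 (plus1 (IReg 11))))))))
    (Seq (IPut 4 (IReg 4) (INum 0)) (Seq (RPut 1 (IReg 4) (RCast (INum 0))) (ISet 10 (IReg 4)))))"

definition find_com :: com where
  "find_com =
     Seq (Seq (ISet 10 (IReg 4)) (ISet 11 (INum 0)))
     (While (ILess (IReg 11) (IReg 4))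
       (Seq (Cond (RLess (RGet 3 (IReg 11)) (RGet 3 (IReg 10))) (ISet 10 (IReg 11)) Skip)
            (ISet 11 (plus1 (IReg 11)))))"

text \<open>Real register 0 saves the step, since the entry it comes from is overwritten in the
  loop. The loop includes \<open>k\<close> because the root has a slack and a row potential; its
  cell in real array 2 is overwritten at the end of the augmentation.\<close>

definition update_com :: com where
  "update_com =
     Seq (Seq (RSet 0 (RGet 3 (IReg 10))) (ISet 11 (INum 0)))
     (While (ILess (IReg 11) (plus1 (IReg 4)))
       (Seq (RPut 3 (IReg 11) (RBin RSub (RGet 3 (IReg 11)) (RReg 0)))
       (Seq (Cond (is_zero (IGet 4 (IReg 11))) Skip
              (Seq (RPut 1 (IReg 11) (RBin RAdd (RGet 1 (IReg 11)) (RReg 0)))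
                   (RPut 2 (IReg 11) (RBin RSub (RGet 2 (IReg 11)) (RReg 0)))))
            (ISet 11 (plus1 (IReg 11))))))"

text \<open>After an update, register 10 names a row of slack zero. If it is in the tree, its
  cheapest free column is tight and the search ends; otherwise its matched column has become
  reachable and the row joins. The root enters by the same loop, its flag having been cleared
  beforehand.\<close>

definition search_com :: com where
  "search_com = While (is_zero (IGet 4 (IReg 10))) (Seq join_com (Seq find_com update_com))"

context gtsp_machine
begin

lemma in_phaseD:
  assumes "in_phase k s"
  shows "configured s" "ireg s 0 = n" "ireg s (Suc 0) = m" "ireg s 2 = R" "ireg s 3 = G" "ireg s 4 = k"
    "k < R" "k < m" "rarr m s 0 = rarr m (rr_input vs ts) 0"
  using assms R_le_m by (auto simp: in_phase_def configured_def loaded_def)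

lemma runs_find_com:
  assumes ph: "in_phase k s"
  shows "runs w S find_com s (100 * (k + 1)) (\<lambda>s'. modifies m s s' {10, 11} {} {} {} \<and> ireg s' 10 \<le> k \<and>
    (\<forall>i\<le>k. rarr m s 3 (ireg s' 10) \<le> rarr m s 3 i))"
proof -
  note P = in_phaseD[OF ph]
  let ?sl = "rarr m s 3"
  \<comment> \<open>Register 10 starts with \<open>k\<close>, so the comparison with the root holds
    from the outset and the loop needs only the rows below \<open>k\<close>.\<close>
  define I where "I s' \<longleftrightarrow> modifies m s s' {10, 11} {} {} {} \<and> ireg s' 10 \<le> k \<and> ireg s' 11 \<le> k \<and>
    ?sl (ireg s' 10) \<le> ?sl k \<and> (\<forall>i<ireg s' 11. ?sl (ireg s' 10) \<le> ?sl i)" for s'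
  show ?thesis
    unfolding find_com_def
  proof (rule runs_Seq_rule)
    show "runs w S (Seq (ISet 10 (IReg 4)) (ISet 11 (INum 0))) s 5 (\<lambda>s'. I s' \<and> ireg s' 11 = 0)"
      using P by (intro runs_wp_rule) (simp_all add: I_def modifies_def word_Some)
  next
    fix s1 assume s1: "I s1 \<and> ireg s1 11 = 0"
    let ?body = "Seq (Cond (RLess (RGet 3 (IReg 11)) (RGet 3 (IReg 10))) (ISet 10 (IReg 11)) Skip)
            (ISet 11 (plus1 (IReg 11)))"
    show "runs w S (While (ILess (IReg 11) (IReg 4)) ?body) s1 (80 * k + 20) (\<lambda>s'. modifies m s s' {10, 11} {} {} {} \<and>
      ireg s' 10 \<le> k \<and> (\<forall>i\<le>k. ?sl (ireg s' 10) \<le> ?sl i))"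
    proof (rule runs_While_rule[where I = I and \<mu> = "\<lambda>s'. k - ireg s' 11" and N = k
          and t = "ccost ?body" and g = "\<lambda>s'. ireg s' 11 < k"])
      fix s' assume Is: "I s'"
      then have mo: "modifies m s s' {10, 11} {} {} {}" and le: "ireg s' 10 \<le> k" by (auto simp: I_def)
      note E = modifiesD[OF mo]
      show "beval w S s' (ILess (IReg 11) (IReg 4)) = Some (ireg s' 11 < k)" using E P by simp
      {
        assume lt: "ireg s' 11 < k"
        have eff: "runs w S ?body s' (ccost ?body) (\<lambda>s''. modifies m s' s'' {10, 11} {} {} {} \<and>
          ireg s'' 11 = Suc (ireg s' 11) \<and>
          ireg s'' 10 = (if ?sl (ireg s' 11) < ?sl (ireg s' 10) then ireg s' 11 else ireg s' 10))"
          using P lt le by (intro runs_wp) (simp add: E word_Some plus1_def modifies_def)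
        show "runs w S ?body s' (ccost ?body) (\<lambda>s''. I s'' \<and> k - ireg s'' 11 < k - ireg s' 11)"
        proof (rule runs_mono[OF eff order_refl], elim conjE, intro conjI)
          fix s'' assume s'': "modifies m s' s'' {10, 11} {} {} {}" "ireg s'' 11 = Suc (ireg s' 11)"
            "ireg s'' 10 = (if ?sl (ireg s' 11) < ?sl (ireg s' 10) then ireg s' 11 else ireg s' 10)"
          have "modifies m s s'' {10, 11} {} {} {}" by (rule modifies_trans[OF mo s''(1)]) auto
          with s'' Is lt show "I s''" by (force simp: I_def less_Suc_eq)
          show "k - ireg s'' 11 < k - ireg s' 11" using s''(2) lt by simp
        qed
      }
      assume "\<not> ireg s' 11 < k"
      then show "modifies m s s' {10, 11} {} {} {} \<and> ireg s' 10 \<le> k \<and> (\<forall>i\<le>k. ?sl (ireg s' 10) \<le> ?sl i)"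
        using Is by (auto simp: I_def le_less)
    qed (use s1 in \<open>simp_all add: plus1_def\<close>)
  qed simp
qed

lemma runs_update_com:
  assumes ph: "in_phase k s" and b: "ireg s 10 \<le> k"
  shows "runs w S update_com s (200 * (k + 2)) (\<lambda>s'. modifies m s s' {11} {0} {} {1, 2, 3} \<and>
    (\<forall>i\<le>k. rarr m s' 3 i = rarr m s 3 i - rarr m s 3 (ireg s 10) \<and>
      rarr m s' 1 i = (if i \<in> tree_set k s then rarr m s 1 i + rarr m s 3 (ireg s 10) else rarr m s 1 i) \<and>
      rarr m s' 2 i = (if i \<in> tree_set k s then rarr m s 2 i - rarr m s 3 (ireg s 10) else rarr m s 2 i)))"
proof -
  note P = in_phaseD[OF ph]
  let ?d = "rarr m s 3 (ireg s 10)"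
  define I where "I s' \<longleftrightarrow> modifies m s s' {11} {0} {} {1, 2, 3} \<and> ireg s' 11 \<le> Suc k \<and> rreg s' 0 = ?d \<and>
    (\<forall>i. rarr m s' 3 i = (if i < ireg s' 11 then rarr m s 3 i - ?d else rarr m s 3 i) \<and>
      rarr m s' 1 i = (if i < ireg s' 11 \<and> iarr m s 4 i \<noteq> 0 then rarr m s 1 i + ?d else rarr m s 1 i) \<and>
      rarr m s' 2 i = (if i < ireg s' 11 \<and> iarr m s 4 i \<noteq> 0 then rarr m s 2 i - ?d else rarr m s 2 i))" for s'
  show ?thesis
    unfolding update_com_def
  proof (rule runs_Seq_rule)
    show "runs w S (Seq (RSet 0 (RGet 3 (IReg 10))) (ISet 11 (INum 0))) s 20 (\<lambda>s'. I s' \<and> ireg s' 11 = 0)"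
      using P b by (intro runs_wp_rule) (simp_all add: I_def modifies_def word_Some)
  next
    fix s1 assume s1: "I s1 \<and> ireg s1 11 = 0"
    let ?body = "Seq (RPut 3 (IReg 11) (RBin RSub (RGet 3 (IReg 11)) (RReg 0)))
       (Seq (Cond (is_zero (IGet 4 (IReg 11))) Skip
              (Seq (RPut 1 (IReg 11) (RBin RAdd (RGet 1 (IReg 11)) (RReg 0)))
                   (RPut 2 (IReg 11) (RBin RSub (RGet 2 (IReg 11)) (RReg 0)))))
            (ISet 11 (plus1 (IReg 11))))"
    let ?b = "ILess (IReg 11) (plus1 (IReg 4))"
    show "runs w S (While ?b ?body) s1 (180 * (k + 1) + 20) (\<lambda>s'. modifies m s s' {11} {0} {} {1, 2, 3} \<and>
    (\<forall>i\<le>k. rarr m s' 3 i = rarr m s 3 i - rarr m s 3 (ireg s 10) \<and>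
      rarr m s' 1 i = (if i \<in> tree_set k s then rarr m s 1 i + rarr m s 3 (ireg s 10) else rarr m s 1 i) \<and>
      rarr m s' 2 i = (if i \<in> tree_set k s then rarr m s 2 i - rarr m s 3 (ireg s 10) else rarr m s 2 i)))"
    proof (rule runs_While_rule[where I = I and \<mu> = "\<lambda>s'. Suc k - ireg s' 11" and N = "Suc k"
          and t = "ccost ?body" and g = "\<lambda>s'. ireg s' 11 < Suc k"])
      fix s' assume Is: "I s'"
      then have mo: "modifies m s s' {11} {0} {} {1, 2, 3}" and d: "rreg s' 0 = ?d" by (auto simp: I_def)
      note E = modifiesD[OF mo]
      show "beval w S s' ?b = Some (ireg s' 11 < Suc k)" using E P by (simp add: plus1_def word_Some)
      {
        assume lt: "ireg s' 11 < Suc k"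
        let ?i = "ireg s' 11"
        have eff: "runs w S ?body s' (ccost ?body) (\<lambda>s''. modifies m s' s'' {11} {} {} {1, 2, 3} \<and>
          ireg s'' 11 = Suc ?i \<and> rarr m s'' 3 = (rarr m s' 3)(?i := rarr m s' 3 ?i - ?d) \<and>
          rarr m s'' 1 = (if iarr m s 4 ?i \<noteq> 0 then (rarr m s' 1)(?i := rarr m s' 1 ?i + ?d) else rarr m s' 1) \<and>
          rarr m s'' 2 = (if iarr m s 4 ?i \<noteq> 0 then (rarr m s' 2)(?i := rarr m s' 2 ?i - ?d) else rarr m s' 2))"
          using P lt d by (intro runs_wp) (simp add: E word_Some plus1_def is_zero_def modifies_def)
        show "runs w S ?body s' (ccost ?body) (\<lambda>s''. I s'' \<and> Suc k - ireg s'' 11 < Suc k - ireg s' 11)"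
        proof (rule runs_mono[OF eff order_refl], elim conjE, intro conjI)
          fix s'' assume s'': "modifies m s' s'' {11} {} {} {1, 2, 3}" "ireg s'' 11 = Suc ?i"
            "rarr m s'' 3 = (rarr m s' 3)(?i := rarr m s' 3 ?i - ?d)"
            "rarr m s'' 1 = (if iarr m s 4 ?i \<noteq> 0 then (rarr m s' 1)(?i := rarr m s' 1 ?i + ?d) else rarr m s' 1)"
            "rarr m s'' 2 = (if iarr m s 4 ?i \<noteq> 0 then (rarr m s' 2)(?i := rarr m s' 2 ?i - ?d) else rarr m s' 2)"
          have "modifies m s s'' {11} {0} {} {1, 2, 3}" by (rule modifies_trans[OF mo s''(1)]) auto
          moreover have "rreg s'' 0 = ?d" using d modifiesD(2)[OF s''(1), of 0] by simp
          ultimately show "I s''" using s''(2-5) Is lt by (auto simp: I_def less_Suc_eq)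
          show "Suc k - ireg s'' 11 < Suc k - ireg s' 11" using s''(2) lt by simp
        qed
      }
      assume "\<not> ireg s' 11 < Suc k"
      then have "ireg s' 11 = Suc k" using Is by (simp add: I_def)
      then show "modifies m s s' {11} {0} {} {1, 2, 3} \<and>
    (\<forall>i\<le>k. rarr m s' 3 i = rarr m s 3 i - rarr m s 3 (ireg s 10) \<and>
      rarr m s' 1 i = (if i \<in> tree_set k s then rarr m s 1 i + rarr m s 3 (ireg s 10) else rarr m s 1 i) \<and>
      rarr m s' 2 i = (if i \<in> tree_set k s then rarr m s 2 i - rarr m s 3 (ireg s 10) else rarr m s 2 i))"
        using Is by (simp add: I_def tree_set_def)
    qed (use s1 in \<open>simp_all add: plus1_def is_zero_def\<close>)
  qed simp
qed

definition searching :: "nat \<Rightarrow> rr_state \<Rightarrow> bool" where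
  "searching k s \<longleftrightarrow> in_phase k s \<and> tree k s \<and> ireg s 10 \<le> k \<and>
     (tree_set k s = {} \<and> ireg s 10 = k \<or> k \<in> tree_set k s \<and> rarr m s 3 (ireg s 10) = 0)"

text \<open>Every iteration adds a row to the tree, so there are at most
  \<open>k + 1 \<le> R\<close> of them, each taking time \<open>O(G + R)\<close>. With
  \<open>R * G \<le> 2 * m\<close> this is \<open>O(m + R * R)\<close>.\<close>

lemma runs_search_com:
  assumes "searching k s"
  shows "runs w S search_com s (2000 * (R * (G + R + 2)) + 50)
    (\<lambda>s'. searching k s' \<and> ireg s' 10 \<in> tree_set k s')"
proof -
  let ?body = "Seq join_com (Seq find_com update_com)"
  have k: "k < R" using assms by (simp add: searching_def in_phase_def)
  show ?thesis
    unfolding search_com_def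
  proof (rule runs_While_rule[where I = "searching k" and \<mu> = "\<lambda>s'. card ({..k} - tree_set k s')" and N = R
          and t = "1300 * (G + R + 1) + (100 * (k + 1) + 200 * (k + 2))"
          and g = "\<lambda>s'. ireg s' 10 \<notin> tree_set k s'"])
    show "searching k s" by fact
    show "card ({..k} - tree_set k s) \<le> R"
      using card_mono[of "{..k}" "{..k} - tree_set k s"] k by simp
    have "R * (1 + bcost (is_zero (IGet 4 (IReg 10))) + (1300 * (G + R + 1) + (100 * (k + 1) + 200 * (k + 2))))
      \<le> R * (2000 * (G + R + 2))"
      using k by (intro mult_left_mono) (simp_all add: is_zero_def)
    moreover have "2000 * (R * (G + R + 2)) = R * (2000 * (G + R + 2))"
      by (rule mult.left_commute)
    ultimately show "R * (1 + bcost (is_zero (IGet 4 (IReg 10))) + (1300 * (G + R + 1) + (100 * (k + 1) + 200 * (k + 2))))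
      + (1 + bcost (is_zero (IGet 4 (IReg 10)))) \<le> 2000 * (R * (G + R + 2)) + 50"
      by (intro add_mono) (simp only:, simp add: is_zero_def)
  next
    fix s assume sg: "searching k s"
    then have ph: "in_phase k s" and tr: "tree k s" and b: "ireg s 10 \<le> k"
      "tree_set k s = {} \<and> ireg s 10 = k \<or> k \<in> tree_set k s \<and> rarr m s 3 (ireg s 10) = 0"
      by (auto simp: searching_def)
    note P = in_phaseD[OF ph]
    show "beval w S s (is_zero (IGet 4 (IReg 10))) = Some (ireg s 10 \<notin> tree_set k s)"
      using P b(1) by (simp add: is_zero_def word_Some tree_set_def)
    {
      assume nb: "ireg s 10 \<notin> tree_set k s"
      show "runs w S ?body s (1300 * (G + R + 1) + (100 * (k + 1) + 200 * (k + 2)))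
        (\<lambda>s'. searching k s' \<and> card ({..k} - tree_set k s') < card ({..k} - tree_set k s))"
      proof (rule runs_Seq_rule[OF runs_join_com[OF ph tr b(1) nb b(2)] _ order_refl])
        fix s1 assume s1: "modifies m s s1 {5, 6, 7, 8, 11, 15} {0} {3, 4, 6} {3} \<and>
          tree_set k s1 = insert (ireg s 10) (tree_set k s) \<and> tree k s1"
        then have ph1: "in_phase k s1" by (intro in_phase_modifies[OF ph]) auto
        have k1: "k \<in> tree_set k s1" using s1 b by auto
        have card: "card ({..k} - tree_set k s1) < card ({..k} - tree_set k s)"
          using s1 b(1) nb by (intro psubset_card_mono) auto
        show "runs w S (Seq find_com update_com) s1 (100 * (k + 1) + 200 * (k + 2))
          (\<lambda>s'. searching k s' \<and> card ({..k} - tree_set k s') < card ({..k} - tree_set k s))"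
        proof (rule runs_Seq_rule[OF runs_find_com[OF ph1] _ order_refl])
          fix s2 assume s2: "modifies m s1 s2 {10, 11} {} {} {} \<and> ireg s2 10 \<le> k \<and>
            (\<forall>i\<le>k. rarr m s1 3 (ireg s2 10) \<le> rarr m s1 3 i)"
          then have mo2: "modifies m s1 s2 {10, 11} {} {} {}" and b2: "ireg s2 10 \<le> k" by auto
          have ph2: "in_phase k s2" by (rule in_phase_modifies[OF ph1 mo2]) auto
          have arr2: "iarr m s2 = iarr m s1" "rarr m s2 = rarr m s1" using mo2 by (auto simp: modifies_def)
          then have X2: "tree_set k s2 = tree_set k s1" by (simp add: tree_set_def)
          show "runs w S update_com s2 (200 * (k + 2))
            (\<lambda>s'. searching k s' \<and> card ({..k} - tree_set k s') < card ({..k} - tree_set k s))"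
          proof (rule runs_mono[OF runs_update_com[OF ph2 b2] order_refl])
            fix s3 assume s3: "modifies m s2 s3 {11} {0} {} {1, 2, 3} \<and>
              (\<forall>i\<le>k. rarr m s3 3 i = rarr m s2 3 i - rarr m s2 3 (ireg s2 10) \<and>
                rarr m s3 1 i = (if i \<in> tree_set k s2 then rarr m s2 1 i + rarr m s2 3 (ireg s2 10) else rarr m s2 1 i) \<and>
                rarr m s3 2 i = (if i \<in> tree_set k s2 then rarr m s2 2 i - rarr m s2 3 (ireg s2 10) else rarr m s2 2 i))"
            then have mo3: "modifies m s2 s3 {11} {0} {} {1, 2, 3}" by simp
            have ph3: "in_phase k s3" by (rule in_phase_modifies[OF ph2 mo3]) auto
            have ia3: "iarr m s3 = iarr m s1" using mo3 arr2 by (auto simp: modifies_def)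
            then have X3: "tree_set k s3 = tree_set k s1" by (simp add: tree_set_def)
            have b3: "ireg s3 10 = ireg s2 10" using modifiesD(1)[OF mo3, of 10] by simp
            obtain stamp where stamp: "search_tree c m k (iarr m s1 2) (tree_set k s1) (rarr m s1 1) (rarr m s1 2)
              (rarr m s1 3) (iarr m s1 3) (iarr m s1 6) stamp" using s1 by (auto simp: tree_def)
            have "search_tree c m k (iarr m s1 2) (tree_set k s1) (rarr m s3 1) (rarr m s3 2)
              (rarr m s3 3) (iarr m s1 3) (iarr m s1 6) stamp"
              by (rule search_tree_update[OF stamp k1 b2]) (use s2 s3 arr2 X2 in auto)
            then have "tree k s3" unfolding tree_def ia3 X3 by blast
            moreover have "rarr m s3 3 (ireg s3 10) = 0" using s3 b3 b2 by simp
            ultimately show "searching k s3 \<and> card ({..k} - tree_set k s3) < card ({..k} - tree_set k s)"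
              using ph3 b3 b2 k1 card by (simp add: searching_def X3)
          qed
        qed
      qed
    }
    assume "\<not> ireg s 10 \<notin> tree_set k s"
    then show "searching k s \<and> ireg s 10 \<in> tree_set k s" using sg by simp
  qed
qed

lemma runs_prepare_com:
  assumes ph: "in_phase k s" and rm: "row_matching c m k (iarr m s 2) (rarr m s 1) (rarr m s 2)"
  shows "runs w S prepare_com s (700 * (k + 1)) (searching k)"
proof -
  note P = in_phaseD[OF ph]
  let ?M = "iarr m s 2" and ?v = "rarr m s 2"
  have Mm: "\<And>i. i < k \<Longrightarrow> ?M i < m" using ph by (simp add: in_phase_def)
  define I where "I s' \<longleftrightarrow> modifies m s s' {11, 15} {} {3, 4} {3} \<and> ireg s' 11 \<le> k \<and>
    (\<forall>i<ireg s' 11. iarr m s' 4 i = 0 \<and> rarr m s' 3 i = c k (?M i) - ?v i \<and> iarr m s' 3 i = k)" for s'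
  show ?thesis
    unfolding prepare_com_def
  proof (rule runs_Seq_rule)
    show "runs w S (ISet 11 (INum 0)) s 2 (\<lambda>s'. I s' \<and> ireg s' 11 = 0)"
      by (intro runs_wp_rule) (simp_all add: I_def modifies_def word_Some)
  next
    fix s1 assume s1: "I s1 \<and> ireg s1 11 = 0"
    let ?body = "Seq (ISet 15 (IGet 2 (IReg 11)))
           (Seq (IPut 4 (IReg 11) (INum 0))
           (Seq (RPut 3 (IReg 11) (RBin RSub (detour_exp (IReg 4) (IReg 15)) (RGet 2 (IReg 11))))
           (Seq (IPut 3 (IReg 11) (IReg 4))
                (ISet 11 (plus1 (IReg 11))))))"
    let ?end = "Seq (IPut 4 (IReg 4) (INum 0)) (Seq (RPut 1 (IReg 4) (RCast (INum 0))) (ISet 10 (IReg 4)))"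
    show "runs w S (Seq (While (ILess (IReg 11) (IReg 4)) ?body) ?end) s1 (600 * k + 10 + 50) (searching k)"
    proof (rule runs_Seq_rule[OF _ _ order_refl])
      show "runs w S (While (ILess (IReg 11) (IReg 4)) ?body) s1 (600 * k + 10) (\<lambda>s'. I s' \<and> ireg s' 11 = k)"
      proof (rule runs_While_rule[where I = I and \<mu> = "\<lambda>s'. k - ireg s' 11" and N = k
          and t = "ccost ?body" and g = "\<lambda>s'. ireg s' 11 < k"])
        fix s' assume Is: "I s'"
        then have mo: "modifies m s s' {11, 15} {} {3, 4} {3}" by (auto simp: I_def)
        note E = modifiesD[OF mo]
        show "beval w S s' (ILess (IReg 11) (IReg 4)) = Some (ireg s' 11 < k)" using E P by simp
        {
          assume lt: "ireg s' 11 < k"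
          let ?i = "ireg s' 11"
          have eff: "runs w S ?body s' (ccost ?body) (\<lambda>s''. modifies m s' s'' {11, 15} {} {3, 4} {3} \<and>
            ireg s'' 11 = Suc ?i \<and> iarr m s'' 4 = (iarr m s' 4)(?i := 0) \<and>
            rarr m s'' 3 = (rarr m s' 3)(?i := c k (?M ?i) - ?v ?i) \<and> iarr m s'' 3 = (iarr m s' 3)(?i := k))"
            using P lt Mm[OF lt]
            by (intro runs_wp) (simp add: E word_Some plus1_def modifies_def reval_detour_reg loaded_def)
          show "runs w S ?body s' (ccost ?body) (\<lambda>s''. I s'' \<and> k - ireg s'' 11 < k - ireg s' 11)"
          proof (rule runs_mono[OF eff order_refl], elim conjE, intro conjI)
            fix s'' assume s'': "modifies m s' s'' {11, 15} {} {3, 4} {3}"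
              "ireg s'' 11 = Suc ?i" "iarr m s'' 4 = (iarr m s' 4)(?i := 0)"
              "rarr m s'' 3 = (rarr m s' 3)(?i := c k (?M ?i) - ?v ?i)" "iarr m s'' 3 = (iarr m s' 3)(?i := k)"
            have "modifies m s s'' {11, 15} {} {3, 4} {3}" by (rule modifies_trans[OF mo s''(1)]) auto
            then show "I s''" using s''(2-5) Is lt by (auto simp: I_def less_Suc_eq)
            show "k - ireg s'' 11 < k - ireg s' 11" using s''(2) lt by simp
          qed
        }
        assume "\<not> ireg s' 11 < k"
        then show "I s' \<and> ireg s' 11 = k" using Is by (simp add: I_def)
      qed (use s1 in \<open>simp_all add: plus1_def\<close>)
    next
      fix s2 assume s2: "I s2 \<and> ireg s2 11 = k"
      then have mo2: "modifies m s s2 {11, 15} {} {3, 4} {3}" by (auto simp: I_def)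
      note E = modifiesD[OF mo2]
      have eff: "runs w S ?end s2 50 (\<lambda>s3. modifies m s2 s3 {10} {} {4} {1} \<and> ireg s3 10 = k \<and>
        iarr m s3 4 = (iarr m s2 4)(k := 0) \<and> rarr m s3 1 = (rarr m s 1)(k := 0))"
        using P by (intro runs_wp_rule) (simp_all add: E word_Some modifies_def)
      show "runs w S ?end s2 50 (searching k)"
      proof (rule runs_mono[OF eff order_refl], elim conjE)
        fix s3 assume s3: "modifies m s2 s3 {10} {} {4} {1}" "ireg s3 10 = k"
          "iarr m s3 4 = (iarr m s2 4)(k := 0)" "rarr m s3 1 = (rarr m s 1)(k := 0)"
        have mo3: "modifies m s s3 {10, 11, 15} {} {3, 4} {1, 3}" by (rule modifies_trans[OF mo2 s3(1)]) auto
        note E3 = modifiesD[OF mo3] modifiesD[OF s3(1)]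
        have "in_phase k s3" by (rule in_phase_modifies[OF ph mo3]) auto
        moreover have X: "tree_set k s3 = {}" using s2 s3(3) by (auto simp: tree_set_def I_def)
        moreover have "tree k s3"
        proof -
          have "search_tree c m k ?M {} ((rarr m s 1)(k := 0)) ?v (rarr m s3 3) (iarr m s3 3) (iarr m s3 6) (\<lambda>_. 0)"
            by (rule search_tree_init[OF rm c_nonneg]) (use s2 E3 in \<open>auto simp: I_def\<close>)
          moreover have "iarr m s3 2 = ?M" "rarr m s3 2 = ?v" by (simp_all add: E3)
          ultimately show ?thesis unfolding tree_def X s3(4) by auto
        qed
        ultimately show "searching k s3" using s3(2) by (simp add: searching_def)
      qed
    qed
  qed simp
qed

end

section \<open>Augmentation and repair of the block table\<close>

definition augment_com :: com where
  "augment_com =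
     Seq (Seq (ISet 12 (IReg 10)) (Seq (ISet 14 (IGet 6 (IReg 10))) (Seq (ISet 13 (IReg 14)) (RSet 1 (RCast (INum 0))))))
    (Seq (While (ILess (IReg 12) (IReg 4))
           (Seq (ISet 15 (IGet 2 (IReg 12)))
           (Seq (IPut 2 (IReg 12) (IReg 13))
           (Seq (ISet 13 (IReg 15))
           (Seq (RSet 2 (RGet 2 (IReg 12)))
           (Seq (RPut 2 (IReg 12) (RReg 1))
           (Seq (RSet 1 (RReg 2))
                (ISet 12 (IGet 3 (IReg 12))))))))))
     (Seq (IPut 2 (IReg 4) (IReg 13)) (RPut 2 (IReg 4) (RReg 1))))"

definition mark_com :: com where
  "mark_com =
     Seq (Seq (IPut 1 (IReg 14) (INum 1)) (Seq (ISet 6 (IBin IDiv (IReg 14) (IReg 2))) (ISet 5 (INum 0))))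
     (While (ILess (IReg 5) (IReg 2)) (Seq block_com (ISet 5 (plus1 (IReg 5)))))"

definition phase_com :: com where
  "phase_com = Seq prepare_com (Seq search_com (Seq augment_com (Seq mark_com (ISet 4 (plus1 (IReg 4))))))"

definition init_com :: com where
  "init_com =
     Seq (Seq (ISet 2 (IBin IMul (IReg 0) (IReg 0)))
         (Seq (ISet 3 (plus1 (IBin IDiv (IBin ISub (IReg 1) (INum 1)) (IReg 2)))) (ISet 5 (INum 0))))
    (Seq (While (ILess (IReg 5) (IReg 2))
           (Seq (ISet 6 (INum 0))
           (Seq (While (ILess (IReg 6) (IReg 3)) (Seq block_com (ISet 6 (plus1 (IReg 6)))))
                (ISet 5 (plus1 (IReg 5))))))
     (ISet 4 (INum 0)))"

definition matching_com :: com where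
  "matching_com = Seq init_com (While (ILess (IReg 4) (IReg 2)) phase_com)"

context gtsp_machine
begin

definition matched :: "nat \<Rightarrow> rr_state \<Rightarrow> bool" where
  "matched k s \<longleftrightarrow> configured s \<and> table_ok s \<and> ireg s 4 = k \<and> k \<le> R \<and>
     free s = {..<m} - iarr m s 2 ` {..<k} \<and> row_matching c m k (iarr m s 2) (rarr m s 1) (rarr m s 2)"

lemma matched_in_phase: "matched k s \<Longrightarrow> k < R \<Longrightarrow> in_phase k s"
  by (auto simp: matched_def in_phase_def row_matching_def)

text \<open>The walk towards the root terminates because stamps decrease along \<open>par\<close>;
  the program itself stores no stamps. Register 14 keeps the new column for the subsequent
  marking.\<close>

lemma runs_augment_com:
  assumes sg: "searching k s" and bX: "ireg s 10 \<in> tree_set k s"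
  shows "runs w S augment_com s (100 * (k + 2)) (\<lambda>s'. modifies m s s' {12, 13, 14, 15} {1, 2} {2} {2} \<and>
    row_matching c m (Suc k) (iarr m s' 2) (rarr m s' 1) (rarr m s' 2) \<and>
    iarr m s' 2 ` {..<Suc k} = insert (ireg s' 14) (iarr m s 2 ` {..<k}) \<and> ireg s' 14 \<in> free s)"
proof -
  have ph: "in_phase k s" and b: "ireg s 10 \<le> k" using sg by (auto simp: searching_def)
  note P = in_phaseD[OF ph]
  let ?M = "iarr m s 2" and ?u = "rarr m s 1" and ?v = "rarr m s 2" and ?X = "tree_set k s"
  let ?f = "iarr m s 6 (ireg s 10)"
  have sl: "rarr m s 3 (ireg s 10) = 0" using sg bX by (auto simp: searching_def)
  obtain stamp where stamp: "search_tree c m k ?M ?X ?u ?v (rarr m s 3) (iarr m s 3) (iarr m s 6) stamp"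
    using sg by (auto simp: searching_def tree_def)
  have f: "?f < m" "?f \<notin> ?M ` {..<k}" using stamp bX by (auto simp: search_tree_def)
  then have ff: "?f \<in> free s" using ph by (auto simp: in_phase_def)
  have X: "i \<le> k" if "i \<in> ?X" for i using that by (simp add: tree_set_def)
  \<comment> \<open>The tree has at most \<open>k + 1\<close> rows and all stamps are below their
    number, which bounds the number of iterations by \<open>k\<close>.\<close>
  have rk: "stamp i \<le> k" if "i \<in> ?X" for i
  proof -
    have "stamp i < card ?X" using stamp that by (auto simp: search_tree_def)
    also have "card ?X \<le> card {..k}" using X by (intro card_mono) auto
    finally show ?thesis by simp
  qed
  define I where "I s' \<longleftrightarrow> modifies m s s' {12, 13, 14, 15} {1, 2} {2} {2} \<and> ireg s' 14 = ?f \<and>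
    augmenting c k ?M ?u ?v ?X stamp ?f (iarr m s' 2) (rarr m s' 2) (ireg s' 12) (ireg s' 13) (rreg s' 1)" for s'
  let ?body = "Seq (ISet 15 (IGet 2 (IReg 12)))
           (Seq (IPut 2 (IReg 12) (IReg 13))
           (Seq (ISet 13 (IReg 15))
           (Seq (RSet 2 (RGet 2 (IReg 12)))
           (Seq (RPut 2 (IReg 12) (RReg 1))
           (Seq (RSet 1 (RReg 2))
                (ISet 12 (IGet 3 (IReg 12))))))))"
  let ?end = "Seq (IPut 2 (IReg 4) (IReg 13)) (RPut 2 (IReg 4) (RReg 1))"
  have IX: "ireg s' 12 \<in> ?X" if "I s'" for s' using that by (simp add: I_def augmenting_def)
  show ?thesis
    unfolding augment_com_def
  proof (rule runs_Seq_rule)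
    show "runs w S (Seq (ISet 12 (IReg 10)) (Seq (ISet 14 (IGet 6 (IReg 10))) (Seq (ISet 13 (IReg 14)) (RSet 1 (RCast (INum 0)))))) s 30 I"
      using P b augmenting_init[OF stamp bX sl]
      by (intro runs_wp_rule) (simp_all add: I_def modifies_def word_Some)
  next
    fix s1 assume s1: "I s1"
    show "runs w S (Seq (While (ILess (IReg 12) (IReg 4)) ?body) ?end) s1 (80 * k + 10 + 30)
      (\<lambda>s'. modifies m s s' {12, 13, 14, 15} {1, 2} {2} {2} \<and>
    row_matching c m (Suc k) (iarr m s' 2) (rarr m s' 1) (rarr m s' 2) \<and>
    iarr m s' 2 ` {..<Suc k} = insert (ireg s' 14) (iarr m s 2 ` {..<k}) \<and> ireg s' 14 \<in> free s)"
    proof (rule runs_Seq_rule[OF _ _ order_refl])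
      show "runs w S (While (ILess (IReg 12) (IReg 4)) ?body) s1 (80 * k + 10) (\<lambda>s'. I s' \<and> ireg s' 12 = k)"
      proof (rule runs_While_rule[where I = I and \<mu> = "\<lambda>s'. stamp (ireg s' 12)" and N = k
          and t = "ccost ?body" and g = "\<lambda>s'. ireg s' 12 < k"])
        fix s' assume Is: "I s'"
        then have mo: "modifies m s s' {12, 13, 14, 15} {1, 2} {2} {2}" by (auto simp: I_def)
        note E = modifiesD[OF mo]
        let ?x = "ireg s' 12"
        have xX: "?x \<in> ?X" by (rule IX[OF Is])
        show "beval w S s' (ILess (IReg 12) (IReg 4)) = Some (?x < k)" using E P by simp
        {
          assume lt: "?x < k"
          have eff: "runs w S ?body s' (ccost ?body) (\<lambda>s''. modifies m s' s'' {12, 13, 15} {1, 2} {2} {2} \<and>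
            iarr m s'' 2 = (iarr m s' 2)(?x := ireg s' 13) \<and> rarr m s'' 2 = (rarr m s' 2)(?x := rreg s' 1) \<and>
            ireg s'' 12 = iarr m s 3 ?x \<and> ireg s'' 13 = iarr m s' 2 ?x \<and> rreg s'' 1 = rarr m s' 2 ?x)"
            using P lt by (intro runs_wp) (simp add: E modifies_def)
          have aug: "augmenting c k ?M ?u ?v ?X stamp ?f (iarr m s' 2) (rarr m s' 2) ?x (ireg s' 13) (rreg s' 1)"
            using Is by (simp add: I_def)
          show "runs w S ?body s' (ccost ?body) (\<lambda>s''. I s'' \<and> stamp (ireg s'' 12) < stamp ?x)"
          proof (rule runs_mono[OF eff order_refl], elim conjE, intro conjI)
            fix s'' assume s'': "modifies m s' s'' {12, 13, 15} {1, 2} {2} {2}"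
              "iarr m s'' 2 = (iarr m s' 2)(?x := ireg s' 13)" "rarr m s'' 2 = (rarr m s' 2)(?x := rreg s' 1)"
              "ireg s'' 12 = iarr m s 3 ?x" "ireg s'' 13 = iarr m s' 2 ?x" "rreg s'' 1 = rarr m s' 2 ?x"
            have "modifies m s s'' {12, 13, 14, 15} {1, 2} {2} {2}" by (rule modifies_trans[OF mo s''(1)]) auto
            moreover have "ireg s'' 14 = ?f" using modifiesD(1)[OF s''(1), of 14] Is by (simp add: I_def)
            ultimately show "I s''"
              unfolding I_def s''(2-6) using augmenting_step(1)[OF stamp aug] lt by simp
            show "stamp (ireg s'' 12) < stamp ?x"
              unfolding s''(4) by (rule augmenting_step(2)[OF stamp aug]) (use lt in simp)
          qed
        }
        assume "\<not> ?x < k"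
        then show "I s' \<and> ?x = k" using Is X[OF xX] by simp
      qed (use s1 rk[OF IX[OF s1]] in simp_all)
    next
      fix s2 assume s2: "I s2 \<and> ireg s2 12 = k"
      then have mo2: "modifies m s s2 {12, 13, 14, 15} {1, 2} {2} {2}" by (auto simp: I_def)
      note E = modifiesD[OF mo2]
      have aug: "augmenting c k ?M ?u ?v ?X stamp ?f (iarr m s2 2) (rarr m s2 2) k (ireg s2 13) (rreg s2 1)"
        using s2 by (auto simp: I_def)
      have eff: "runs w S ?end s2 30 (\<lambda>s3. modifies m s2 s3 {} {} {2} {2} \<and>
        iarr m s3 2 = (iarr m s2 2)(k := ireg s2 13) \<and> rarr m s3 2 = (rarr m s2 2)(k := rreg s2 1))"
        using P by (intro runs_wp_rule) (simp_all add: E modifies_def)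
      show "runs w S ?end s2 30 (\<lambda>s'. modifies m s s' {12, 13, 14, 15} {1, 2} {2} {2} \<and>
        row_matching c m (Suc k) (iarr m s' 2) (rarr m s' 1) (rarr m s' 2) \<and>
        iarr m s' 2 ` {..<Suc k} = insert (ireg s' 14) (iarr m s 2 ` {..<k}) \<and> ireg s' 14 \<in> free s)"
      proof (rule runs_mono[OF eff order_refl], elim conjE)
        fix s3 assume s3: "modifies m s2 s3 {} {} {2} {2}"
          "iarr m s3 2 = (iarr m s2 2)(k := ireg s2 13)" "rarr m s3 2 = (rarr m s2 2)(k := rreg s2 1)"
        have mo3: "modifies m s s3 {12, 13, 14, 15} {1, 2} {2} {2}" by (rule modifies_trans[OF mo2 s3(1)]) auto
        have u3: "rarr m s3 1 = ?u" using modifiesD(4)[OF mo3, of 1] by simp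
        have f3: "ireg s3 14 = ?f" using modifiesD(1)[OF s3(1), of 14] s2 by (simp add: I_def)
        show "modifies m s s3 {12, 13, 14, 15} {1, 2} {2} {2} \<and>
          row_matching c m (Suc k) (iarr m s3 2) (rarr m s3 1) (rarr m s3 2) \<and>
          iarr m s3 2 ` {..<Suc k} = insert (ireg s3 14) (iarr m s 2 ` {..<k}) \<and> ireg s3 14 \<in> free s"
          unfolding s3(2,3) u3 f3
          by (intro conjI mo3 ff augmenting_final[OF stamp f aug])
      qed
    qed
  qed simp
qed

lemma table_index_eq_iff:
  assumes "g < G" "g' < G"
  shows "i * G + g = i' * G + g' \<longleftrightarrow> i = i' \<and> g = g'"
proof
  assume eq: "i * G + g = i' * G + g'"
  then have "(i * G + g) div G = (i' * G + g') div G" by simp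
  then have "i = i'" using assms by simp
  with eq show "i = i' \<and> g = g'" by simp
qed simp

definition entry_ok :: "rr_state \<Rightarrow> nat \<Rightarrow> nat \<Rightarrow> bool" where
  "entry_ok s i g \<longleftrightarrow> candidate (free s) i (block g) (iarr m s 5 (i * G + g))"

text \<open>Recomputing one entry spoils no other. This form serves both the repair, which runs
  through one block for all rows, and the initialization, which fills the table row by row.\<close>

lemma runs_block_entry:
  assumes conf: "configured s" and i: "ireg s 5 < R" and g: "ireg s 6 < G"
  shows "runs w S block_com s (1100 * (R + 1)) (\<lambda>s'. modifies m s s' {7, 8} {} {5} {} \<and>
    (\<forall>i g. g < G \<longrightarrow> entry_ok s i g \<or> i = ireg s 5 \<and> g = ireg s 6 \<longrightarrow> entry_ok s' i g))"
proof (rule runs_mono[OF runs_block_com[OF assms] order_refl], elim conjE exE, intro conjI allI impI)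
  fix s' a i' g' assume mo: "modifies m s s' {7, 8} {} {5} {}"
    and a: "candidate (free s) (ireg s 5) (block (ireg s 6)) a"
      "iarr m s' 5 = (iarr m s 5)(ireg s 5 * G + ireg s 6 := a)"
    and g': "g' < G" "entry_ok s i' g' \<or> i' = ireg s 5 \<and> g' = ireg s 6"
  have "free s' = free s" by (simp add: free_def modifiesD[OF mo])
  then show "entry_ok s' i' g'" using a g' g by (auto simp: entry_ok_def table_index_eq_iff)
qed

text \<open>After an augmentation the flags and the table still describe the old set of free
  columns. Only the block of the new column has to be rescanned, for all \<open>R\<close> rows, in
  time \<open>O(R * R)\<close>.\<close>

lemma runs_mark_com:
  assumes conf: "configured s" and tab: "table_ok s" and f: "ireg s 14 \<in> free s"
  shows "runs w S mark_com s (1200 * R * (R + 1) + 50) (\<lambda>s'. modifies m s s' {5, 6, 7, 8} {} {1, 5} {} \<and>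
    free s' = free s - {ireg s 14} \<and> table_ok s')"
proof -
  let ?f = "ireg s 14"
  have fm: "?f < m" using f by (simp add: free_def)
  note regs = configuredD[OF conf]
  let ?g = "?f div R"
  have g: "?g < G" by (rule block_of[OF fm])
  let ?Q = "\<lambda>s1. modifies m s s1 {5, 6} {} {1} {} \<and> iarr m s1 1 = (iarr m s 1)(?f := 1) \<and> ireg s1 5 = 0 \<and> ireg s1 6 = ?g"
  show ?thesis
    unfolding mark_com_def
  proof (rule runs_Seq_rule)
    have "word w ?g = Some ?g" using fm order_trans[OF div_le_dividend[of ?f R]] by (intro word_Some) simp
    then show "runs w S (Seq (IPut 1 (IReg 14) (INum 1)) (Seq (ISet 6 (IBin IDiv (IReg 14) (IReg 2))) (ISet 5 (INum 0)))) s 30 ?Q"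
      using regs fm R_pos by (intro runs_wp_rule) (simp_all add: word_Some modifies_def)
  next
    fix s1 assume s1: "?Q s1"
    then have mo1: "modifies m s s1 {5, 6} {} {1} {}" by simp
    have free1: "free s1 = free s - {?f}" using s1 by (auto simp: free_def)
    define I where "I s' \<longleftrightarrow> modifies m s1 s' {5, 7, 8} {} {5} {} \<and> ireg s' 5 \<le> R \<and>
      (\<forall>i<R. \<forall>g<G. i < ireg s' 5 \<or> g \<noteq> ?g \<longrightarrow> entry_ok s' i g)" for s'
    let ?body = "Seq block_com (ISet 5 (plus1 (IReg 5)))"
    show "runs w S (While (ILess (IReg 5) (IReg 2)) ?body) s1 (1200 * R * (R + 1) + 20)
      (\<lambda>s'. modifies m s s' {5, 6, 7, 8} {} {1, 5} {} \<and> free s' = free s - {?f} \<and> table_ok s')"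
    proof (rule runs_While_rule[where I = I and \<mu> = "\<lambda>s'. R - ireg s' 5" and N = R
          and t = "1100 * (R + 1) + 5" and g = "\<lambda>s'. ireg s' 5 < R"])
      \<comment> \<open>A block that does not contain the newly matched column has the same free
        columns as before, so its stored candidate remains valid.\<close>
      have "entry_ok s1 i g" if "i < R" "g < G" "g \<noteq> ?g" for i g
      proof -
        have "candidate (free s) i (block g) (iarr m s 5 (i * G + g))" using tab that by (simp add: table_ok_def)
        moreover have "?f \<notin> block g" using that by (auto simp: block_def)
        ultimately show ?thesis
          unfolding entry_ok_def free1 modifiesD(3)[OF mo1, of 5, simplified]
          by (auto simp: candidate_def)
      qed
      then show "I s1" using s1 by (auto simp: I_def modifies_refl)
    next
      fix s' assume Is: "I s'"
      then have mo: "modifies m s1 s' {5, 7, 8} {} {5} {}" by (auto simp: I_def)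
      have mo': "modifies m s s' {5, 6, 7, 8} {} {1, 5} {}" by (rule modifies_trans[OF mo1 mo]) auto
      have conf': "configured s'" by (rule modifies_configured[OF mo' conf]) auto
      note regs' = configuredD[OF conf']
      have free': "free s' = free s1" by (simp add: free_def modifiesD[OF mo])
      have g': "ireg s' 6 = ?g" using modifiesD(1)[OF mo, of 6] s1 by simp
      show "beval w S s' (ILess (IReg 5) (IReg 2)) = Some (ireg s' 5 < R)" using regs' by simp
      {
        assume lt: "ireg s' 5 < R"
        have g6: "ireg s' 6 < G" using g g' by simp
        show "runs w S ?body s' (1100 * (R + 1) + 5) (\<lambda>s''. I s'' \<and> R - ireg s'' 5 < R - ireg s' 5)"
        proof (rule runs_Seq_rule[OF runs_block_entry[OF conf' lt g6] _ order_refl])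
          fix s2 assume s2: "modifies m s' s2 {7, 8} {} {5} {} \<and>
            (\<forall>i g. g < G \<longrightarrow> entry_ok s' i g \<or> i = ireg s' 5 \<and> g = ireg s' 6 \<longrightarrow> entry_ok s2 i g)"
          then have mo2: "modifies m s' s2 {7, 8} {} {5} {}" by simp
          have r5: "ireg s2 5 = ireg s' 5" using modifiesD(1)[OF mo2, of 5] by simp
          let ?s3 = "s2\<lparr>ireg := (ireg s2)(5 := Suc (ireg s2 5))\<rparr>"
          have mo3: "modifies m s1 ?s3 {5, 7, 8} {} {5} {}"
            using modifies_trans[OF mo mo2, of "{5, 7, 8}" "{}" "{5}" "{}"] by (auto simp: modifies_def)
          have "entry_ok ?s3 i g" if "i < R" "g < G" "i < Suc (ireg s' 5) \<or> g \<noteq> ?g" for i g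
          proof -
            have "entry_ok s2 i g" using s2 that Is g' unfolding I_def less_Suc_eq by metis
            then show ?thesis by (simp add: entry_ok_def free_def)
          qed
          then have I3: "I ?s3" using mo3 lt r5 by (simp add: I_def)
          then show "runs w S (ISet 5 (plus1 (IReg 5))) s2 5 (\<lambda>s''. I s'' \<and> R - ireg s'' 5 < R - ireg s' 5)"
            using lt r5 R_le_m by (intro runs_wp_rule) (simp_all add: plus1_def word_Some)
        qed
      }
      assume "\<not> ireg s' 5 < R"
      then have "table_ok s'" using Is by (auto simp: I_def table_ok_def entry_ok_def)
      then show "modifies m s s' {5, 6, 7, 8} {} {1, 5} {} \<and> free s' = free s - {?f} \<and> table_ok s'"
        using mo' free' free1 by simp
    next
      show "R * (1 + bcost (ILess (IReg 5) (IReg 2)) + (1100 * (R + 1) + 5)) + (1 + bcost (ILess (IReg 5) (IReg 2)))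
        \<le> 1200 * R * (R + 1) + 20"
        by (simp add: algebra_simps)
    qed simp
  qed simp
qed

end

section \<open>Listing the unmatched columns\<close>

definition output_com :: com where
  "output_com =
     Seq (Seq (ISet 8 (INum 0)) (ISet 16 (INum 0)))
     (While (ILess (IReg 8) (IReg 1))
       (Seq (Cond (is_zero (IGet 1 (IReg 8)))
              (Seq (IPut 0 (IReg 16) (IReg 8)) (ISet 16 (plus1 (IReg 16)))) Skip)
            (ISet 8 (plus1 (IReg 8)))))"

text \<open>Without inner points the matching would divide by \<open>R = 0\<close>, so it is
  skipped; all flags are then zero and every terminal pair is listed.\<close>

definition gtsp_com :: com where
  "gtsp_com = Seq (Cond (ILess (INum 0) (IReg 0)) matching_com Skip) output_com"

context array_machine
begin

text \<open>This is proved outside \<open>gtsp_machine\<close> because the output is also produced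
  when there are no inner points.\<close>

lemma runs_output_com:
  assumes "ireg s (Suc 0) = m"
  defines "F \<equiv> {j. j < m \<and> iarr m s 1 j = 0}"
  shows "runs w S output_com s (60 * m + 20) (\<lambda>s'. bij_betw (imem s') {..<card F} F)"
proof -
  let ?F = "\<lambda>j. F \<inter> {..<j}"
  have finF: "finite F" by (simp add: F_def)
  define I where "I s' \<longleftrightarrow> modifies m s s' {8, 16} {} {0} {} \<and> ireg s' 8 \<le> m \<and>
    ireg s' 16 = card (?F (ireg s' 8)) \<and>
    bij_betw (iarr m s' 0) {..<card (?F (ireg s' 8))} (?F (ireg s' 8))" for s'
  let ?body = "Seq (Cond (is_zero (IGet 1 (IReg 8)))
              (Seq (IPut 0 (IReg 16) (IReg 8)) (ISet 16 (plus1 (IReg 16)))) Skip)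
            (ISet 8 (plus1 (IReg 8)))"
  show ?thesis
    unfolding output_com_def
  proof (rule runs_Seq_rule)
    show "runs w S (Seq (ISet 8 (INum 0)) (ISet 16 (INum 0))) s 5 (\<lambda>s'. I s' \<and> ireg s' 8 = 0)"
      by (intro runs_wp_rule) (simp_all add: I_def modifies_def word_Some bij_betw_def)
  next
    fix s1 assume s1: "I s1 \<and> ireg s1 8 = 0"
    show "runs w S (While (ILess (IReg 8) (IReg 1)) ?body) s1 (60 * m + 10)
      (\<lambda>s'. bij_betw (imem s') {..<card F} F)"
    proof (rule runs_While_rule[where I = I and \<mu> = "\<lambda>s'. m - ireg s' 8" and N = m
          and t = "ccost ?body" and g = "\<lambda>s'. ireg s' 8 < m"])
      fix s' assume Is: "I s'"
      then have mo: "modifies m s s' {8, 16} {} {0} {}" by (auto simp: I_def)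
      note E = modifiesD[OF mo]
      let ?j = "ireg s' 8" and ?p = "ireg s' 16"
      have p: "?p = card (?F ?j)" using Is by (simp add: I_def)
      have "card (?F ?j) \<le> card {..<?j}" by (rule card_mono) auto
      then have pj: "?p \<le> ?j" using p by simp
      show "beval w S s' (ILess (IReg 8) (IReg 1)) = Some (?j < m)" using assms(1) E by simp
      {
        assume lt: "?j < m"
        have eff: "runs w S ?body s' (ccost ?body) (\<lambda>s''. modifies m s' s'' {8, 16} {} {0} {} \<and>
          ireg s'' 8 = Suc ?j \<and> ireg s'' 16 = (if ?j \<in> F then Suc ?p else ?p) \<and>
          iarr m s'' 0 = (if ?j \<in> F then (iarr m s' 0)(?p := ?j) else iarr m s' 0))"
          using assms(1) lt pj
          by (intro runs_wp) (simp add: E F_def word_Some plus1_def is_zero_def modifies_def)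
        show "runs w S ?body s' (ccost ?body) (\<lambda>s''. I s'' \<and> m - ireg s'' 8 < m - ?j)"
        proof (rule runs_mono[OF eff order_refl], elim conjE, intro conjI)
          fix s'' assume s'': "modifies m s' s'' {8, 16} {} {0} {}" "ireg s'' 8 = Suc ?j"
            "ireg s'' 16 = (if ?j \<in> F then Suc ?p else ?p)"
            "iarr m s'' 0 = (if ?j \<in> F then (iarr m s' 0)(?p := ?j) else iarr m s' 0)"
          have mo'': "modifies m s s'' {8, 16} {} {0} {}" by (rule modifies_trans[OF mo s''(1)]) auto
          have bij: "bij_betw (iarr m s' 0) {..<?p} (?F ?j)" using Is by (simp add: I_def)
          show "I s''"
          proof (cases "?j \<in> F")
            case True
            then have F': "?F (Suc ?j) = insert ?j (?F ?j)" by auto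
            have "bij_betw ((iarr m s' 0)(?p := ?j)) {..<?p} (?F ?j)"
              by (rule bij_betw_cong[THEN iffD1, OF _ bij]) auto
            then have "bij_betw ((iarr m s' 0)(?p := ?j)) (insert ?p {..<?p}) (insert ?j (?F ?j))"
              using notIn_Un_bij_betw[of ?p "{..<?p}" "(iarr m s' 0)(?p := ?j)" "?F ?j"] by simp
            moreover have "card (?F (Suc ?j)) = Suc ?p" unfolding F' p using finF by simp
            ultimately show ?thesis
              unfolding I_def using mo'' s''(2-4) True lt F' by (simp add: lessThan_Suc)
          next
            case False
            then have "?F (Suc ?j) = ?F ?j" by (auto simp: less_Suc_eq)
            then show ?thesis unfolding I_def using mo'' s''(2-4) False lt bij p by simp
          qed
          show "m - ireg s'' 8 < m - ?j" using s''(2) lt by simp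
        qed
      }
      assume "\<not> ?j < m"
      then have "?j = m" using Is by (simp add: I_def)
      moreover have "?F m = F" by (auto simp: F_def)
      ultimately have bij: "bij_betw (iarr m s' 0) {..<card F} F" using Is by (simp add: I_def)
      have "card F \<le> card {..<m}" by (rule card_mono) (auto simp: F_def)
      \<comment> \<open>Array 0 starts at address 0, so on these indices it coincides with the raw
        memory that the output convention refers to.\<close>
      then show "bij_betw (imem s') {..<card F} F"
        by (intro bij_betw_cong[THEN iffD1, OF _ bij]) (simp add: iarr_def)
    qed (use s1 in \<open>simp_all add: plus1_def is_zero_def\<close>)
  qed simp
qed

end

section \<open>Correctness and running time of the phases\<close>

context gtsp_machine
begin

lemma runs_phase_com:
  assumes ma: "matched k s" and k: "k < R"
  shows "runs w S phase_com s (5000 * (R * (G + R + 2))) (matched (Suc k))"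
proof -
  have ph: "in_phase k s" and rm: "row_matching c m k (iarr m s 2) (rarr m s 1) (rarr m s 2)"
    using ma matched_in_phase[OF ma k] by (auto simp: matched_def)
  let ?t4 = "5" and ?t3 = "1200 * R * (R + 1) + 50" and ?t2 = "100 * (k + 2)"
    and ?t1 = "2000 * (R * (G + R + 2)) + 50"
  show ?thesis
    unfolding phase_com_def
  proof (rule runs_Seq_rule[OF runs_prepare_com[OF ph rm]])
    fix s1 assume sg: "searching k s1"
    show "runs w S (Seq search_com (Seq augment_com (Seq mark_com (ISet 4 (plus1 (IReg 4)))))) s1
      (?t1 + (?t2 + (?t3 + ?t4))) (matched (Suc k))"
    proof (rule runs_Seq_rule[OF runs_search_com[OF sg] _ order_refl], elim conjE)
      fix s2 assume sg2: "searching k s2" and b: "ireg s2 10 \<in> tree_set k s2"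
      have ph2: "in_phase k s2" using sg2 by (simp add: searching_def)
      show "runs w S (Seq augment_com (Seq mark_com (ISet 4 (plus1 (IReg 4))))) s2 (?t2 + (?t3 + ?t4)) (matched (Suc k))"
      proof (rule runs_Seq_rule[OF runs_augment_com[OF sg2 b] _ order_refl], elim conjE)
        fix s3 assume mo3: "modifies m s2 s3 {12, 13, 14, 15} {1, 2} {2} {2}"
          and rm3: "row_matching c m (Suc k) (iarr m s3 2) (rarr m s3 1) (rarr m s3 2)"
          and im3: "iarr m s3 2 ` {..<Suc k} = insert (ireg s3 14) (iarr m s2 2 ` {..<k})"
          and f: "ireg s3 14 \<in> free s2"
        have conf3: "configured s3"
          by (rule modifies_configured[OF mo3]) (use ph2 in \<open>auto simp: in_phase_def\<close>)
        have free3: "free s3 = free s2" and arr3: "iarr m s3 5 = iarr m s2 5"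
          by (simp_all add: free_def modifiesD[OF mo3])
        have tab3: "table_ok s3" using ph2 by (auto simp: in_phase_def table_ok_def free3 arr3)
        have k3: "ireg s3 4 = k" using modifiesD(1)[OF mo3, of 4] ph2 by (simp add: in_phase_def)
        have f3: "ireg s3 14 \<in> free s3" using f free3 by simp
        show "runs w S (Seq mark_com (ISet 4 (plus1 (IReg 4)))) s3 (?t3 + ?t4) (matched (Suc k))"
        proof (rule runs_Seq_rule[OF runs_mark_com[OF conf3 tab3 f3] _ order_refl], elim conjE)
          fix s4 assume mo4: "modifies m s3 s4 {5, 6, 7, 8} {} {1, 5} {}"
            and free4: "free s4 = free s3 - {ireg s3 14}" and tab4: "table_ok s4"
          have conf4: "configured s4" by (rule modifies_configured[OF mo4 conf3]) auto
          have k4: "ireg s4 4 = k" using modifiesD(1)[OF mo4, of 4] k3 by simp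
          have arr4: "iarr m s4 2 = iarr m s3 2" "rarr m s4 = rarr m s3" using mo4 by (auto simp: modifies_def)
          let ?s5 = "s4\<lparr>ireg := (ireg s4)(4 := Suc k)\<rparr>"
          have "free s4 = {..<m} - iarr m s4 2 ` {..<Suc k}"
            unfolding free4 free3 arr4 im3 using ph2 by (auto simp: in_phase_def)
          then have "matched (Suc k) ?s5"
            using conf4 tab4 k rm3 arr4
            by (auto simp: matched_def configured_def loaded_def table_ok_def free_def)
          then show "runs w S (ISet 4 (plus1 (IReg 4))) s4 ?t4 (matched (Suc k))"
            using k k4 R_le_m by (intro runs_wp_rule) (simp_all add: plus1_def word_Some)
        qed
      qed
    qed
  next
    \<comment> \<open>The search dominates the phase: \<open>R\<close> and the cost
      \<open>R * (R + 1)\<close> of the repair are both at most \<open>Y\<close>.\<close>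
    define Y Z where "Y = R * (G + R + 2)" and "Z = R * (R + 1)"
    have "R \<le> Y" "Z \<le> Y" unfolding Y_def Z_def by (simp, intro mult_left_mono) simp_all
    then have "700 * (k + 1) + (2000 * Y + 50 + (100 * (k + 2) + (1200 * Z + 50 + 5))) \<le> 5000 * Y"
      using k by simp
    then show "700 * (k + 1) + (?t1 + (?t2 + (?t3 + ?t4))) \<le> 5000 * (R * (G + R + 2))"
      unfolding Y_def Z_def by (simp only: mult.assoc)
  qed
qed

text \<open>Filling the table takes \<open>R * G\<close> scans of length at most \<open>R\<close>.
  By \<open>RG_le\<close> this is \<open>O(m * R)\<close>, within the bound although every row looks
  at every column.\<close>

lemma runs_init_com:
  assumes ld: "loaded s" and zero: "\<And>j. j < m \<Longrightarrow> iarr m s 1 j = 0"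
  shows "runs w S init_com s (1200 * (R * G * (R + 1)) + 30 * R + 50) (matched 0)"
proof -
  let ?row = "Seq (ISet 6 (INum 0))
           (Seq (While (ILess (IReg 6) (IReg 3)) (Seq block_com (ISet 6 (plus1 (IReg 6)))))
                (ISet 5 (plus1 (IReg 5))))"
  have fr: "free s = {..<m}" using zero by (auto simp: free_def)
  have regs: "ireg s 0 = n" "ireg s (Suc 0) = m" using ld by (simp_all add: loaded_def)
  let ?Q = "\<lambda>s1. modifies m s s1 {2, 3, 5} {} {} {} \<and> configured s1 \<and> ireg s1 5 = 0"
  let ?t = "G * (1100 * (R + 1) + 15) + 20"
  show ?thesis
    unfolding init_com_def
  proof (rule runs_Seq_rule)
    have "word w ((m - 1) div R) = Some ((m - 1) div R)"
      using order_trans[OF div_le_dividend[of "m - 1" R]] by (intro word_Some) simp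
    moreover have "word w (Suc ((m - 1) div R)) = Some (Suc ((m - 1) div R))"
      using div_le_dividend[of "m - 1" R] by (intro word_Some) linarith
    ultimately show "runs w S (Seq (ISet 2 (IBin IMul (IReg 0) (IReg 0)))
         (Seq (ISet 3 (plus1 (IBin IDiv (IBin ISub (IReg 1) (INum 1)) (IReg 2)))) (ISet 5 (INum 0)))) s 30 ?Q"
      using regs ld R_pos R_le_m
      by (intro runs_wp_rule)
        (simp_all add: word_Some plus1_def modifies_def configured_def loaded_def G_def R_def[symmetric])
  next
    fix s1 assume s1: "?Q s1"
    then have mo1: "modifies m s s1 {2, 3, 5} {} {} {}" by simp
    have free1: "free s1 = {..<m}" using fr by (simp add: free_def modifiesD[OF mo1])
    define I where "I s' \<longleftrightarrow> configured s' \<and> free s' = {..<m} \<and> ireg s' 5 \<le> R \<and>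
      (\<forall>i<ireg s' 5. \<forall>g<G. entry_ok s' i g)" for s'
    show "runs w S (Seq (While (ILess (IReg 5) (IReg 2)) ?row) (ISet 4 (INum 0))) s1
      (R * (?t + 10) + 10 + 5) (matched 0)"
    proof (rule runs_Seq_rule[OF _ _ order_refl])
      show "runs w S (While (ILess (IReg 5) (IReg 2)) ?row) s1 (R * (?t + 10) + 10) (\<lambda>s'. I s' \<and> ireg s' 5 = R)"
      proof (rule runs_While_rule[where I = I and \<mu> = "\<lambda>s'. R - ireg s' 5" and N = R
          and t = "?t" and g = "\<lambda>s'. ireg s' 5 < R"])
        show "I s1" using s1 free1 by (simp add: I_def)
      next
        fix s' assume Is: "I s'"
        then have conf': "configured s'" by (simp add: I_def)
        note regs' = configuredD[OF conf']
        let ?i = "ireg s' 5"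
        show "beval w S s' (ILess (IReg 5) (IReg 2)) = Some (?i < R)" using regs' by simp
        {
          assume lt: "?i < R"
          define J where "J s'' \<longleftrightarrow> configured s'' \<and> free s'' = {..<m} \<and> ireg s'' 5 = ?i \<and> ireg s'' 6 \<le> G \<and>
            (\<forall>i g. g < G \<longrightarrow> i < ?i \<or> i = ?i \<and> g < ireg s'' 6 \<longrightarrow> entry_ok s'' i g)" for s''
          show "runs w S ?row s' ?t (\<lambda>s''. I s'' \<and> R - ireg s'' 5 < R - ?i)"
          proof (rule runs_Seq_rule)
            show "runs w S (ISet 6 (INum 0)) s' 3 (\<lambda>s''. J s'' \<and> ireg s'' 6 = 0)"
              using Is
              by (intro runs_wp_rule) (auto simp: word_Some J_def I_def configured_def loaded_def free_def entry_ok_def)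
          next
            fix s2 assume s2: "J s2 \<and> ireg s2 6 = 0"
            show "runs w S (Seq (While (ILess (IReg 6) (IReg 3)) (Seq block_com (ISet 6 (plus1 (IReg 6)))))
              (ISet 5 (plus1 (IReg 5)))) s2 (G * (1100 * (R + 1) + 15) + 5 + 5) (\<lambda>s''. I s'' \<and> R - ireg s'' 5 < R - ?i)"
            proof (rule runs_Seq_rule[OF _ _ order_refl])
              show "runs w S (While (ILess (IReg 6) (IReg 3)) (Seq block_com (ISet 6 (plus1 (IReg 6))))) s2
                (G * (1100 * (R + 1) + 15) + 5) (\<lambda>s''. J s'' \<and> ireg s'' 6 = G)"
              proof (rule runs_While_rule[where I = J and \<mu> = "\<lambda>s'. G - ireg s' 6" and N = G
                  and t = "1100 * (R + 1) + 5" and g = "\<lambda>s'. ireg s' 6 < G"])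
                fix s3 assume Js: "J s3"
                then have conf3: "configured s3" and i3: "ireg s3 5 < R" using lt by (auto simp: J_def)
                note regs3 = configuredD[OF conf3]
                show "beval w S s3 (ILess (IReg 6) (IReg 3)) = Some (ireg s3 6 < G)" using regs3 by simp
                {
                  assume g3: "ireg s3 6 < G"
                  show "runs w S (Seq block_com (ISet 6 (plus1 (IReg 6)))) s3 (1100 * (R + 1) + 5)
                    (\<lambda>s''. J s'' \<and> G - ireg s'' 6 < G - ireg s3 6)"
                  proof (rule runs_Seq_rule[OF runs_block_entry[OF conf3 i3 g3] _ order_refl], elim conjE)
                    fix s4 assume mo4: "modifies m s3 s4 {7, 8} {} {5} {}"
                      and en: "\<forall>i g. g < G \<longrightarrow> entry_ok s3 i g \<or> i = ireg s3 5 \<and> g = ireg s3 6 \<longrightarrow> entry_ok s4 i g"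
                    have conf4: "configured s4" by (rule modifies_configured[OF mo4 conf3]) auto
                    have free4: "free s4 = {..<m}" using Js by (simp add: free_def modifiesD[OF mo4] J_def)
                    have r4: "ireg s4 5 = ?i" "ireg s4 6 = ireg s3 6" using Js by (simp_all add: modifiesD[OF mo4] J_def)
                    let ?s5 = "s4\<lparr>ireg := (ireg s4)(6 := Suc (ireg s3 6))\<rparr>"
                    have "entry_ok ?s5 i g" if "g < G" "i < ?i \<or> i = ?i \<and> g < Suc (ireg s3 6)" for i g
                    proof -
                      have "entry_ok s4 i g" using en that Js unfolding J_def less_Suc_eq by metis
                      then show ?thesis by (simp add: entry_ok_def free_def)
                    qed
                    moreover have "configured ?s5" "free ?s5 = {..<m}"
                      using conf4 free4 by (simp_all add: configured_def loaded_def free_def)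
                    ultimately have J5: "J ?s5" using r4 g3 by (simp add: J_def)
                    have "g \<le> 2 * m" if "g < G" for g using table_index[OF R_pos that] by simp
                    then have "Suc (ireg s3 6) \<le> 50 * m + 49" using g3 by fastforce
                    then show "runs w S (ISet 6 (plus1 (IReg 6))) s4 5 (\<lambda>s''. J s'' \<and> G - ireg s'' 6 < G - ireg s3 6)"
                      using J5 g3 r4 by (intro runs_wp_rule) (simp_all add: plus1_def word_Some)
                  qed
                }
                assume "\<not> ireg s3 6 < G"
                then show "J s3 \<and> ireg s3 6 = G" using Js by (simp add: J_def)
              qed (use s2 in \<open>simp_all add: algebra_simps\<close>)
            next
              fix s3 assume s3: "J s3 \<and> ireg s3 6 = G"
              let ?s4 = "s3\<lparr>ireg := (ireg s3)(5 := Suc ?i)\<rparr>"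
              have "I ?s4" using s3 lt
                by (auto simp: I_def J_def configured_def loaded_def free_def entry_ok_def less_Suc_eq)
              then show "runs w S (ISet 5 (plus1 (IReg 5))) s3 5 (\<lambda>s''. I s'' \<and> R - ireg s'' 5 < R - ?i)"
                using s3 lt R_le_m by (intro runs_wp_rule) (simp_all add: plus1_def word_Some J_def)
            qed
          qed simp
        }
        assume "\<not> ireg s' 5 < R"
        then show "I s' \<and> ireg s' 5 = R" using Is by (simp add: I_def)
      qed (simp_all add: algebra_simps)
    next
      fix s2 assume s2: "I s2 \<and> ireg s2 5 = R"
      then show "runs w S (ISet 4 (INum 0)) s2 5 (matched 0)"
        by (intro runs_wp_rule)
          (auto simp: word_Some I_def matched_def configured_def loaded_def free_def table_ok_def entry_ok_def row_matching_def)
    qed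
  next
    have "G * 15 * R \<le> 15 * (R * G * (R + 1))" by simp
    then show "30 + (R * (?t + 10) + 10 + 5) \<le> 1200 * (R * G * (R + 1)) + 30 * R + 50"
      by (simp add: algebra_simps)
  qed
qed

text \<open>The \<open>R\<close> phases cost \<open>O(R * R * (G + R))\<close>. Here
  \<open>R * R * G \<le> 2 * m * R\<close> yields the term m n^2, and \<open>R * R * R\<close> is
  n^6.\<close>

lemma runs_matching_com:
  assumes "loaded s" "\<And>j. j < m \<Longrightarrow> iarr m s 1 j = 0"
  shows "runs w S matching_com s (30000 * (m * R + R * R * R)) (matched R)"
  unfolding matching_com_def
proof (rule runs_Seq_rule[OF runs_init_com[OF assms]])
  fix s1 assume s1: "matched 0 s1"
  show "runs w S (While (ILess (IReg 4) (IReg 2)) phase_com) s1 (R * (5000 * (R * (G + R + 2)) + 10) + 10) (matched R)"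
  proof (rule runs_While_rule[where I = "\<lambda>s'. matched (ireg s' 4) s'" and \<mu> = "\<lambda>s'. R - ireg s' 4" and N = R
          and t = "5000 * (R * (G + R + 2))" and g = "\<lambda>s'. ireg s' 4 < R"])
    show "matched (ireg s1 4) s1" using s1 by (simp add: matched_def)
  next
    fix s' assume ma: "matched (ireg s' 4) s'"
    then show "beval w S s' (ILess (IReg 4) (IReg 2)) = Some (ireg s' 4 < R)"
      by (auto simp: matched_def configured_def)
    {
      assume lt: "ireg s' 4 < R"
      show "runs w S phase_com s' (5000 * (R * (G + R + 2))) (\<lambda>s''. matched (ireg s'' 4) s'' \<and> R - ireg s'' 4 < R - ireg s' 4)"
      proof (rule runs_mono[OF runs_phase_com[OF ma lt] order_refl])
        fix s'' assume ma'': "matched (Suc (ireg s' 4)) s''"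
        moreover from this have "ireg s'' 4 = Suc (ireg s' 4)" by (simp add: matched_def)
        ultimately show "matched (ireg s'' 4) s'' \<and> R - ireg s'' 4 < R - ireg s' 4" using lt by simp
      qed
    }
    assume "\<not> ireg s' 4 < R"
    then have "ireg s' 4 = R" using ma by (simp add: matched_def)
    with ma show "matched R s'" by simp
  qed (simp_all add: algebra_simps)
next
  have RG: "R * G \<le> 2 * m" by (rule RG_le)
  have "R * G * (R + 1) \<le> 2 * m * (R + 1)" using RG by (rule mult_right_mono) simp
  also have "\<dots> \<le> 2 * m * (2 * R)" using R_pos by (intro mult_left_mono) simp_all
  finally have a: "R * G * (R + 1) \<le> 4 * (m * R)" by simp
  have "R * (R * G) \<le> R * (2 * m)" using RG by (rule mult_left_mono) simp
  moreover have "R * (2 * m) = 2 * (m * R)" by simp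
  moreover have "R * (R * (G + R + 2)) = R * (R * G) + R * R * R + 2 * (R * R)" by (simp add: algebra_simps)
  moreover have RR: "R * R \<le> R * R * R" using R_pos by simp
  ultimately have b: "R * (R * (G + R + 2)) \<le> 2 * (m * R) + 3 * (R * R * R)" by linarith
  have r: "R \<le> R * R * R" "1 \<le> R * R * R" using R_pos by simp_all
  define x y z q where "x = R * G * (R + 1)" and "y = R * (R * (G + R + 2))" and "z = R * R * R"
    and "q = m * R"
  have "1200 * x + 30 * R + 50 + (5000 * y + 10 * R + 10) \<le> 30000 * (q + z)"
    using a b r unfolding x_def[symmetric] y_def[symmetric] z_def[symmetric] q_def[symmetric] by simp
  moreover have "R * (5000 * (R * (G + R + 2)) + 10) = 5000 * y + 10 * R"
    by (simp add: y_def algebra_simps)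
  ultimately show "1200 * (R * G * (R + 1)) + 30 * R + 50 + (R * (5000 * (R * (G + R + 2)) + 10) + 10)
    \<le> 30000 * (m * R + R * R * R)"
    unfolding x_def z_def q_def by simp
qed

end

section \<open>From the computed matching to redundant paths\<close>

context gtsp_machine
begin

text \<open>The machine matches indices, the exchange argument points. Since \<open>vs\<close> and
  \<open>ts\<close> are distinct, base-\<open>n\<close> decoding is a bijection from row numbers to
  pairs of inner points and columns correspond to terminal pairs, so matching and potentials carry
  over.\<close>

lemma matched_free_redundant:
  assumes ma: "matched R s" and dvs: "distinct vs" and dts: "distinct ts"
  shows "card (free s) = m - R"
    and "\<exists>s'. gtsp_optimal (set vs) (set ts) s' \<and> (\<forall>j\<in>free s. redundant_path s' (ts ! j))"
proof -
  let ?M = "iarr m s 2" and ?u = "rarr m s 1" and ?v = "rarr m s 2"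
  let ?V = "set vs" and ?T = "set ts"
  have rm: "row_matching c m R ?M ?u ?v" and fr: "free s = {..<m} - ?M ` {..<R}"
    using ma by (auto simp: matched_def)
  have Mm: "\<And>i. i < R \<Longrightarrow> ?M i < m" and injM: "inj_on ?M {..<R}"
    using rm by (auto simp: row_matching_def)
  show "card (free s) = m - R"
    unfolding fr using Mm by (subst card_Diff_subset) (auto simp: card_image[OF injM])
  define row where "row i = (vs ! (i div n), vs ! (i mod n))" for i
  have inj: "inj_on row {..<R}"
  proof (rule inj_onI)
    fix i i' assume i: "i \<in> {..<R}" "i' \<in> {..<R}" "row i = row i'"
    then have "i div n < n" "i' div n < n" "i mod n < n" "i' mod n < n"
      using n_pos by (auto simp: R_def less_mult_imp_div_less)
    with i(3) have "i div n = i' div n" "i mod n = i' mod n"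
      using dvs by (auto simp: row_def nth_eq_iff_index_eq length_vs)
    then show "i = i'" by (metis div_mult_mod_eq)
  qed
  have "row ` {..<R} = ?V \<times> ?V"
  proof (rule card_subset_eq)
    show "row ` {..<R} \<subseteq> ?V \<times> ?V"
      using n_pos by (auto simp: row_def R_def length_vs less_mult_imp_div_less)
    show "card (row ` {..<R}) = card (?V \<times> ?V)"
      unfolding card_image[OF inj] using distinct_card[OF dvs]
      by (simp add: R_def length_vs card_cartesian_product)
  qed simp
  then have bij: "bij_betw row {..<R} (?V \<times> ?V)" using inj by (simp add: bij_betw_def)
  define ix where "ix = inv_into {..<R} row"
  have ix: "ix r < R" "row (ix r) = r" if "r \<in> ?V \<times> ?V" for r
    using that bij_betw_imp_surj_on[OF bij] inv_into_into[of r row "{..<R}"] f_inv_into_f[of r row "{..<R}"]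
    by (auto simp: ix_def)
  define N where "N i = ts ! ?M i" for i
  have injN: "inj_on N {..<R}"
    using injM Mm dts by (auto simp: N_def inj_on_def nth_eq_iff_index_eq length_ts)
  \<comment> \<open>The machine stores column potentials by row; here they are attached to terminal
    pairs, with zero for the unmatched ones, as the exchange argument demands.\<close>
  define v where "v p = (if p \<in> N ` {..<R} then ?v (inv_into {..<R} N p) else 0)" for p
  have vN: "v (N i) = ?v i" if "i < R" for i using that injN by (simp add: v_def)
  have ci: "c i j = detour (row i) (ts ! j)" for i j by (simp add: c_def row_def)
  have img: "(\<lambda>r. N (ix r)) ` (?V \<times> ?V) = N ` {..<R}"
    using bij_betw_imp_surj_on[OF bij_betw_inv_into[OF bij]] by (metis image_image ix_def)
  have "?T \<noteq> {}" using m_pos length_ts by auto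
  then obtain s0 where "gtsp_optimal ?V ?T s0" using gtsp_optimal_exists[of ?V ?T] by auto
  then have "\<exists>s'. gtsp_optimal ?V ?T s' \<and> (\<forall>p\<in>?T - (\<lambda>r. N (ix r)) ` (?V \<times> ?V). redundant_path s' p)"
  proof (rule optimal_within_matched[where u = "\<lambda>r. ?u (ix r)" and v = v])
    show "inj_on (\<lambda>r. N (ix r)) (?V \<times> ?V)"
      using injN ix by (intro inj_onI) (metis inj_onD lessThan_iff)
    show "(\<lambda>r. N (ix r)) ` (?V \<times> ?V) \<subseteq> ?T"
      unfolding img using Mm by (auto simp: N_def length_ts)
    show "?u (ix r) + v p \<le> detour r p" if r: "r \<in> ?V \<times> ?V" and p: "p \<in> ?T" for r p
    proof (cases "p \<in> N ` {..<R}")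
      case True
      then obtain i where i: "i < R" "p = N i" by auto
      have "?u (ix r) + ?v i \<le> c (ix r) (?M i)" using rm ix(1)[OF r] i(1) by (simp add: row_matching_def)
      then show ?thesis using vN[OF i(1)] ix(2)[OF r] i(2) by (simp add: ci N_def)
    next
      case False
      obtain j where j: "j < m" "p = ts ! j" using p by (auto simp: in_set_conv_nth length_ts)
      then have "j \<notin> ?M ` {..<R}" using False by (auto simp: N_def)
      then have "?u (ix r) \<le> c (ix r) j" using rm ix(1)[OF r] j(1) by (auto simp: row_matching_def)
      then show ?thesis using False ix(2)[OF r] j(2) by (simp add: ci v_def)
    qed
    show "?u (ix r) + v (N (ix r)) = detour r (N (ix r))" if r: "r \<in> ?V \<times> ?V" for r
    proof -
      have "?u (ix r) + ?v (ix r) = c (ix r) (?M (ix r))" using rm ix(1)[OF r] by (simp add: row_matching_def)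
      then show ?thesis using vN[OF ix(1)[OF r]] ix(2)[OF r] by (simp add: ci N_def)
    qed
    show "v p \<le> 0" for p
    proof (cases "p \<in> N ` {..<R}")
      case True
      then obtain i where "i < R" "p = N i" by auto
      then show ?thesis using vN rm by (auto simp: row_matching_def)
    qed (simp add: v_def)
    show "v p = 0" if "p \<in> ?T - (\<lambda>r. N (ix r)) ` (?V \<times> ?V)" for p
      using that unfolding img by (simp add: v_def)
  qed simp
  then obtain s' where s': "gtsp_optimal ?V ?T s'" "\<And>p. p \<in> ?T - N ` {..<R} \<Longrightarrow> redundant_path s' p"
    unfolding img by blast
  have "ts ! j \<in> ?T - N ` {..<R}" if "j \<in> free s" for j
    using that Mm dts unfolding fr by (auto simp: N_def nth_eq_iff_index_eq length_ts)
  with s' show "\<exists>s'. gtsp_optimal ?V ?T s' \<and> (\<forall>j\<in>free s. redundant_path s' (ts ! j))" by blast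
qed

end

theorem theorem1:
  shows "\<exists>(P :: com) (C :: nat).
    \<forall>(V :: point set) (T :: terminal_pair set) (n :: nat) (m :: nat)
      (vs :: point list) (ts :: terminal_pair list).
      finite V \<and> finite T \<and> card V = n \<and> card T = m \<and> m \<ge> n ^ 2 \<and>
      gtsp_promise V T \<and>
      distinct vs \<and> set vs = V \<and> distinct ts \<and> set ts = T \<longrightarrow>
      (\<exists>(time :: nat) (s' :: rr_state) (T0 :: terminal_pair set).
         rr_exec ((m + 2) ^ C) (C * max 1 m) P (rr_input vs ts) time s' \<and>
         time \<le> C * (if n = 0 then m + 1 else m * n ^ 2 + n ^ 6) \<and>
         rr_outputs s' ts (m - n ^ 2) T0 \<and>
         T0 \<subseteq> T \<and> card T0 = m - n ^ 2 \<and>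
         (\<exists>s. gtsp_optimal V T s \<and> (\<forall>p\<in>T0. redundant_path s p)))"
proof -
  \<comment> \<open>One number serves as exponent of the word bound and as factor of memory and
    time. The time is most demanding: 30000 for the matching, with room for the remaining
    \<open>60 * m + 30\<close>.\<close>
  define C where "C = (40000 :: nat)"
  have C: "40000 \<le> C" by (simp add: C_def)
  show ?thesis
  proof (rule exI[of _ gtsp_com], rule exI[of _ C], intro allI impI, elim conjE)
    fix V :: "point set" and T :: "terminal_pair set" and n m :: nat
      and vs :: "point list" and ts :: "terminal_pair list"
    assume fin: "finite V" "finite T" and card: "card V = n" "card T = m" and nm: "n ^ 2 \<le> m"
      and vs: "distinct vs" "set vs = V" and ts: "distinct ts" "set ts = T"
    have lvs: "length vs = n" and lts: "length ts = m"
      using vs ts card distinct_card[of vs] distinct_card[of ts] by auto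
    define w S where "w = (m + 2) ^ C" and "S = C * max 1 m"
    let ?s = "rr_input vs ts"
    \<comment> \<open>As \<open>m + 2\<close> is at least 2, its sixth power is at least 64 and
      absorbs the constant 50, so exponent 7 would already do for the word bound.\<close>
    have "50 * m + 50 \<le> (m + 2) * 2 ^ 6" by simp
    also have "\<dots> \<le> (m + 2) * (m + 2) ^ 6" by (intro mult_left_mono power_mono) auto
    also have "\<dots> = (m + 2) ^ 7" by (simp add: numeral_eq_Suc)
    also have "\<dots> \<le> w" unfolding w_def using C by (intro power_increasing) auto
    finally have words: "50 * m + 50 \<le> w" .
    have "50 * m \<le> C * m" using C by (intro mult_right_mono) auto
    also have "\<dots> \<le> S" unfolding S_def by (intro mult_left_mono) auto
    finally interpret array_machine w S m using words by unfold_locales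
    define F where "F s = {j. j < m \<and> iarr m s 1 j = 0}" for s
    define good where "good s \<longleftrightarrow> ireg s (Suc 0) = m \<and> card (F s) = m - n ^ 2 \<and>
      (\<exists>s'. gtsp_optimal V T s' \<and> (\<forall>j\<in>F s. redundant_path s' (ts ! j)))" for s
    have zero: "iarr m ?s 1 j = 0" for j by (simp add: iarr_def rr_input_def)
    let ?t = "if n = 0 then 0 else 30000 * (m * n ^ 2 + n ^ 6)"
    have first: "runs w S (Cond (ILess (INum 0) (IReg 0)) matching_com Skip) ?s (10 + ?t) good"
    proof (cases "n = 0")
      case True
      \<comment> \<open>With no inner points every path of every solution is the direct
        segment.\<close>
      then have "V = {}" using card fin by auto
      then obtain s' where s': "gtsp_optimal V T s'" using gtsp_optimal_exists[OF fin] by auto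
      then have "set (s' p) = {}" if "p \<in> T" for p
        using that \<open>V = {}\<close> by (simp add: gtsp_optimal_def gtsp_solution_def)
      then have red: "redundant_path s' (ts ! j)" if "j < m" for j
        using that nth_mem[of j ts] ts(2) lts by (simp add: redundant_path_def)
      have "F ?s = {..<m}" using zero by (auto simp: F_def)
      then have "good ?s"
        using s' red True lts by (auto simp: good_def rr_input_def)
      moreover have "ireg ?s 0 = 0" using lvs True by (simp add: rr_input_def)
      ultimately have "runs w S (Cond (ILess (INum 0) (IReg 0)) matching_com Skip) ?s (1 + bcost (ILess (INum 0) (IReg 0)) + (0 + 1)) good"
        by (intro runs_Cond[where x = False]) (auto simp: word_Some intro!: runs_wp_rule)
      then show ?thesis by (rule runs_mono) simp_all
    next
      case False
      interpret gtsp_machine w S m n vs ts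
        using False nm lvs lts by unfold_locales (auto simp: power2_eq_square)
      have ld: "loaded ?s" by (simp add: loaded_def lvs lts rr_input_def)
      have R: "R = n ^ 2" "m * R + R * R * R = m * n ^ 2 + n ^ 6"
        by (simp_all add: R_def power2_eq_square numeral_eq_Suc)
      have "runs w S matching_com ?s ?t good"
      proof (rule runs_mono[OF runs_matching_com[OF ld zero]])
        fix s1 assume ma: "matched R s1"
        have "ireg s1 (Suc 0) = m" using ma by (simp add: matched_def configuredD)
        moreover have "F s1 = free s1" by (simp add: F_def free_def)
        ultimately show "good s1"
          using matched_free_redundant[OF ma vs(1) ts(1)] vs ts by (simp add: good_def R(1))
      qed (use False R in simp)
      then have "runs w S (Cond (ILess (INum 0) (IReg 0)) matching_com Skip) ?s (1 + bcost (ILess (INum 0) (IReg 0)) + (?t + 1)) good"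
        using False lvs
        by (intro runs_Cond[where x = True]) (auto simp: word_Some rr_input_def)
      then show ?thesis by (rule runs_mono) simp_all
    qed
    have "runs w S gtsp_com ?s (10 + ?t + (60 * m + 20)) (\<lambda>s'. \<exists>s1. good s1 \<and> bij_betw (imem s') {..<card (F s1)} (F s1))"
      unfolding gtsp_com_def
    proof (rule runs_Seq_rule[OF first _ order_refl])
      fix s1 assume g: "good s1"
      then have "ireg s1 (Suc 0) = m" by (simp add: good_def)
      from runs_output_com[OF this]
      show "runs w S output_com s1 (60 * m + 20) (\<lambda>s'. \<exists>s1. good s1 \<and> bij_betw (imem s') {..<card (F s1)} (F s1))"
        by (rule runs_mono) (use g in \<open>auto simp: F_def\<close>)
    qed
    then obtain time s' s1 where ex: "rr_exec w S gtsp_com ?s time s'" "time \<le> 10 + ?t + (60 * m + 20)"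
      and g: "good s1" and "bij_betw (imem s') {..<card (F s1)} (F s1)"
      unfolding runs_def by blast
    then have bij: "bij_betw (imem s') {..<m - n ^ 2} (F s1)" by (simp add: good_def)
    let ?B = "if n = 0 then m + 1 else m * n ^ 2 + n ^ 6"
    let ?T0 = "(\<lambda>i. ts ! imem s' i) ` {..<m - n ^ 2}"
    have "10 + ?t + (60 * m + 20) \<le> 40000 * ?B"
    proof (cases "n = 0")
      case False
      \<comment> \<open>For positive \<open>n\<close> the linear output time is absorbed by
        \<open>m * n ^ 2\<close>, and the additive constants by \<open>n ^ 6\<close>.\<close>
      define x y where "x = m * n ^ 2" and "y = n ^ 6"
      have "m \<le> x" "1 \<le> y" using False by (simp_all add: x_def y_def)
      then have "10 + 30000 * (x + y) + (60 * m + 20) \<le> 40000 * (x + y)" by simp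
      then show ?thesis using False by (simp add: x_def y_def)
    qed simp
    also have "\<dots> \<le> C * ?B" using C by (rule mult_right_mono) simp
    finally have time: "time \<le> C * ?B" using ex(2) by simp
    have im: "imem s' i \<in> F s1" if "i < m - n ^ 2" for i using bij_betwE[OF bij] that by auto
    then have lt: "imem s' i < m" if "i < m - n ^ 2" for i using that by (auto simp: F_def)
    have injm: "inj_on (imem s') {..<m - n ^ 2}" using bij by (simp add: bij_betw_def)
    have "inj_on (\<lambda>i. ts ! imem s' i) {..<m - n ^ 2}"
      using injm lt ts(1) by (auto simp: inj_on_def nth_eq_iff_index_eq lts)
    then have "card ?T0 = m - n ^ 2" by (simp add: card_image)
    moreover have "?T0 \<subseteq> T" using lt ts(2) lts by auto
    moreover have "rr_outputs s' ts (m - n ^ 2) ?T0" using lt injm by (simp add: rr_outputs_def lts)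
    moreover have "\<exists>s. gtsp_optimal V T s \<and> (\<forall>p\<in>?T0. redundant_path s p)"
      using g im by (auto simp: good_def)
    ultimately show "\<exists>time s' T0. rr_exec ((m + 2) ^ C) (C * max 1 m) gtsp_com ?s time s' \<and> time \<le> C * ?B \<and>
         rr_outputs s' ts (m - n ^ 2) T0 \<and> T0 \<subseteq> T \<and> card T0 = m - n ^ 2 \<and>
         (\<exists>s. gtsp_optimal V T s \<and> (\<forall>p\<in>T0. redundant_path s p))"
      using ex(1)[unfolded w_def S_def] time by blast
  qed
qed

end
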